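(* Let $d,N\ge1$ be integers, let $\sigma>0$ and $\alpha>0$, and let $V_i:\mathbb R^d\to\mathbb R$ be $\alpha$-strongly convex for each $i\in\{1,\dots,N\}$. Let $P$ be a probability measure on a measurable space $\mathcal Z$, let $\ell:\mathbb R\times\mathcal Z\to\mathbb R$ and $h:\mathbb R^d\times\mathcal Z\to\mathbb R$, and let $$\mathcal F_0(\nu)=\int\ell\Bigl(\int h(\theta,z)\,\nu(d\theta),z\Bigr)\,P(dz),\qquad\nu\in\mathcal P_2(\mathbb R^d),$$ where, for every $z\in\mathcal Z$, the function $\ell(\cdot,z)$ is convex, $L_\ell$-Lipschitz and $\beta_\ell$-smooth (its derivative is $\beta_\ell$-Lipschitz), and $h(\cdot,z)$ is $L_h$-Lipschitz. Put $\beta=L_h^2\beta_\ell$ and $B=L_hL_\ell$, and assume that $\mathcal F_0$ satisfies: (A1) $\mathcal F_0((1-t)\nu_0+t\nu_1)\le (1-t)\mathcal F_0(\nu_0)+t\mathcal F_0(\nu_1)$ for all $\nu_0,\nu_1\in\mathcal P_2(\mathbb R^d)$, $t\in[0,1]$; (A2) $\|\nabla_1\nabla_2\delta^2\mathcal F_0(\nu,x,y)\|_{\mathrm{op}}\le\beta$ for all $\nu\in\mathcal P_2(\mathbb R^d)$, $x,y\in\mathbb R^d$; (A3) $\|\nabla\delta\mathcal F_0(\nu,x)\|\le B$ for all $\nu\in\mathcal P_2(\mathbb R^d)$, $x\in\mathbb R^d$. Let $\mu^{1:N}$ be the probability measure on $\mathbb R^{N\times d}$ with density $$\mu^{1:N}(x^{1:N})\propto\exp\Bigl(-\sum_{i=1}^NV_i(x^i)-\frac{2N}{\sigma^2}\,\mathcal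 F_0(\rho_{x^{1:N}})\Bigr),\qquad\rho_{x^{1:N}}=\frac1N\sum_{i=1}^N\delta_{x^i},$$ and let $\pi^1,\dots,\pi^N$ be probability measures on $\mathbb R^d$ with densities satisfying the coupled system $$\pi^i(x^i)\propto\exp\Bigl(-V_i(x^i)-\frac{2}{\sigma^2}\,\delta\mathcal F_0(\bar\pi,x^i)\Bigr),\quad i=1,\dots,N,\qquad\bar\pi=\frac1N\sum_{i=1}^N\pi^i,$$ where all these measures are assumed to be well-defined. Set $\pi^{1:N}=\bigotimes_{i=1}^N\pi^i$. Assume that each $\pi^i$ satisfies a Poincaré inequality with constant $\bar C_{\mathsf{PI}}$. Then $$\mathrm{KL}(\mu^{1:N}\,\|\,\pi^{1:N})\le\frac{\beta}{\sigma^2}\min\Bigl\{\bar C_{\mathsf{PI}},\ \frac{2}{\alpha}+\frac{8B^2}{\alpha^2\sigma^4}\Bigr\}.$$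
   Context: $\mathcal P_2(\mathbb R^d)$ is the set of probability measures on $\mathbb R^d$ with finite second moment. A point $x^{1:N}\in\mathbb R^{N\times d}$ is written $x^{1:N}=[x^1,\dots,x^N]$ with $x^i\in\mathbb R^d$. $\mathrm{KL}(\mu\|\pi)=\int\log\frac{d\mu}{d\pi}\,d\mu$. A probability measure $\nu$ satisfies a Poincaré inequality with constant $C$ if $\mathrm{Var}_\nu f\le C\,\mathbb E_\nu[\|\nabla f\|^2]$ for all smooth compactly supported $f:\mathbb R^d\to\mathbb R$. The first variation $\delta\mathcal F_0(\nu,x)$ is the linear functional derivative: $\frac{d}{dt}\big|_{t=0^+}\mathcal F_0((1-t)\nu+t\nu')=\int\delta\mathcal F_0(\nu,x)\,(\nu'-\nu)(dx)$ (up to an additive constant), and the second variation $\delta^2\mathcal F_0(\nu,x,y)$ is the first variation of $\nu\mapsto\delta\mathcal F_0(\nu,x)$. Here they are given by $$\delta\mathcal F_0(\nu,x)=\int\ell'\Bigl(\int h(\cdot,z)\,d\nu,z\Bigr)h(x,z)\,P(dz),\qquad \delta^2\mathcal F_0(\nu,x,y)=\int\ell''\Bigl(\int h(\cdot,z)\,d\nu,z\Bigr)h(x,z)h(y,z)\,P(dz),$$ where derivatives of $\ell$ are in its first argument. $\nabla\delta\mathcal F_0(\nu,x)$ is the gradient in $x$, and $\nabla_1\nabla_2\delta^2\mathcal F_0(\nu,x,y)$ is the $d\times d$ matrix of mixed derivatives in $x$ and $y$. $\mathcal F_0$ is assumed regular enough that these expressions make sense and the usual calculus along linear interpolations applies.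 *)

theory Defs
  imports "HOL-Probability.Probability"
begin

definition P2 :: "('a::euclidean_space) measure set" where
  "P2 = {\<nu>. prob_space \<nu> \<and> sets \<nu> = sets borel \<and> integrable \<nu> (\<lambda>x. (norm x)\<^sup>2)}"

text \<open>The finite nonnegative combination of Borel measures with weights \<open>w\<close>.\<close>

definition mixture :: "'i set \<Rightarrow> ('i \<Rightarrow> real) \<Rightarrow> ('i \<Rightarrow> 'a measure) \<Rightarrow> ('a::topological_space) measure" where
  "mixture I w \<nu> = measure_of UNIV (sets borel) (\<lambda>A. \<Sum>i\<in>I. ennreal (w i) * emeasure (\<nu> i) A)"

abbreviation interp :: "real \<Rightarrow> 'a measure \<Rightarrow> 'a measure \<Rightarrow> ('a::topological_space) measure" where
  "interp t \<nu>0 \<nu>1 \<equiv>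
     mixture UNIV (\<lambda>b. if b then t else 1 - t) (\<lambda>b. if b then \<nu>1 else \<nu>0)"

abbreviation average :: "nat \<Rightarrow> (nat \<Rightarrow> 'a measure) \<Rightarrow> ('a::topological_space) measure" where
  "average N \<nu> \<equiv> mixture {1..N} (\<lambda>i. 1 / real N) \<nu>"

abbreviation empirical :: "nat \<Rightarrow> (nat \<Rightarrow> 'a) \<Rightarrow> ('a::topological_space) measure" where
  "empirical N x \<equiv> average N (\<lambda>i. return borel (x i))"

lemma sets_mixture [simp, measurable_cong]: "sets (mixture I w \<nu>) = sets borel"
  unfolding mixture_def by (metis sets.sigma_sets_eq sets_measure_of space_borel sets.space_closed)

lemma space_mixture [simp]: "space (mixture I w \<nu>) = UNIV"
  using sets_eq_imp_space_eq[OF sets_mixture[of I w \<nu>]] by simp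

lemma emeasure_mixture:
  assumes "\<And>i. i \<in> I \<Longrightarrow> sets (\<nu> i) = sets borel" and A: "A \<in> sets borel"
  shows "emeasure (mixture I w \<nu>) A = (\<Sum>i\<in>I. ennreal (w i) * emeasure (\<nu> i) A)"
proof (rule emeasure_measure_of[OF mixture_def])
  show "countably_additive (sets (mixture I w \<nu>)) (\<lambda>A. \<Sum>i\<in>I. ennreal (w i) * emeasure (\<nu> i) A)"
  proof (rule countably_additiveI)
    fix F :: "nat \<Rightarrow> 'b set"
    assume F: "range F \<subseteq> sets (mixture I w \<nu>)" "disjoint_family F"
    have "(\<Sum>n. \<Sum>i\<in>I. ennreal (w i) * emeasure (\<nu> i) (F n))
        = (\<Sum>i\<in>I. \<Sum>n. ennreal (w i) * emeasure (\<nu> i) (F n))"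
      by (intro suminf_sum summableI)
    also have "\<dots> = (\<Sum>i\<in>I. ennreal (w i) * emeasure (\<nu> i) (\<Union>n. F n))"
      using F assms(1) by (intro sum.cong refl) (simp add: suminf_emeasure)
    finally show "(\<Sum>n. \<Sum>i\<in>I. ennreal (w i) * emeasure (\<nu> i) (F n))
        = (\<Sum>i\<in>I. ennreal (w i) * emeasure (\<nu> i) (\<Union>n. F n))" .
  qed
qed (use A in \<open>auto simp: positive_def\<close>)

text \<open>\<open>KL \<mu> \<pi>\<close> is the divergence of \<open>\<mu>\<close> from \<open>\<pi>\<close>; note the reversed argument order in the
  library constant. For probability measures with \<open>\<mu>\<close> absolutely continuous with respect to \<open>\<pi>\<close>,
  the negative part of the logarithmic density is always \<open>\<mu>\<close>-integrable, so failure of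
  integrability means that the integral is \<open>\<infinity>\<close>.\<close>

definition KL :: "'a measure \<Rightarrow> 'a measure \<Rightarrow> ereal" where
  "KL \<mu> \<pi> = (if absolutely_continuous \<pi> \<mu> \<and> integrable \<mu> (entropy_density (exp 1) \<pi> \<mu>)
             then ereal (KL_divergence (exp 1) \<pi> \<mu>) else \<infinity>)"

text \<open>\<open>\<mu>\<close> is a probability measure with density proportional to \<open>f\<close> with respect to \<open>M\<close>.\<close>

definition has_density_propto :: "'a measure \<Rightarrow> 'a measure \<Rightarrow> ('a \<Rightarrow> real) \<Rightarrow> bool" where
  "has_density_propto M \<mu> f \<longleftrightarrow> prob_space \<mu> \<and> (\<exists>c>0. \<mu> = density M (\<lambda>x. ennreal (c * f x)))"

definition strongly_convex :: "real \<Rightarrow> ('a::real_inner \<Rightarrow> real) \<Rightarrow> bool" where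
  "strongly_convex \<alpha> V \<longleftrightarrow>
     (\<forall>x y. \<forall>t\<in>{0..1}. V ((1 - t) *\<^sub>R x + t *\<^sub>R y)
        \<le> (1 - t) * V x + t * V y - \<alpha> / 2 * t * (1 - t) * (norm (x - y))\<^sup>2)"

primrec Ck :: "nat \<Rightarrow> ('a::euclidean_space \<Rightarrow> real) \<Rightarrow> bool" where
  "Ck 0 f \<longleftrightarrow> continuous_on UNIV f"
| "Ck (Suc k) f \<longleftrightarrow>
     f differentiable_on UNIV \<and> (\<forall>b\<in>Basis. Ck k (\<lambda>x. frechet_derivative f (at x) b))"

definition grad :: "('a::euclidean_space \<Rightarrow> real) \<Rightarrow> 'a \<Rightarrow> 'a" where
  "grad f x = (THE D. GDERIV f x :> D)"

definition poincare :: "('a::euclidean_space) measure \<Rightarrow> real \<Rightarrow> bool" where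
  "poincare \<nu> C \<longleftrightarrow>
     (\<forall>f. (\<forall>k. Ck k f) \<and> compact (closure {x. f x \<noteq> 0}) \<longrightarrow>
        (\<integral>x. (f x - (\<integral>y. f y \<partial>\<nu>))\<^sup>2 \<partial>\<nu>) \<le> C * (\<integral>x. (norm (grad f x))\<^sup>2 \<partial>\<nu>))"

text \<open>\<open>mixed_hessian G x y\<close> is the matrix of mixed derivatives of \<open>G\<close>, one in each argument.\<close>

definition mixed_hessian :: "(real^'d \<Rightarrow> real^'d \<Rightarrow> real) \<Rightarrow> real^'d \<Rightarrow> real^'d \<Rightarrow> real^'d^'d" where
  "mixed_hessian G x y = jacobian (\<lambda>u. grad (\<lambda>v. G u v) y) (at x)"

definition has_mixed_hessian :: "(real^'d \<Rightarrow> real^'d \<Rightarrow> real) \<Rightarrow> real^'d \<Rightarrow> real^'d \<Rightarrow> bool" where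
  "has_mixed_hessian G x y \<longleftrightarrow> (\<forall>u. (\<lambda>v. G u v) differentiable (at y)) \<and>
     (\<lambda>u. grad (\<lambda>v. G u v) y) differentiable (at x)"

definition first_variation ::
    "('a::euclidean_space measure \<Rightarrow> real) \<Rightarrow> ('a measure \<Rightarrow> 'a \<Rightarrow> real) \<Rightarrow> bool" where
  "first_variation F dF \<longleftrightarrow> (\<forall>\<nu>\<in>P2. \<forall>\<nu>'\<in>P2. integrable \<nu>' (dF \<nu>) \<and>
     ((\<lambda>t. F (interp t \<nu> \<nu>')) has_real_derivative
        ((\<integral>x. dF \<nu> x \<partial>\<nu>') - (\<integral>x. dF \<nu> x \<partial>\<nu>))) (at_right 0))"

definition F0 :: "'z measure \<Rightarrow> (real \<Rightarrow> 'z \<Rightarrow> real) \<Rightarrow> ('a \<Rightarrow> 'z \<Rightarrow> real) \<Rightarrow>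
    'a measure \<Rightarrow> real" where
  "F0 P l h \<nu> = (\<integral>z. l (\<integral>\<theta>. h \<theta> z \<partial>\<nu>) z \<partial>P)"

definition dF0 :: "'z measure \<Rightarrow> (real \<Rightarrow> 'z \<Rightarrow> real) \<Rightarrow> ('a \<Rightarrow> 'z \<Rightarrow> real) \<Rightarrow>
    'a measure \<Rightarrow> 'a \<Rightarrow> real" where
  "dF0 P l h \<nu> x = (\<integral>z. deriv (\<lambda>r. l r z) (\<integral>\<theta>. h \<theta> z \<partial>\<nu>) * h x z \<partial>P)"

definition d2F0 :: "'z measure \<Rightarrow> (real \<Rightarrow> 'z \<Rightarrow> real) \<Rightarrow> ('a \<Rightarrow> 'z \<Rightarrow> real) \<Rightarrow>
    'a measure \<Rightarrow> 'a \<Rightarrow> 'a \<Rightarrow> real" where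
  "d2F0 P l h \<nu> x y =
     (\<integral>z. deriv (deriv (\<lambda>r. l r z)) (\<integral>\<theta>. h \<theta> z \<partial>\<nu>) * h x z * h y z \<partial>P)"

text \<open>The standing regularity assumption: the integrals and derivatives in \<open>F0\<close>, \<open>dF0\<close>,
  \<open>d2F0\<close>, the gradient of the first variation and the mixed Hessian of the second variation all
  exist, and \<open>dF0\<close>, \<open>d2F0\<close> are indeed the first and second variation of \<open>F0\<close> along linear
  interpolations.\<close>

definition regular :: "'z measure \<Rightarrow> (real \<Rightarrow> 'z \<Rightarrow> real) \<Rightarrow> (real^'d \<Rightarrow> 'z \<Rightarrow> real) \<Rightarrow> bool" where
  "regular P l h \<longleftrightarrow>
     (\<lambda>(r, z). l r z) \<in> borel_measurable (borel \<Otimes>\<^sub>M P) \<and>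
     (\<lambda>(x, z). h x z) \<in> borel_measurable (borel \<Otimes>\<^sub>M P) \<and>
     (\<forall>z\<in>space P. (\<lambda>r. l r z) differentiable_on UNIV \<and> deriv (\<lambda>r. l r z) differentiable_on UNIV) \<and>
     (\<forall>\<nu>\<in>P2. integrable P (\<lambda>z. l (\<integral>\<theta>. h \<theta> z \<partial>\<nu>) z)) \<and>
     (\<forall>\<nu>\<in>P2. \<forall>x. integrable P (\<lambda>z. deriv (\<lambda>r. l r z) (\<integral>\<theta>. h \<theta> z \<partial>\<nu>) * h x z)) \<and>
     (\<forall>\<nu>\<in>P2. \<forall>x y. integrable P
        (\<lambda>z. deriv (deriv (\<lambda>r. l r z)) (\<integral>\<theta>. h \<theta> z \<partial>\<nu>) * h x z * h y z)) \<and>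
     (\<forall>\<nu>\<in>P2. dF0 P l h \<nu> differentiable_on UNIV) \<and>
     (\<forall>\<nu>\<in>P2. \<forall>x y. has_mixed_hessian (d2F0 P l h \<nu>) x y) \<and>
     first_variation (F0 P l h) (dF0 P l h) \<and>
     (\<forall>x. first_variation (\<lambda>\<nu>. dF0 P l h \<nu> x) (\<lambda>\<nu>. d2F0 P l h \<nu> x))"

end

theory Submission
  imports Defs
begin

text \<open>By convexity of \<open>l\<close>, the density of \<open>\<mu>\<close> with respect to the product \<open>Q\<close> of the \<open>\<pi> i\<close> is
  proportional to \<open>exp (- k \<Delta>)\<close> with \<open>k = 2 N / \<sigma>\<^sup>2\<close>, where the Bregman remainder \<open>\<Delta> \<ge> 0\<close> of \<open>F0\<close> at
  the average is an integral of Bregman remainders of \<open>l\<close>. By Jensen's inequality the divergence is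
  at most \<open>k\<close> times the \<open>Q\<close>-mean of \<open>\<Delta>\<close>, and smoothness of \<open>l\<close> together with independence bounds
  this mean by variances of the Lipschitz functions \<open>h(\<cdot>, z)\<close> under the single \<open>\<pi> i\<close>. These variances
  are controlled either by the Poincare inequality (after smoothing \<open>h(\<cdot>, z)\<close>), or by the following
  comparison with the strongly log-concave measure \<open>\<gamma>\<close> of density proportional to \<open>exp (- V i)\<close>:
  the Prekopa-Leindler inequality shows that Lipschitz functions are sub-Gaussian under \<open>\<gamma>\<close> with the
  sharp constant and that the exponential moments of a Lipschitz perturbation \<open>g\<close> of order \<open>3/2\<close> and
  \<open>1\<close> are comparable, and the entropy inequality transfers the Gaussian moment
  \<open>E exp (\<kappa> (f - E f)\<^sup>2) \<le> 2\<close> from \<open>\<gamma>\<close> to the perturbed measure.\<close>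

section \<open>The Prekopa-Leindler inequality\<close>

text \<open>The linear part of \<open>F0\<close> at \<open>average N \<pi>\<close> is a sum over the
  particles, and the coupled system puts exactly these terms into the exponents of the
  \<open>\<pi> i\<close>. Hence only a second-order remainder survives in the density relative to
  the product measure. Its sign lets the divergence be bounded by the logarithm of the normalizing
  constant alone. The variance of an average of \<open>N\<close> independent terms carries a factor
  \<open>1 / N\<close>, which cancels the \<open>N\<close> in \<open>k\<close>, so the bound is free
  of \<open>N\<close>.

  Only variances of Lipschitz functions enter. The obstacle is the second constant, which reads
  \<open>2 / \<alpha> + 2 * b^2 / \<alpha>^2\<close> with \<open>b = 2 * B / \<sigma>^2\<close> the
  Lipschitz constant of the perturbation. That perturbation is unbounded, so a bounded-perturbation
  argument does not apply, and \<open>V i\<close> need not be differentiable. Prekopa-Leindler needs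
  nothing but the strong convexity inequality itself. It is used with integer weights, so that all
  exponents are natural powers, which are available for \<open>ennreal\<close>.\<close>

lemma emeasure_le_compact_inner:
  fixes A :: "'a::euclidean_space set"
  assumes A: "A \<in> sets borel"
    and le: "\<And>K. compact K \<Longrightarrow> K \<subseteq> A \<Longrightarrow> emeasure lborel K \<le> r"
  shows "emeasure lborel A \<le> r"
proof (rule ennreal_le_epsilon)
  fix e :: real assume e: "0 < e"
  obtain T where T: "closed T" "T \<subseteq> A" "emeasure lebesgue (A - T) < ennreal e"
    using sets_lebesgue_inner_closed[OF _ e, of A] A sets_completionI_sets[of A lborel]
    by (metis sets_lborel)
  have Tb: "T \<in> sets borel" using T by auto
  have "emeasure lborel T = (SUP k::nat. emeasure lborel (T \<inter> cball 0 (real k)))"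
  proof -
    have "(\<Union>k::nat. T \<inter> cball 0 (real k)) = T"
    proof (intro equalityI subsetI)
      fix x assume "x \<in> T"
      then show "x \<in> (\<Union>k::nat. T \<inter> cball 0 (real k))"
        using real_arch_simple[of "norm x"] by auto
    qed auto
    moreover have "(SUP k::nat. emeasure lborel (T \<inter> cball 0 (real k)))
        = emeasure lborel (\<Union>k::nat. T \<inter> cball 0 (real k))"
      using Tb by (intro SUP_emeasure_incseq) (auto simp: incseq_def)
    ultimately show ?thesis by simp
  qed
  also have "\<dots> \<le> r"
    by (intro SUP_least le closed_Int_compact T compact_cball le_infI1)
  finally have 1: "emeasure lborel T \<le> r" .
  have "emeasure lborel A \<le> emeasure lborel T + emeasure lborel (A - T)"
    using A Tb T(2) by (subst plus_emeasure) (auto simp: Un_absorb1)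
  also have "\<dots> \<le> emeasure lborel T + ennreal e"
    using T(3) A Tb by (intro add_left_mono) simp
  also have "\<dots> \<le> r + ennreal e" by (rule add_right_mono[OF 1])
  finally show "emeasure lborel A \<le> r + ennreal e" .
qed

text \<open>Brunn-Minkowski on the line. For compact \<open>K\<close> and \<open>L\<close>,
  translating \<open>K\<close> by the minimum of \<open>L\<close> and \<open>L\<close> by the
  maximum of \<open>K\<close> gives two subsets of \<open>C\<close> that meet in at most one point;
  inner regularity passes to Borel sets. The superset \<open>C\<close> stands in for the sumset,
  which need not be Borel.\<close>

lemma emeasure_lborel_sumset:
  fixes A B C :: "real set"
  assumes [measurable]: "A \<in> sets borel" "B \<in> sets borel" "C \<in> sets borel"
    and ne: "A \<noteq> {}" "B \<noteq> {}"
    and sub: "\<And>x y. x \<in> A \<Longrightarrow> y \<in> B \<Longrightarrow> x + y \<in> C"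
  shows "emeasure lborel A + emeasure lborel B \<le> emeasure lborel C"
proof -
  have translate: "emeasure lborel ((+) c ` K) = emeasure lborel K" if "compact K" for c :: real and K
  proof -
    have "emeasure lborel K = emeasure (distr lborel borel ((+) (-c))) K"
      by (simp add: lborel_distr_plus)
    also have "\<dots> = emeasure lborel ((+) (-c) -` K)"
      using that by (subst emeasure_distr) (auto intro: borel_compact)
    also have "(+) (-c) -` K = (+) c ` K" by force
    finally show ?thesis by simp
  qed
  have key: "emeasure lborel K + emeasure lborel L \<le> emeasure lborel C"
    if K: "compact K" "K \<subseteq> A" "K \<noteq> {}" and L: "compact L" "L \<subseteq> B" "L \<noteq> {}" for K L
  proof -
    obtain a where a: "a \<in> K" "\<And>x. x \<in> K \<Longrightarrow> x \<le> a" using compact_attains_sup[of K] K by auto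
    obtain b where b: "b \<in> L" "\<And>x. x \<in> L \<Longrightarrow> b \<le> x" using compact_attains_inf[of L] L by auto
    have cK: "compact ((+) b ` K)" and cL: "compact ((+) a ` L)"
      using K L by (auto intro: compact_translation)
    have null: "(+) b ` K \<inter> (+) a ` L \<subseteq> {a + b}"
    proof
      fix z assume "z \<in> (+) b ` K \<inter> (+) a ` L"
      then obtain x y where xy: "x \<in> K" "y \<in> L" "z = b + x" "z = a + y" by auto
      with a(2)[of x] b(2)[of y] show "z \<in> {a + b}" by auto
    qed
    have [measurable]: "(+) b ` K \<in> sets borel" "(+) a ` L \<in> sets borel"
      using cK cL by (auto intro: borel_compact)
    have "emeasure lborel K + emeasure lborel L
      = emeasure lborel ((+) b ` K) + emeasure lborel ((+) a ` L)"
      using translate K L by simp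
    also have "emeasure lborel ((+) a ` L) = emeasure lborel ((+) a ` L - {a + b})"
      by (subst emeasure_Diff_null_set) auto
    also have "emeasure lborel ((+) b ` K) + \<dots> = emeasure lborel ((+) b ` K \<union> ((+) a ` L - {a + b}))"
      using null by (subst plus_emeasure) auto
    also have "\<dots> \<le> emeasure lborel C"
    proof (rule emeasure_mono)
      show "(+) b ` K \<union> ((+) a ` L - {a + b}) \<subseteq> C"
      proof
        fix z assume "z \<in> (+) b ` K \<union> ((+) a ` L - {a + b})"
        then consider x where "x \<in> K" "z = x + b" | y where "y \<in> L" "z = a + y"
          by (auto simp: add.commute)
        then show "z \<in> C" using a(1) b(1) K(2) L(2) sub by cases auto
      qed
    qed simp
    finally show ?thesis .
  qed
  obtain a0 b0 where ab0: "a0 \<in> A" "b0 \<in> B" using ne by auto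
  \<comment> \<open>Releases one factor from compactness. The extreme points used in
    \<open>key\<close> require nonempty sets, so a point \<open>x0\<close> of \<open>X\<close> is
    inserted into \<open>K\<close>.\<close>
  have sup: "emeasure lborel X \<le> emeasure lborel C - r"
    if X: "X \<in> sets borel" "x0 \<in> X"
      and le: "\<And>K. compact K \<Longrightarrow> K \<subseteq> X \<Longrightarrow> K \<noteq> {} \<Longrightarrow> emeasure lborel K + r \<le> emeasure lborel C"
    for X :: "real set" and x0 r
  proof (rule emeasure_le_compact_inner[OF X(1)])
    fix K assume K: "compact K" "K \<subseteq> X"
    have "emeasure lborel K \<le> emeasure lborel (insert x0 K)"
      using K by (intro emeasure_mono) (auto intro: borel_compact)
    then have "emeasure lborel K + r \<le> emeasure lborel (insert x0 K) + r"
      by (rule add_right_mono)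
    also have "\<dots> \<le> emeasure lborel C"
      using K X by (intro le) auto
    finally show "emeasure lborel K \<le> emeasure lborel C - r"
      by (simp add: ennreal_le_minus_iff)
  qed
  have step: "emeasure lborel B + emeasure lborel K \<le> emeasure lborel C"
    if K: "compact K" "K \<subseteq> A" "K \<noteq> {}" for K
  proof -
    have "emeasure lborel B \<le> emeasure lborel C - emeasure lborel K"
      using key[OF K] ab0 by (intro sup[of B b0]) (auto simp: add.commute)
    \<comment> \<open>Subtraction in \<open>ennreal\<close> is truncated at 0, so turning the
      difference back into a sum needs this comparison.\<close>
    moreover have "emeasure lborel K \<le> emeasure lborel C"
      using key[OF K, of "{b0}"] ab0 by simp
    ultimately show ?thesis by (auto simp: ennreal_le_minus_iff)
  qed
  have "emeasure lborel A \<le> emeasure lborel C - emeasure lborel B"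
    using step ab0 by (intro sup[of A a0]) (auto simp: add.commute)
  moreover have "emeasure lborel B \<le> emeasure lborel C"
    using step[of "{a0}"] ab0 by simp
  ultimately show ?thesis by (auto simp: ennreal_le_minus_iff)
qed

lemma emeasure_lborel_scale:
  fixes A :: "real set"
  assumes [measurable]: "A \<in> sets borel" and c: "c > 0"
  shows "emeasure lborel {x. x / c \<in> A} = ennreal c * emeasure lborel A"
proof -
  have "emeasure lborel {x. x / c \<in> A} = (\<integral>\<^sup>+x. indicator {x. x / c \<in> A} x \<partial>lborel)"
    by (rule nn_integral_indicator[symmetric]) measurable
  also have "\<dots> = (\<integral>\<^sup>+x. indicator A (x / c) \<partial>lborel)"
    by (simp add: indicator_def)
  also have "\<dots> = ennreal c * (\<integral>\<^sup>+x. indicator A x \<partial>lborel)"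
    using c by (subst nn_integral_real_affine[where c=c and t=0]) auto
  finally show ?thesis by simp
qed

text \<open>Layer cake with the levels cut off at 1. For functions bounded by 1 the cut loses
  nothing; for the dominating function it only decreases the integral, which is the harmless
  direction.\<close>

lemma nn_integral_superlevel:
  fixes f :: "'a \<Rightarrow> ennreal"
  assumes "sigma_finite_measure M" and [measurable]: "f \<in> borel_measurable M"
  shows "(\<integral>\<^sup>+t. indicator {0<..<1::real} t * emeasure M {x\<in>space M. ennreal t < f x} \<partial>lborel)
    = (\<integral>\<^sup>+x. min (f x) 1 \<partial>M)"
proof -
  interpret M: sigma_finite_measure M by fact
  interpret pair_sigma_finite lborel M ..
  define g :: "real \<Rightarrow> 'a \<Rightarrow> ennreal" where "g t x = (if ennreal t < f x then indicator {0<..<1} t else 0)" for t x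
  have [measurable]: "(\<lambda>(t, x). g t x) \<in> borel_measurable (lborel \<Otimes>\<^sub>M M)"
    unfolding g_def split_beta' by measurable
  have "(\<integral>\<^sup>+t. indicator {0<..<1::real} t * emeasure M {x\<in>space M. ennreal t < f x} \<partial>lborel)
    = (\<integral>\<^sup>+t. (\<integral>\<^sup>+x. g t x \<partial>M) \<partial>lborel)"
  proof (rule nn_integral_cong)
    fix t
    have "indicator {0<..<1::real} t * emeasure M {x\<in>space M. ennreal t < f x}
      = (\<integral>\<^sup>+x. indicator {0<..<1::real} t * indicator {x\<in>space M. ennreal t < f x} x \<partial>M)"
      by (simp add: nn_integral_cmult)
    also have "\<dots> = (\<integral>\<^sup>+x. g t x \<partial>M)"
      by (rule nn_integral_cong) (simp add: g_def split: split_indicator)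
    finally show "indicator {0<..<1::real} t * emeasure M {x\<in>space M. ennreal t < f x} = (\<integral>\<^sup>+x. g t x \<partial>M)" .
  qed
  also have "\<dots> = (\<integral>\<^sup>+x. (\<integral>\<^sup>+t. g t x \<partial>lborel) \<partial>M)"
    by (rule Fubini'[symmetric]) measurable
  also have "\<dots> = (\<integral>\<^sup>+x. min (f x) 1 \<partial>M)"
  proof (rule nn_integral_cong)
    fix x assume [measurable]: "x \<in> space M"
    have "(\<integral>\<^sup>+t. g t x \<partial>lborel) = (\<integral>\<^sup>+t. indicator {t. 0 < t \<and> t < 1 \<and> ennreal t < f x} t \<partial>lborel)"
      by (rule nn_integral_cong) (simp add: g_def split: split_indicator)
    also have "\<dots> = emeasure lborel {t. 0 < t \<and> t < 1 \<and> ennreal t < f x}"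
      by (rule nn_integral_indicator) measurable
    also have "\<dots> = min (f x) 1"
    proof (cases "1 \<le> f x")
      case True
      have "ennreal t < f x" if "t < 1" for t
        using that True by (rule_tac less_le_trans[of "ennreal t" 1]) (auto simp: ennreal_less_one_iff)
      then have "{t. 0 < t \<and> t < 1 \<and> ennreal t < f x} = {0<..<1}"
        by auto
      then show ?thesis using True by (simp add: min_absorb2)
    next
      case False
      then obtain r where r: "f x = ennreal r" "0 \<le> r" "r < 1"
        by (cases "f x") (auto simp: not_le ennreal_less_one_iff)
      then have "{t. 0 < t \<and> t < 1 \<and> ennreal t < f x} = {0<..<r}"
        by (auto simp: ennreal_less_iff)
      then show ?thesis using r by (simp add: min_absorb1)
    qed
    finally show "(\<integral>\<^sup>+t. g t x \<partial>lborel) = min (f x) 1" .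
  qed
  finally show ?thesis .
qed

section \<open>Prekopa-Leindler on the line\<close>

text \<open>Weighted AM-GM: after division by the mean \<open>s\<close>, each factor
  \<open>c / s\<close> is at most \<open>exp (c / s - 1)\<close>, and the weighted exponents add up
  to 0.\<close>

lemma amgm_power_real:
  fixes a b :: real
  assumes "0 \<le> a" "0 \<le> b" "0 < m" "0 < n"
  shows "a ^ m * b ^ n \<le> ((real m * a + real n * b) / real (m + n)) ^ (m + n)"
proof (cases "a = 0 \<or> b = 0")
  case True
  then show ?thesis using assms by (auto simp: power_0_left)
next
  case False
  define s where "s = (real m * a + real n * b) / real (m + n)"
  have p: "real m * a + real n * b > 0"
    using assms False by (intro add_pos_pos mult_pos_pos) auto
  then have s: "s > 0" using assms by (auto simp: s_def)
  have *: "(c / s) ^ k \<le> exp (real k * (c / s - 1))" if "0 \<le> c" for c k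
  proof -
    have "c / s \<le> exp (c / s - 1)" using exp_ge_add_one_self[of "c / s - 1"] by simp
    then have "(c / s) ^ k \<le> exp (c / s - 1) ^ k" using that s by (intro power_mono) auto
    then show ?thesis by (simp add: exp_of_nat_mult)
  qed
  have "(a / s) ^ m * (b / s) ^ n \<le> exp (real m * (a / s - 1)) * exp (real n * (b / s - 1))"
    using assms s by (intro mult_mono * ) auto
  also have "\<dots> = exp ((real m * a + real n * b) / s - real (m + n))"
    using s by (simp add: exp_add[symmetric] field_simps)
  also have "(real m * a + real n * b) / s = real (m + n)"
    using p by (simp add: s_def)
  finally have "a ^ m * b ^ n / s ^ (m + n) \<le> 1"
    by (simp add: power_divide power_add)
  then have "a ^ m * b ^ n \<le> s ^ (m + n)" using s by (simp add: divide_le_eq)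
  then show ?thesis by (simp only: s_def)
qed

lemma amgm_power_ennreal:
  fixes a b c :: ennreal
  assumes "0 < m" "0 < n" and le: "of_nat m * a + of_nat n * b \<le> of_nat (m + n) * c"
  shows "a ^ m * b ^ n \<le> c ^ (m + n)"
proof (cases "c = top")
  case True
  then show ?thesis using assms by (simp add: power_eq_top_ennreal_iff)
next
  case False
  have "of_nat (m + n) * c < top" using False by (simp add: less_top[symmetric] ennreal_mult_eq_top_iff del: of_nat_add)
  then have "of_nat m * a < top" "of_nat n * b < top"
    using le by (auto dest: order.strict_trans1)
  then have "a < top" "b < top" using assms(1,2) by (auto simp: ennreal_mult_less_top)
  then obtain a' b' where ab: "a = ennreal a'" "b = ennreal b'" "0 \<le> a'" "0 \<le> b'"
    by (cases a; cases b) auto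
  obtain c' where c: "c = ennreal c'" "0 \<le> c'" using False by (cases c) auto
  have "ennreal (real m * a' + real n * b') = of_nat m * a + of_nat n * b"
    using ab by (simp add: ennreal_mult ennreal_of_nat_eq_real_of_nat)
  also note le
  also have "of_nat (m + n) * c = ennreal (real (m + n) * c')"
    using c by (simp add: ennreal_mult ennreal_of_nat_eq_real_of_nat del: of_nat_add)
  finally have "ennreal (real m * a' + real n * b') \<le> ennreal (real (m + n) * c')" .
  then have "(real m * a' + real n * b') / real (m + n) \<le> c'"
    using assms(1,2) c by (subst (asm) ennreal_le_iff) (auto simp: divide_le_eq mult.commute)
  then have "((real m * a' + real n * b') / real (m + n)) ^ (m + n) \<le> c' ^ (m + n)"
    using ab by (intro power_mono) auto
  with amgm_power_real[OF ab(3,4) assms(1,2)] have "a' ^ m * b' ^ n \<le> c' ^ (m + n)" by linarith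
  then show ?thesis using ab c by (simp add: ennreal_power ennreal_mult[symmetric] ennreal_leI)
qed

text \<open>Equal suprema make both superlevel sets nonempty at every level below 1, so the sumset
  inequality applies level by level and integrates to an additive bound. This is stronger than the
  product form, which follows by AM-GM.\<close>

lemma prekopa_leindler_real_normalized:
  fixes u v w :: "real \<Rightarrow> ennreal"
  assumes [measurable]: "u \<in> borel_measurable borel" "v \<in> borel_measurable borel" "w \<in> borel_measurable borel"
    and mn: "0 < m" "0 < n"
    and sup: "(SUP x. u x) = 1" "(SUP x. v x) = 1"
    and le: "\<And>x y. u x ^ m * v y ^ n \<le> w ((real m * x + real n * y) / real (m + n)) ^ (m + n)"
  shows "of_nat m * (\<integral>\<^sup>+x. u x \<partial>lborel) + of_nat n * (\<integral>\<^sup>+x. v x \<partial>lborel)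
    \<le> of_nat (m + n) * (\<integral>\<^sup>+x. w x \<partial>lborel)"
proof -
  have u1: "u x \<le> 1" and v1: "v x \<le> 1" for x
    using sup by (metis SUP_upper UNIV_I)+
  have pos: "real m > 0" "real n > 0" "real (m + n) > 0" using mn by auto
  have lev: "of_nat m * emeasure lborel {x. ennreal t < u x} + of_nat n * emeasure lborel {x. ennreal t < v x}
    \<le> of_nat (m + n) * emeasure lborel {x. ennreal t < w x}" if t: "0 < t" "t < 1" for t
  proof -
    have t1: "ennreal t < 1" using t by (simp add: ennreal_less_one_iff)
    \<comment> \<open>These are the superlevel sets dilated by \<open>m\<close>, \<open>n\<close>
      and \<open>m + n\<close>, so that a plain sum of points replaces the weighted mean.\<close>
    have "emeasure lborel {x. x / real m \<in> {x. ennreal t < u x}} + emeasure lborel {x. x / real n \<in> {x. ennreal t < v x}}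
      \<le> emeasure lborel {x. x / real (m + n) \<in> {x. ennreal t < w x}}"
    proof (rule emeasure_lborel_sumset)
      obtain x where x: "ennreal t < u x" using sup(1) t1 by (metis less_SUP_iff)
      obtain y where y: "ennreal t < v y" using sup(2) t1 by (metis less_SUP_iff)
      show "{x. x / real m \<in> {x. ennreal t < u x}} \<noteq> {}"
        using x pos by (auto intro!: exI[of _ "real m * x"])
      show "{x. x / real n \<in> {x. ennreal t < v x}} \<noteq> {}"
        using y pos by (auto intro!: exI[of _ "real n * y"])
      fix x y assume "x \<in> {x. x / real m \<in> {x. ennreal t < u x}}" "y \<in> {x. x / real n \<in> {x. ennreal t < v x}}"
      then have xy: "ennreal t < u (x / real m)" "ennreal t < v (y / real n)" by auto
      have eq: "(real m * (x / real m) + real n * (y / real n)) / real (m + n) = (x + y) / real (m + n)"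
        using pos by simp
      have "\<not> w ((x + y) / real (m + n)) \<le> ennreal t"
      proof
        assume "w ((x + y) / real (m + n)) \<le> ennreal t"
        then have "w ((x + y) / real (m + n)) ^ (m + n) \<le> ennreal t ^ (m + n)"
          by (intro power_mono) auto
        with le[of "x / real m" "y / real n"]
        have *: "u (x / real m) ^ m * v (y / real n) ^ n \<le> ennreal t ^ (m + n)"
          unfolding eq by (rule order_trans)
        obtain a b where ab: "u (x / real m) = ennreal a" "v (y / real n) = ennreal b" "0 \<le> a" "0 \<le> b"
          using u1[of "x / real m"] v1[of "y / real n"]
          by (cases "u (x / real m)"; cases "v (y / real n)") (auto simp: top_unique)
        have tab: "t < a" "t < b" using xy t ab by (auto simp: ennreal_less_iff)
        have "t ^ m * t ^ n < a ^ m * b ^ n"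
          using tab t mn by (intro mult_strict_mono power_strict_mono) auto
        moreover have "a ^ m * b ^ n \<le> t ^ (m + n)"
          using * t ab by (simp add: ennreal_power ennreal_mult[symmetric])
        ultimately show False by (simp add: power_add)
      qed
      then show "x + y \<in> {x. x / real (m + n) \<in> {x. ennreal t < w x}}" by simp
    qed measurable
    then show ?thesis
      using pos by (subst (asm) (1 2 3) emeasure_lborel_scale) (auto simp: ennreal_of_nat_eq_real_of_nat)
  qed
  have U: "(\<integral>\<^sup>+t. indicator {0<..<1::real} t * emeasure lborel {x. ennreal t < f x} \<partial>lborel)
      = (\<integral>\<^sup>+x. min (f x) 1 \<partial>lborel)" if "f \<in> borel_measurable borel" for f :: "real \<Rightarrow> ennreal"
    using nn_integral_superlevel[OF sigma_finite_lborel, of f] that by simp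
  have M: "(\<lambda>t. emeasure lborel {x. ennreal t < f x}) \<in> borel_measurable borel"
    if [measurable]: "f \<in> borel_measurable borel" for f :: "real \<Rightarrow> ennreal"
  proof -
    have "{p \<in> space (lborel \<Otimes>\<^sub>M lborel). ennreal (fst p) < f (snd p)} \<in> sets (lborel \<Otimes>\<^sub>M lborel)"
      by measurable
    then have "(\<lambda>t. emeasure lborel (Pair t -` {p. ennreal (fst p) < f (snd p)})) \<in> borel_measurable lborel"
      by (intro lborel.measurable_emeasure_Pair) (simp add: space_pair_measure)
    then show ?thesis by (simp add: vimage_def)
  qed
  note [measurable] = M[OF assms(1)] M[OF assms(2)] M[OF assms(3)]
  have "of_nat m * (\<integral>\<^sup>+x. u x \<partial>lborel) + of_nat n * (\<integral>\<^sup>+x. v x \<partial>lborel)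
     = of_nat m * (\<integral>\<^sup>+x. min (u x) 1 \<partial>lborel) + of_nat n * (\<integral>\<^sup>+x. min (v x) 1 \<partial>lborel)"
    using u1 v1 by (simp add: min_absorb1)
  also have "\<dots> = (\<integral>\<^sup>+t. of_nat m * (indicator {0<..<1::real} t * emeasure lborel {x. ennreal t < u x})
      + of_nat n * (indicator {0<..<1::real} t * emeasure lborel {x. ennreal t < v x}) \<partial>lborel)"
    by (subst nn_integral_add, simp, simp, subst (1 2) nn_integral_cmult) (simp_all add: U)
  also have "\<dots> \<le> (\<integral>\<^sup>+t. of_nat (m + n) * (indicator {0<..<1::real} t * emeasure lborel {x. ennreal t < w x}) \<partial>lborel)"
    using lev by (intro nn_integral_mono) (auto split: split_indicator)
  also have "\<dots> = of_nat (m + n) * (\<integral>\<^sup>+x. min (w x) 1 \<partial>lborel)"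
    by (subst nn_integral_cmult) (simp_all add: U del: of_nat_add)
  also have "\<dots> \<le> of_nat (m + n) * (\<integral>\<^sup>+x. w x \<partial>lborel)"
    by (intro mult_left_mono nn_integral_mono) auto
  finally show ?thesis .
qed

text \<open>Boundedness makes the suprema finite, so \<open>u\<close> and \<open>v\<close> can be
  divided by them; the case of a vanishing supremum is trivial.\<close>

lemma prekopa_leindler_real_bounded:
  fixes u v w :: "real \<Rightarrow> ennreal"
  assumes [measurable]: "u \<in> borel_measurable borel" "v \<in> borel_measurable borel" "w \<in> borel_measurable borel"
    and mn: "0 < m" "0 < n"
    and bd: "\<And>x. u x \<le> ennreal K" "\<And>x. v x \<le> ennreal K"
    and le: "\<And>x y. u x ^ m * v y ^ n \<le> w ((real m * x + real n * y) / real (m + n)) ^ (m + n)"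
  shows "(\<integral>\<^sup>+x. u x \<partial>lborel) ^ m * (\<integral>\<^sup>+x. v x \<partial>lborel) ^ n \<le> (\<integral>\<^sup>+x. w x \<partial>lborel) ^ (m + n)"
proof (cases "(SUP x. u x) = 0 \<or> (SUP x. v x) = 0")
  case True
  then have "(\<forall>x. u x = 0) \<or> (\<forall>x. v x = 0)"
    by (metis SUP_upper UNIV_I le_zero_eq)
  then have "(\<integral>\<^sup>+x. u x \<partial>lborel) = 0 \<or> (\<integral>\<^sup>+x. v x \<partial>lborel) = 0"
    by auto
  then show ?thesis using mn by (auto simp: zero_power)
next
  case False
  define s where "s = (SUP x. u x)"
  define t where "t = (SUP x. v x)"
  have "s \<le> ennreal K" "t \<le> ennreal K" using bd by (auto simp: s_def t_def intro: SUP_least)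
  then have fin: "s \<noteq> top" "t \<noteq> top" by (auto simp: top_unique)
  then obtain a b where ab: "s = ennreal a" "t = ennreal b" "0 \<le> a" "0 \<le> b"
    by (cases s; cases t) auto
  have pos: "a > 0" "b > 0" using False ab by (auto simp: s_def[symmetric] t_def[symmetric] less_le)
  \<comment> \<open>The weighted geometric mean of the two suprema: dividing \<open>w\<close> by it
    scales both sides of the hypothesis by the same factor.\<close>
  define c where "c = root (m + n) (a ^ m * b ^ n)"
  have c: "c > 0" "c ^ (m + n) = a ^ m * b ^ n" using pos mn by (auto simp: c_def)
  have "inverse (ennreal a ^ m) * inverse (ennreal b ^ n) = inverse (ennreal c ^ (m + n))"
    using ab pos c by (simp add: ennreal_power inverse_ennreal ennreal_mult[symmetric] del: power_inverse)
  then have scale_uv: "(p / s) ^ m * (q / t) ^ n = p ^ m * q ^ n * inverse (ennreal c ^ (m + n))" for p q :: ennreal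
    using ab by (simp add: divide_ennreal_def power_mult_distrib ennreal_inverse_power[symmetric] ac_simps)
  have scale_w: "(p / ennreal c) ^ (m + n) = p ^ (m + n) * inverse (ennreal c ^ (m + n))" for p :: ennreal
    by (simp only: divide_ennreal_def power_mult_distrib ennreal_inverse_power)
  have "of_nat m * (\<integral>\<^sup>+x. u x / s \<partial>lborel) + of_nat n * (\<integral>\<^sup>+x. v x / t \<partial>lborel)
    \<le> of_nat (m + n) * (\<integral>\<^sup>+x. w x / ennreal c \<partial>lborel)"
  proof (rule prekopa_leindler_real_normalized)
    show "(SUP x. u x / s) = 1" "(SUP x. v x / t) = 1"
      using False fin by (auto simp: SUP_divide_ennreal[symmetric] s_def[symmetric] t_def[symmetric] intro!: ennreal_divide_self)
         (auto simp: less_top)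
    fix x y
    let ?z = "(real m * x + real n * y) / real (m + n)"
    have "(u x / s) ^ m * (v y / t) ^ n = u x ^ m * v y ^ n * inverse (ennreal c ^ (m + n))"
      by (rule scale_uv)
    also have "u x ^ m * v y ^ n * inverse (ennreal c ^ (m + n)) \<le> w ?z ^ (m + n) * inverse (ennreal c ^ (m + n))"
      by (intro mult_right_mono le) auto
    also have "\<dots> = (w ?z / ennreal c) ^ (m + n)"
      by (rule scale_w[symmetric])
    finally show "(u x / s) ^ m * (v y / t) ^ n \<le> (w ?z / ennreal c) ^ (m + n)" .
  qed (use mn in measurable)
  then have "(\<integral>\<^sup>+x. u x / s \<partial>lborel) ^ m * (\<integral>\<^sup>+x. v x / t \<partial>lborel) ^ n
    \<le> (\<integral>\<^sup>+x. w x / ennreal c \<partial>lborel) ^ (m + n)"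
    by (rule amgm_power_ennreal[OF mn])
  then have *: "((\<integral>\<^sup>+x. u x \<partial>lborel) / s) ^ m * ((\<integral>\<^sup>+x. v x \<partial>lborel) / t) ^ n
    \<le> ((\<integral>\<^sup>+x. w x \<partial>lborel) / ennreal c) ^ (m + n)"
    by (simp add: nn_integral_divide)
  \<comment> \<open>Cancelling a factor in \<open>ennreal\<close> is valid only if it is neither 0
    nor infinite.\<close>
  have "inverse (ennreal c ^ (m + n)) \<noteq> 0" "inverse (ennreal c ^ (m + n)) \<noteq> top"
    using c(1) by (auto simp: ennreal_power inverse_ennreal power_eq_top_ennreal)
  then show ?thesis
    using * unfolding scale_uv scale_w
    by (simp add: mult.commute[of _ "inverse (ennreal c ^ (m + n))"] ennreal_mult_le_mult_iff)
qed

lemma ennreal_SUP_mult: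
  fixes f g :: "nat \<Rightarrow> ennreal"
  assumes "mono f" "mono g"
  shows "(SUP k. f k * g k) = (SUP k. f k) * (SUP k. g k)"
proof (rule antisym)
  show "(SUP k. f k * g k) \<le> (SUP k. f k) * (SUP k. g k)"
    by (intro SUP_least mult_mono SUP_upper) auto
  have "(SUP k. f k) * (SUP k. g k) = (SUP i. SUP j. f i * g j)"
    by (simp only: SUP_mult_right_ennreal) (simp only: SUP_mult_left_ennreal)
  also have "\<dots> \<le> (SUP k. f k * g k)"
  proof (intro SUP_least)
    fix i j
    have "f i * g j \<le> f (max i j) * g (max i j)"
      using assms by (intro mult_mono) (auto simp: mono_def)
    then show "f i * g j \<le> (SUP k. f k * g k)" by (rule SUP_upper2[rotated]) simp
  qed
  finally show "(SUP k. f k) * (SUP k. g k) \<le> (SUP k. f k * g k)" .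
qed

lemma ennreal_SUP_power:
  fixes f :: "nat \<Rightarrow> ennreal"
  assumes "mono f"
  shows "(SUP k. f k ^ n) = (SUP k. f k) ^ n"
proof (induction n)
  case (Suc n)
  have "mono (\<lambda>k. f k ^ n)" using assms by (auto simp: mono_def intro: power_mono)
  then show ?case using assms by (simp add: ennreal_SUP_mult Suc)
qed simp

text \<open>Truncating \<open>u\<close> and \<open>v\<close> at height \<open>k\<close> only weakens
  the hypothesis, so the same \<open>w\<close> serves for all \<open>k\<close> and monotone
  convergence removes the bound.\<close>

lemma prekopa_leindler_real:
  fixes u v w :: "real \<Rightarrow> ennreal"
  assumes [measurable]: "u \<in> borel_measurable borel" "v \<in> borel_measurable borel" "w \<in> borel_measurable borel"
    and mn: "0 < m" "0 < n"
    and le: "\<And>x y. u x ^ m * v y ^ n \<le> w ((real m * x + real n * y) / real (m + n)) ^ (m + n)"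
  shows "(\<integral>\<^sup>+x. u x \<partial>lborel) ^ m * (\<integral>\<^sup>+x. v x \<partial>lborel) ^ n \<le> (\<integral>\<^sup>+x. w x \<partial>lborel) ^ (m + n)"
proof -
  define T where "T f k = (\<integral>\<^sup>+x. min (f x) (ennreal (real k)) \<partial>lborel)" for f :: "real \<Rightarrow> ennreal" and k :: nat
  have mono: "mono (T f)" for f
    by (auto simp: T_def mono_def intro!: nn_integral_mono min.mono ennreal_leI)
  have lim: "(SUP k. T f k) = (\<integral>\<^sup>+x. f x \<partial>lborel)" if [measurable]: "f \<in> borel_measurable borel" for f
  proof -
    have "(SUP k. min (f x) (ennreal (real k))) = f x" for x
    proof (rule antisym)
      show "f x \<le> (SUP k. min (f x) (ennreal (real k)))"
        unfolding le_SUP_iff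
      proof (intro allI impI)
        fix y assume y: "y < f x"
        also have "f x \<le> (SUP k. ennreal (real k))"
          unfolding ennreal_of_nat_eq_real_of_nat[symmetric] ennreal_SUP_of_nat_eq_top by simp
        finally have "y < (SUP k. ennreal (real k))" .
        then obtain k where "y < ennreal (real k)" by (auto simp: less_SUP_iff)
        then show "\<exists>k\<in>UNIV. y < min (f x) (ennreal (real k))" using y by auto
      qed
    qed (auto intro: SUP_least)
    then have "(\<integral>\<^sup>+x. f x \<partial>lborel) = (\<integral>\<^sup>+x. (SUP k. min (f x) (ennreal (real k))) \<partial>lborel)" by simp
    also have "\<dots> = (SUP k. T f k)"
      unfolding T_def
      by (rule nn_integral_monotone_convergence_SUP)
        (auto simp: incseq_def le_fun_def min.coboundedI2 ennreal_leI)
    finally show ?thesis ..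
  qed
  have bd: "T u k ^ m * T v k ^ n \<le> (\<integral>\<^sup>+x. w x \<partial>lborel) ^ (m + n)" for k
    unfolding T_def
  proof (rule prekopa_leindler_real_bounded[where K = "real k"])
    fix x y
    show "min (u x) (ennreal (real k)) ^ m * min (v y) (ennreal (real k)) ^ n
      \<le> w ((real m * x + real n * y) / real (m + n)) ^ (m + n)"
      by (rule order_trans[OF mult_mono le]) (auto intro!: power_mono)
  qed (use mn in auto)
  have "(\<integral>\<^sup>+x. u x \<partial>lborel) ^ m * (\<integral>\<^sup>+x. v x \<partial>lborel) ^ n = (SUP k. T u k ^ m * T v k ^ n)"
  proof -
    have "mono (\<lambda>k. T f k ^ j)" for f j
      using mono[of f] by (auto simp: mono_def intro: power_mono)
    then show ?thesis
      by (simp add: lim[symmetric] ennreal_SUP_mult ennreal_SUP_power mono)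
  qed
  also have "\<dots> \<le> (\<integral>\<^sup>+x. w x \<partial>lborel) ^ (m + n)" by (intro SUP_least bd)
  finally show ?thesis .
qed

section \<open>Prekopa-Leindler in several dimensions\<close>

text \<open>Tensorization: for fixed values of the new coordinate the slices satisfy the hypothesis
  over \<open>I\<close>, so by induction the marginals in that coordinate satisfy the
  one-dimensional hypothesis. Over the empty index set the space is a single point, and the
  hypothesis there is the claim.\<close>

lemma prekopa_leindler_PiM:
  fixes u v w :: "('i \<Rightarrow> real) \<Rightarrow> ennreal"
  assumes fin: "finite I"
    and "u \<in> borel_measurable (Pi\<^sub>M I (\<lambda>_. lborel))" "v \<in> borel_measurable (Pi\<^sub>M I (\<lambda>_. lborel))"
      "w \<in> borel_measurable (Pi\<^sub>M I (\<lambda>_. lborel))"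
    and mn: "0 < m" "0 < n"
    and "\<And>x y. x \<in> extensional I \<Longrightarrow> y \<in> extensional I \<Longrightarrow>
      u x ^ m * v y ^ n \<le> w (\<lambda>i\<in>I. (real m * x i + real n * y i) / real (m + n)) ^ (m + n)"
  shows "(\<integral>\<^sup>+x. u x \<partial>Pi\<^sub>M I (\<lambda>_. lborel)) ^ m * (\<integral>\<^sup>+x. v x \<partial>Pi\<^sub>M I (\<lambda>_. lborel)) ^ n
    \<le> (\<integral>\<^sup>+x. w x \<partial>Pi\<^sub>M I (\<lambda>_. lborel)) ^ (m + n)"
  using fin assms(2-4,7)
proof (induction I arbitrary: u v w rule: finite_induct)
  case empty
  then show ?case
    using empty(4)[of "\<lambda>_. undefined" "\<lambda>_. undefined"]
    by (simp add: PiM_empty nn_integral_count_space_finite restrict_def)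
next
  case (insert i I)
  interpret product_sigma_finite "\<lambda>_::'i. lborel :: real measure" by standard
  interpret I: finite_product_sigma_finite "\<lambda>_::'i. lborel :: real measure" I by standard fact
  note [measurable] = insert.prems(1-3)
  have upd[measurable]: "(\<lambda>x. x(i := s)) \<in> measurable (Pi\<^sub>M I (\<lambda>_. lborel)) (Pi\<^sub>M (insert i I) (\<lambda>_. lborel :: real measure))" for s
    by (rule measurable_fun_upd[where J = I]) auto
  have upd2[measurable]: "(\<lambda>p. (snd p)(i := fst p)) \<in> measurable (lborel \<Otimes>\<^sub>M Pi\<^sub>M I (\<lambda>_. lborel)) (Pi\<^sub>M (insert i I) (\<lambda>_. lborel :: real measure))"
    by (rule measurable_fun_upd[where J = I]) auto
  have marg: "(\<lambda>s. \<integral>\<^sup>+x. f (x(i := s)) \<partial>Pi\<^sub>M I (\<lambda>_. lborel)) \<in> borel_measurable borel"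
    if [measurable]: "f \<in> borel_measurable (Pi\<^sub>M (insert i I) (\<lambda>_. lborel))" for f :: "('i \<Rightarrow> real) \<Rightarrow> ennreal"
  proof -
    have "(\<lambda>p. f ((snd p)(i := fst p))) \<in> borel_measurable (lborel \<Otimes>\<^sub>M Pi\<^sub>M I (\<lambda>_. lborel))"
      by measurable
    then have "(\<lambda>s. \<integral>\<^sup>+x. f ((snd (s, x))(i := fst (s, x))) \<partial>Pi\<^sub>M I (\<lambda>_. lborel)) \<in> borel_measurable lborel"
      by (intro I.borel_measurable_nn_integral_fst)
    then show ?thesis by simp
  qed
  show ?case
    unfolding product_nn_integral_insert_rev[OF insert.hyps insert.prems(1)]
      product_nn_integral_insert_rev[OF insert.hyps insert.prems(2)]
      product_nn_integral_insert_rev[OF insert.hyps insert.prems(3)]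
  proof (rule prekopa_leindler_real)
    fix s t
    let ?z = "(real m * s + real n * t) / real (m + n)"
    show "(\<integral>\<^sup>+x. u (x(i := s)) \<partial>Pi\<^sub>M I (\<lambda>_. lborel)) ^ m * (\<integral>\<^sup>+x. v (x(i := t)) \<partial>Pi\<^sub>M I (\<lambda>_. lborel)) ^ n
      \<le> (\<integral>\<^sup>+x. w (x(i := ?z)) \<partial>Pi\<^sub>M I (\<lambda>_. lborel)) ^ (m + n)"
    proof (rule insert.IH)
      fix x y :: "'i \<Rightarrow> real" assume xy: "x \<in> extensional I" "y \<in> extensional I"
      have "u (x(i := s)) ^ m * v (y(i := t)) ^ n
         \<le> w (\<lambda>j\<in>insert i I. (real m * (x(i := s)) j + real n * (y(i := t)) j) / real (m + n)) ^ (m + n)"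
        using xy by (intro insert.prems(4)) (auto simp: extensional_def)
      also have "(\<lambda>j\<in>insert i I. (real m * (x(i := s)) j + real n * (y(i := t)) j) / real (m + n))
        = (\<lambda>j\<in>I. (real m * x j + real n * y j) / real (m + n))(i := ?z)"
        using insert.hyps by (auto simp: fun_eq_iff restrict_def)
      finally show "u (x(i := s)) ^ m * v (y(i := t)) ^ n
        \<le> w ((\<lambda>j\<in>I. (real m * x j + real n * y j) / real (m + n))(i := ?z)) ^ (m + n)" .
    qed measurable
  qed (use mn marg insert.prems in auto)
qed

lemma prekopa_leindler:
  fixes u v w :: "'a::euclidean_space \<Rightarrow> ennreal"
  assumes [measurable]: "u \<in> borel_measurable borel" "v \<in> borel_measurable borel" "w \<in> borel_measurable borel"
    and mn: "0 < m" "0 < n"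
    and le: "\<And>x y. u x ^ m * v y ^ n \<le> w ((1 / real (m + n)) *\<^sub>R (real m *\<^sub>R x + real n *\<^sub>R y)) ^ (m + n)"
  shows "(\<integral>\<^sup>+x. u x \<partial>lborel) ^ m * (\<integral>\<^sup>+x. v x \<partial>lborel) ^ n \<le> (\<integral>\<^sup>+x. w x \<partial>lborel) ^ (m + n)"
proof -
  let ?\<phi> = "\<lambda>f::'a \<Rightarrow> real. \<Sum>b\<in>Basis. f b *\<^sub>R b"
  have *: "(\<integral>\<^sup>+x. f x \<partial>lborel) = (\<integral>\<^sup>+x. f (?\<phi> x) \<partial>Pi\<^sub>M Basis (\<lambda>_. lborel))"
    if [measurable]: "f \<in> borel_measurable borel" for f :: "'a \<Rightarrow> ennreal"
    by (subst lborel_eq, subst nn_integral_distr) auto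
  show ?thesis
    unfolding *[OF assms(1)] *[OF assms(2)] *[OF assms(3)]
  proof (rule prekopa_leindler_PiM)
    fix x y :: "'a \<Rightarrow> real"
    have "?\<phi> (\<lambda>i\<in>Basis. (real m * x i + real n * y i) / real (m + n))
       = (1 / real (m + n)) *\<^sub>R (real m *\<^sub>R ?\<phi> x + real n *\<^sub>R ?\<phi> y)"
      by (simp add: scaleR_sum_right sum.distrib[symmetric] scaleR_add_left[symmetric] add_divide_distrib)
    then show "u (?\<phi> x) ^ m * v (?\<phi> y) ^ n
      \<le> w (?\<phi> (\<lambda>i\<in>Basis. (real m * x i + real n * y i) / real (m + n))) ^ (m + n)"
      using le[of "?\<phi> x" "?\<phi> y"] by simp
  qed (use mn in \<open>auto intro!: measurable_compose[OF _ assms(1)] measurable_compose[OF _ assms(2)] measurable_compose[OF _ assms(3)]\<close>)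
qed

section \<open>Lipschitz perturbations of strongly log-concave measures\<close>

lemma (in prob_space) exp_expectation_le:
  fixes X :: "'a \<Rightarrow> real"
  assumes "integrable M X" "integrable M (\<lambda>x. exp (X x))"
  shows "exp (expectation X) \<le> expectation (\<lambda>x. exp (X x))"
proof -
  let ?m = "expectation X"
  have "exp ?m = (\<integral>x. exp ?m * (1 + (X x - ?m)) \<partial>M)"
    using assms by (simp add: prob_space)
  also have "\<dots> \<le> expectation (\<lambda>x. exp (X x))"
  proof (rule integral_mono)
    fix x
    have "exp ?m * (1 + (X x - ?m)) \<le> exp ?m * exp (X x - ?m)"
      by (intro mult_left_mono exp_ge_add_one_self) simp
    then show "exp ?m * (1 + (X x - ?m)) \<le> exp (X x)" by (simp add: exp_diff)
  qed (use assms in auto)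
  finally show ?thesis .
qed

text \<open>Used for \<open>\<psi> / k\<close> with \<open>k\<close> large: the remainder is then of
  order \<open>1 / k^2\<close>, with a factor that can be dominated uniformly in
  \<open>k\<close>.\<close>

lemma exp_le_quadratic:
  fixes x :: real
  shows "exp x \<le> 1 + x + x\<^sup>2 * exp \<bar>x\<bar>"
proof -
  obtain t where t: "\<bar>t\<bar> \<le> \<bar>x\<bar>" "exp x = (\<Sum>m<2. (x ^ m) / fact m) + (exp t / fact 2) * x ^ 2"
    using Maclaurin_exp_le[of x 2] by blast
  have "exp t \<le> exp \<bar>x\<bar>" using t(1) by simp
  then have "exp t / fact 2 \<le> exp \<bar>x\<bar>" using exp_ge_zero[of t] by (simp only: fact_2)
  then have "(exp t / fact 2) * x ^ 2 \<le> exp \<bar>x\<bar> * x ^ 2"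
    by (rule mult_right_mono) simp
  then show ?thesis using t(2) by (simp add: numeral_2_eq_2 mult.commute)
qed

section \<open>Growth of strongly convex potentials and integrability\<close>

lemma integrable_gaussian:
  assumes c: "c > 0"
  shows "integrable lborel (\<lambda>x::'a::euclidean_space. exp (- c * (norm x)\<^sup>2))"
proof -
  interpret product_sigma_finite "\<lambda>_::'a. lborel :: real measure" by standard
  have 1: "integrable lborel (\<lambda>t::real. exp (- c * t\<^sup>2))"
  proof -
    define \<sigma> where "\<sigma> = sqrt (1 / (2 * c))"
    have \<sigma>: "\<sigma> > 0" "\<sigma>\<^sup>2 = 1 / (2 * c)" using c by (auto simp: \<sigma>_def)
    have "exp (- c * t\<^sup>2) = sqrt (2 * pi * \<sigma>\<^sup>2) * normal_density 0 \<sigma> t" for t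
      using c by (simp add: normal_density_def \<sigma>(2))
    moreover have "integrable lborel (\<lambda>t. sqrt (2 * pi * \<sigma>\<^sup>2) * normal_density 0 \<sigma> t)"
      using \<sigma> by (intro integrable_mult_right integrable_normal_density)
    ultimately show ?thesis by presburger
  qed
  have "integrable (Pi\<^sub>M Basis (\<lambda>_. lborel)) (\<lambda>f::'a \<Rightarrow> real. \<Prod>b\<in>Basis. exp (- c * (f b)\<^sup>2))"
    by (intro product_integrable_prod 1) auto
  moreover have "(\<Prod>b\<in>Basis. exp (- c * (f b)\<^sup>2)) = exp (- c * (norm (\<Sum>b\<in>Basis. f b *\<^sub>R b))\<^sup>2)"
    for f :: "'a \<Rightarrow> real"
  proof -
    have "(norm (\<Sum>b\<in>Basis. f b *\<^sub>R b :: 'a))\<^sup>2 = (\<Sum>b\<in>Basis. (f b)\<^sup>2)"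
      unfolding power2_norm_eq_inner
      by (subst euclidean_inner) (simp add: power2_eq_square)
    then show ?thesis by (simp add: exp_sum sum_distrib_left)
  qed
  ultimately have "integrable (Pi\<^sub>M Basis (\<lambda>_. lborel)) (\<lambda>f. exp (- c * (norm (\<Sum>b\<in>Basis. f b *\<^sub>R b :: 'a))\<^sup>2))"
    by simp
  then show ?thesis by (subst lborel_eq, subst integrable_distr_eq) auto
qed

lemma strongly_convex_imp_convex:
  fixes V :: "'a::real_inner \<Rightarrow> real"
  assumes "strongly_convex \<alpha> V" "\<alpha> > 0"
  shows "convex_on UNIV V"
proof (rule convex_onI)
  fix t :: real and x y :: 'a assume t: "0 < t" "t < 1"
  then have "0 \<le> \<alpha> / 2 * t * (1 - t) * (norm (x - y))\<^sup>2" using assms(2) by simp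
  moreover have "V ((1 - t) *\<^sub>R x + t *\<^sub>R y)
      \<le> (1 - t) * V x + t * V y - \<alpha> / 2 * t * (1 - t) * (norm (x - y))\<^sup>2"
    using assms(1) t unfolding strongly_convex_def by force
  ultimately show "V ((1 - t) *\<^sub>R x + t *\<^sub>R y) \<le> (1 - t) * V x + t * V y" by linarith
qed simp

text \<open>On the unit ball \<open>V\<close> is bounded below by compactness. A point
  \<open>x\<close> outside is compared with \<open>x / norm x\<close> on the segment from 0 to
  \<open>x\<close>, where strong convexity forces quadratic growth of \<open>V x\<close>. Half of
  the coefficient \<open>\<alpha> / 2\<close> is spent on absorbing the linear terms.\<close>

lemma strongly_convex_quadratic_lower_bound:
  fixes V :: "'a::euclidean_space \<Rightarrow> real"
  assumes sc: "strongly_convex \<alpha> V" and \<alpha>: "\<alpha> > 0"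
  obtains A where "\<And>x. \<alpha> / 4 * (norm x)\<^sup>2 - A \<le> V x"
proof -
  have cont: "continuous_on UNIV V"
    using convex_on_continuous strongly_convex_imp_convex[OF sc \<alpha>] by blast
  have "\<exists>e\<in>cball 0 1. \<forall>x\<in>cball 0 1. V e \<le> V x"
    by (intro continuous_attains_inf) (auto intro: continuous_on_subset[OF cont])
  then obtain e where "\<forall>x\<in>cball 0 1. V e \<le> V x" by blast
  then obtain m where m: "\<And>x. norm x \<le> 1 \<Longrightarrow> m \<le> V x" by (auto intro: that[of "V e"])
  \<comment> \<open>Collects all terms linear in \<open>r = norm x\<close>; the summand
    \<open>\<alpha> / 2\<close> comes from \<open>\<alpha> / 2 * (r - 1) * r\<close>.\<close>
  define K where "K = \<bar>m\<bar> + \<bar>V 0\<bar> + \<alpha> / 2"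
  have "\<alpha> / 4 * (norm x)\<^sup>2 - (K\<^sup>2 / \<alpha> + K) \<le> V x" for x
  proof (cases "norm x \<le> 1")
    case True
    have "(norm x)\<^sup>2 \<le> 1" using True by (simp add: power_le_one)
    then have "\<alpha> / 4 * (norm x)\<^sup>2 \<le> \<alpha> / 4 * 1" using \<alpha> by (intro mult_left_mono) auto
    moreover have "0 \<le> K\<^sup>2 / \<alpha>" using \<alpha> by simp
    moreover have "\<alpha> / 4 * 1 - K \<le> m" using \<alpha> by (simp add: K_def)
    ultimately show ?thesis using m[OF True] by linarith
  next
    case False
    define r where "r = norm x"
    have r: "r > 1" using False by (simp add: r_def)
    have "V ((1 - 1 / r) *\<^sub>R 0 + (1 / r) *\<^sub>R x) \<le> (1 - 1 / r) * V 0 + 1 / r * V x - \<alpha> / 2 * (1 / r) * (1 - 1 / r) * (norm (0 - x))\<^sup>2"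
      using r by (intro sc[unfolded strongly_convex_def, rule_format]) auto
    moreover have "m \<le> V ((1 - 1 / r) *\<^sub>R 0 + (1 / r) *\<^sub>R x)"
      using r by (intro m) (auto simp: r_def[symmetric])
    ultimately have "m \<le> (1 - 1 / r) * V 0 + 1 / r * V x - \<alpha> / 2 * (1 / r) * (1 - 1 / r) * r\<^sup>2"
      by (simp add: r_def)
    then have "r * m \<le> r * ((1 - 1 / r) * V 0 + 1 / r * V x - \<alpha> / 2 * (1 / r) * (1 - 1 / r) * r\<^sup>2)"
      using r by (intro mult_left_mono) auto
    also have "\<dots> = (r - 1) * V 0 + V x - \<alpha> / 2 * (r - 1) * r"
      using r by (simp add: field_simps power2_eq_square)
    finally have 1: "r * m - (r - 1) * V 0 + \<alpha> / 2 * (r - 1) * r \<le> V x" by simp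
    have "r * (- \<bar>m\<bar>) \<le> r * m" using r by (intro mult_left_mono) auto
    moreover have "(r - 1) * V 0 \<le> (r - 1) * \<bar>V 0\<bar>" using r by (intro mult_left_mono) auto
    moreover have "(r - 1) * \<bar>V 0\<bar> \<le> r * \<bar>V 0\<bar>" by (intro mult_right_mono) auto
    moreover have "K * r = r * \<bar>m\<bar> + r * \<bar>V 0\<bar> + \<alpha> / 2 * r" by (simp add: K_def algebra_simps)
    moreover have "\<alpha> / 2 * (r - 1) * r = \<alpha> / 2 * r\<^sup>2 - \<alpha> / 2 * r"
      by (simp add: field_simps power2_eq_square)
    ultimately have 2: "\<alpha> / 2 * r\<^sup>2 - K * r \<le> V x"
      using 1 by linarith
    have "0 \<le> (\<alpha> * r / 2 - K)\<^sup>2 / \<alpha>" using \<alpha> by simp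
    also have "\<dots> = \<alpha> / 4 * r\<^sup>2 - K * r + K\<^sup>2 / \<alpha>"
      using \<alpha> by (simp add: power2_eq_square field_simps)
    finally have "\<alpha> / 4 * r\<^sup>2 - K\<^sup>2 / \<alpha> \<le> V x" using 2 by simp
    moreover have "K \<ge> 0" using \<alpha> by (simp add: K_def)
    ultimately show ?thesis by (simp add: r_def)
  qed
  then show ?thesis by (rule that)
qed

locale strongly_convex_potential =
  fixes V :: "'a::euclidean_space \<Rightarrow> real" and \<alpha> :: real
  assumes sc: "strongly_convex \<alpha> V" and \<alpha>: "\<alpha> > 0"
begin

lemma measurable_V [measurable]: "V \<in> borel_measurable borel"
  using convex_on_continuous[of UNIV V] strongly_convex_imp_convex[OF sc \<alpha>]
  by (auto intro: borel_measurable_continuous_onI)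

text \<open>Half of the coefficient \<open>\<alpha> / 4\<close> of the lower bound absorbs the
  exponent \<open>K * norm x\<close> by completing a square; the other half leaves an integrable
  Gaussian.\<close>

lemma integrable_exp_bound:
  assumes [measurable]: "F \<in> borel_measurable borel" and le: "\<And>x. \<bar>F x\<bar> \<le> C * exp (K * norm x)"
  shows "integrable lborel (\<lambda>x. F x * exp (- V x))"
proof -
  obtain A where A: "\<And>x. \<alpha> / 4 * (norm x)\<^sup>2 - A \<le> V x"
    using strongly_convex_quadratic_lower_bound[OF sc \<alpha>] by blast
  have "integrable lborel (\<lambda>x::'a. (\<bar>C\<bar> * exp (2 * K\<^sup>2 / \<alpha> + A)) * exp (- (\<alpha> / 8) * (norm x)\<^sup>2))"
    using \<alpha> by (intro integrable_mult_right integrable_gaussian) simp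
  then show ?thesis
  proof (rule Bochner_Integration.integrable_bound)
    have "\<bar>F x * exp (- V x)\<bar> \<le> \<bar>C\<bar> * exp (2 * K\<^sup>2 / \<alpha> + A) * exp (- (\<alpha> / 8) * (norm x)\<^sup>2)" for x
    proof -
      have "0 \<le> (\<alpha> * norm x / 4 - K)\<^sup>2 * (2 / \<alpha>)" using \<alpha> by simp
      also have "\<dots> = \<alpha> / 8 * (norm x)\<^sup>2 - K * norm x + 2 * K\<^sup>2 / \<alpha>"
        using \<alpha> by (simp add: power2_eq_square field_simps)
      finally have "K * norm x - V x \<le> 2 * K\<^sup>2 / \<alpha> + A - \<alpha> / 8 * (norm x)\<^sup>2"
        using A[of x] by simp
      then have "exp (K * norm x) * exp (- V x) \<le> exp (2 * K\<^sup>2 / \<alpha> + A) * exp (- (\<alpha> / 8) * (norm x)\<^sup>2)"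
        by (simp add: exp_add[symmetric])
      note exp_le = this
      have "\<bar>F x\<bar> \<le> \<bar>C\<bar> * exp (K * norm x)"
        using le[of x] by (rule order_trans) (simp add: mult_right_mono)
      then have "\<bar>F x * exp (- V x)\<bar> \<le> \<bar>C\<bar> * exp (K * norm x) * exp (- V x)"
        by (simp add: abs_mult mult_right_mono)
      also have "\<dots> \<le> \<bar>C\<bar> * (exp (2 * K\<^sup>2 / \<alpha> + A) * exp (- (\<alpha> / 8) * (norm x)\<^sup>2))"
        unfolding mult.assoc by (rule mult_left_mono[OF exp_le]) simp
      finally show ?thesis by (simp add: mult.assoc)
    qed
    then show "AE x in lborel. norm (F x * exp (- V x)) \<le> norm (\<bar>C\<bar> * exp (2 * K\<^sup>2 / \<alpha> + A) * exp (- (\<alpha> / 8) * (norm x)\<^sup>2))"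
      by (auto intro!: AE_I2 simp: abs_mult)
  qed measurable
qed

text \<open>Left unnormalized because Prekopa-Leindler applies to these integrals as they stand;
  exponential moments under \<open>gibbs\<close> are their ratios to
  \<open>partition (\<lambda>_. 0)\<close>.\<close>

definition partition :: "('a \<Rightarrow> real) \<Rightarrow> real" where
  "partition \<phi> = (\<integral>x. exp (\<phi> x - V x) \<partial>lborel)"

definition gibbs :: "'a measure" where
  "gibbs = density lborel (\<lambda>x. ennreal (exp (- V x) / partition (\<lambda>_. 0)))"

end

lemma lipschitz_real_norm_bound:
  fixes f :: "'a::real_normed_vector \<Rightarrow> real"
  assumes "L-lipschitz_on UNIV f"
  shows "\<bar>f x\<bar> \<le> \<bar>f 0\<bar> + L * norm x"
  using lipschitz_onD[OF assms, of x 0] by (simp add: dist_real_def)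

lemma lipschitz_borel_measurable:
  fixes f :: "'a::real_normed_vector \<Rightarrow> real"
  assumes "L-lipschitz_on UNIV f"
  shows "f \<in> borel_measurable borel"
  using lipschitz_on_continuous_on[OF assms] by (rule borel_measurable_continuous_onI)

context strongly_convex_potential
begin

lemma integrable_exp_lipschitz:
  assumes f: "b-lipschitz_on UNIV \<phi>"
  shows "integrable lborel (\<lambda>x. exp (\<phi> x - V x))"
proof -
  have [measurable]: "\<phi> \<in> borel_measurable borel" by (rule lipschitz_borel_measurable[OF f])
  have "integrable lborel (\<lambda>x. exp (\<phi> x) * exp (- V x))"
  proof (rule integrable_exp_bound[where C = "exp \<bar>\<phi> 0\<bar>" and K = b])
    fix x
    have "\<phi> x \<le> \<bar>\<phi> 0\<bar> + b * norm x" using lipschitz_real_norm_bound[OF f, of x] by simp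
    then show "\<bar>exp (\<phi> x)\<bar> \<le> exp \<bar>\<phi> 0\<bar> * exp (b * norm x)" by (simp add: exp_add[symmetric])
  qed measurable
  then show ?thesis by (simp add: exp_add[symmetric])
qed

lemma partition_pos:
  assumes "b-lipschitz_on UNIV \<phi>"
  shows "partition \<phi> > 0"
proof -
  have [measurable]: "\<phi> \<in> borel_measurable borel" by (rule lipschitz_borel_measurable[OF assms])
  have "partition \<phi> \<ge> 0" unfolding partition_def by (rule Bochner_Integration.integral_nonneg) simp
  moreover have "partition \<phi> \<noteq> 0"
  proof
    assume "partition \<phi> = 0"
    then have "AE x in lborel. exp (\<phi> x - V x) = 0"
      using integral_nonneg_eq_0_iff_AE[OF integrable_exp_lipschitz[OF assms]]
      unfolding partition_def by auto
    then have "AE x in (lborel :: 'a measure). \<not> True" by simp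
    from emeasure_eq_0_AE[OF this] show False by simp
  qed
  ultimately show ?thesis by simp
qed

text \<open>All of \<open>\<phi>\<close>, multiplied by \<open>(m + n) / m\<close>, is put into the
  first function and nothing into the second. Moving \<open>\<phi>\<close> from \<open>x\<close> to
  the weighted mean \<open>z\<close> costs a term linear in the distance of \<open>x\<close> and
  \<open>y\<close>; the strong convexity of \<open>V\<close> gains a quadratic one.\<close>

lemma partition_prekopa_leindler:
  assumes \<phi>: "b-lipschitz_on UNIV \<phi>" and mn: "0 < m" "0 < n"
  shows "partition (\<lambda>x. real (m + n) / real m * \<phi> x) ^ m * partition (\<lambda>_. 0) ^ n
    \<le> partition \<phi> ^ (m + n) * exp (real (m + n) * real n * b\<^sup>2 / (2 * \<alpha> * real m))"
proof -
  have [measurable]: "\<phi> \<in> borel_measurable borel" by (rule lipschitz_borel_measurable[OF \<phi>])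
  \<comment> \<open>With \<open>s = m + n\<close>, the product \<open>s * c\<close> is the maximum
    over \<open>r\<close> of the Lipschitz loss \<open>n * b * r\<close> minus the convexity gain
    \<open>\<alpha> * m * n * r^2 / (2 * s)\<close>.\<close>
  define c where "c = real n * b\<^sup>2 / (2 * \<alpha> * real m)"
  define s where "s = real (m + n)"
  have pos: "real m > 0" "real n > 0" "s > 0" using mn by (auto simp: s_def)
  have s: "s = real m + real n" by (simp add: s_def)
  have \<phi>': "(s / real m * b)-lipschitz_on UNIV (\<lambda>x. s / real m * \<phi> x)"
    using lipschitz_on_cmult_real[OF \<phi>, of "s / real m"] pos by simp
  have point: "real m * (s / real m * \<phi> x - V x) + real n * (- V y) \<le> s * (\<phi> z - V z + c)"
    if z: "z = (1 / s) *\<^sub>R (real m *\<^sub>R x + real n *\<^sub>R y)" for x y z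
  proof -
    define t where "t = real n / s"
    have t: "t \<in> {0..1}" "1 - t = real m / s" using pos by (auto simp: t_def s field_simps)
    have z': "z = (1 - t) *\<^sub>R x + t *\<^sub>R y"
      unfolding z t by (simp add: t_def scaleR_add_right)
    define r where "r = norm (x - y)"
    have "V z \<le> (1 - t) * V x + t * V y - \<alpha> / 2 * t * (1 - t) * r\<^sup>2"
      using sc t(1) unfolding strongly_convex_def z' r_def by blast
    then have "s * V z \<le> s * ((1 - t) * V x + t * V y - \<alpha> / 2 * t * (1 - t) * r\<^sup>2)"
      using pos by (intro mult_left_mono) auto
    also have "\<dots> = real m * V x + real n * V y - \<alpha> * real m * real n * r\<^sup>2 / (2 * s)"
      unfolding t(2) using pos by (simp add: t_def field_simps)
    finally have 1: "s * V z \<le> real m * V x + real n * V y - \<alpha> * real m * real n * r\<^sup>2 / (2 * s)" .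
    have "\<phi> x - \<phi> z \<le> b * norm (x - z)"
      using lipschitz_onD[OF \<phi>, of x z] by (simp add: dist_real_def dist_norm)
    also have "x - z = t *\<^sub>R (x - y)" unfolding z' by (simp add: algebra_simps)
    also have "norm \<dots> = t * r" using t(1) by (simp add: r_def)
    finally have "s * (\<phi> x - \<phi> z) \<le> s * (b * (t * r))" using pos by (intro mult_left_mono) auto
    then have 2: "s * \<phi> x \<le> s * \<phi> z + real n * b * r" using pos by (simp add: t_def algebra_simps)
    have "0 \<le> real n * (\<alpha> * real m * r / s - b)\<^sup>2 * s / (2 * \<alpha> * real m)" using pos \<alpha> by simp
    also have "\<dots> = \<alpha> * real m * real n * r\<^sup>2 / (2 * s) - real n * b * r + s * c"
      using pos \<alpha> by (simp add: c_def power2_eq_square field_simps)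
    finally have "real n * b * r \<le> \<alpha> * real m * real n * r\<^sup>2 / (2 * s) + s * c" by simp
    with 1 2 have "s * \<phi> x - real m * V x - real n * V y \<le> s * \<phi> z - s * V z + s * c" by linarith
    then show ?thesis using pos by (simp add: algebra_simps)
  qed
  have I: "(\<integral>\<^sup>+x. ennreal (exp (f x)) \<partial>lborel) = ennreal (\<integral>x. exp (f x) \<partial>lborel)"
    if "integrable lborel (\<lambda>x. exp (f x))" for f :: "'a \<Rightarrow> real"
    using that by (rule nn_integral_eq_integral) auto
  have zero: "0-lipschitz_on UNIV (\<lambda>_::'a. 0::real)" by (rule lipschitz_intros)
  have pz: "(\<integral>x. exp (- V x) \<partial>lborel) = partition (\<lambda>_. 0)" by (simp add: partition_def)
  have c_int: "exp (\<phi> x - V x + c) = exp c * exp (\<phi> x - V x)" for x by (simp add: exp_add)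
  have "(\<integral>\<^sup>+x. ennreal (exp (s / real m * \<phi> x - V x)) \<partial>lborel) ^ m * (\<integral>\<^sup>+x. ennreal (exp (0 - V x)) \<partial>lborel) ^ n
    \<le> (\<integral>\<^sup>+x. ennreal (exp (\<phi> x - V x + c)) \<partial>lborel) ^ (m + n)"
  proof (rule prekopa_leindler)
    fix x y :: 'a
    let ?z = "(1 / real (m + n)) *\<^sub>R (real m *\<^sub>R x + real n *\<^sub>R y)"
    have "exp (s / real m * \<phi> x - V x) ^ m * exp (0 - V y) ^ n
       = exp (real m * (s / real m * \<phi> x - V x) + real n * (- V y))"
      by (simp only: exp_of_nat_mult[symmetric] exp_add[symmetric]) simp
    also have "\<dots> \<le> exp (s * (\<phi> ?z - V ?z + c))"
      using point[of ?z x y] by (simp add: s_def)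
    also have "\<dots> = exp (\<phi> ?z - V ?z + c) ^ (m + n)" unfolding s_def by (rule exp_of_nat_mult)
    finally show "ennreal (exp (s / real m * \<phi> x - V x)) ^ m * ennreal (exp (0 - V y)) ^ n
      \<le> ennreal (exp (\<phi> ?z - V ?z + c)) ^ (m + n)"
      by (simp add: ennreal_power ennreal_mult[symmetric] ennreal_leI)
  qed (use mn in measurable)
  then have "ennreal (partition (\<lambda>x. s / real m * \<phi> x) ^ m * partition (\<lambda>_. 0) ^ n)
     \<le> ennreal ((exp c * partition \<phi>) ^ (m + n))"
    using integrable_exp_lipschitz[OF \<phi>'] integrable_exp_lipschitz[OF zero] integrable_exp_lipschitz[OF \<phi>]
      partition_pos[OF \<phi>'] partition_pos[OF zero] partition_pos[OF \<phi>]
    by (subst (asm) (1 2 3) I) (simp_all add: c_int pz partition_def[symmetric] ennreal_power ennreal_mult[symmetric] less_imp_le)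
  then have "partition (\<lambda>x. s / real m * \<phi> x) ^ m * partition (\<lambda>_. 0) ^ n \<le> (exp c * partition \<phi>) ^ (m + n)"
    using partition_pos[OF \<phi>] by (subst (asm) ennreal_le_iff) auto
  also have "\<dots> = partition \<phi> ^ (m + n) * exp (s * c)"
    unfolding s_def exp_of_nat_mult by (simp add: power_mult_distrib)
  finally show ?thesis by (simp add: s_def c_def mult.assoc)
qed

section \<open>Lipschitz functions under the Gibbs measure\<close>

lemma lipschitz_const_real: "0-lipschitz_on UNIV (\<lambda>_::'a. c::real)"
  by (rule lipschitz_intros)

lemma prob_space_gibbs: "prob_space gibbs"
proof
  have "integrable lborel (\<lambda>x. exp (- V x) / partition (\<lambda>_. 0))"
    using integrable_exp_lipschitz[OF lipschitz_const_real[of 0]] by simp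
  then have "(\<integral>\<^sup>+x. ennreal (exp (- V x) / partition (\<lambda>_. 0)) \<partial>lborel)
      = ennreal (\<integral>x. exp (- V x) / partition (\<lambda>_. 0) \<partial>lborel)"
    using partition_pos[OF lipschitz_const_real[of 0]] by (intro nn_integral_eq_integral) auto
  also have "(\<integral>x. exp (- V x) / partition (\<lambda>_. 0) \<partial>lborel) = partition (\<lambda>_. 0) / partition (\<lambda>_. 0)"
    by (simp add: partition_def)
  finally show "emeasure gibbs (space gibbs) = 1"
    using partition_pos[OF lipschitz_const_real[of 0]]
    unfolding gibbs_def by (subst emeasure_density) auto
qed

lemma sets_gibbs [simp, measurable_cong]: "sets gibbs = sets borel"
  by (simp add: gibbs_def)

lemma integrable_gibbs_iff:
  fixes F :: "'a \<Rightarrow> real"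
  assumes [measurable]: "F \<in> borel_measurable borel"
  shows "integrable gibbs F \<longleftrightarrow> integrable lborel (\<lambda>x. F x * exp (- V x))"
proof -
  have "integrable gibbs F \<longleftrightarrow> integrable lborel (\<lambda>x. (1 / partition (\<lambda>_. 0)) * (F x * exp (- V x)))"
    unfolding gibbs_def using partition_pos[OF lipschitz_const_real[of 0]]
    by (subst integrable_density) (auto simp: mult.commute)
  also have "\<dots> \<longleftrightarrow> integrable lborel (\<lambda>x. F x * exp (- V x))"
    using partition_pos[OF lipschitz_const_real[of 0]] by (subst integrable_mult_left_iff) auto
  finally show ?thesis .
qed

lemma expectation_gibbs:
  fixes F :: "'a \<Rightarrow> real"
  assumes [measurable]: "F \<in> borel_measurable borel"
  shows "(\<integral>x. F x \<partial>gibbs) = (\<integral>x. F x * exp (- V x) \<partial>lborel) / partition (\<lambda>_. 0)"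
  unfolding gibbs_def using partition_pos[OF lipschitz_const_real[of 0]]
  by (subst integral_density) (auto simp: mult.commute)

lemma expectation_gibbs_exp:
  fixes \<phi> :: "'a \<Rightarrow> real"
  assumes "b-lipschitz_on UNIV \<phi>"
  shows "(\<integral>x. exp (\<phi> x) \<partial>gibbs) = partition \<phi> / partition (\<lambda>_. 0)"
proof -
  have [measurable]: "\<phi> \<in> borel_measurable borel" by (rule lipschitz_borel_measurable[OF assms])
  show ?thesis by (subst expectation_gibbs) (auto simp: partition_def exp_add[symmetric])
qed

lemma integrable_gibbs_exp:
  fixes \<phi> :: "'a \<Rightarrow> real"
  assumes "b-lipschitz_on UNIV \<phi>"
  shows "integrable gibbs (\<lambda>x. exp (\<phi> x))"
proof -
  have [measurable]: "\<phi> \<in> borel_measurable borel" by (rule lipschitz_borel_measurable[OF assms])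
  show ?thesis
    using integrable_exp_lipschitz[OF assms] by (subst integrable_gibbs_iff) (auto simp: exp_add[symmetric])
qed

text \<open>The Prekopa-Leindler bound with weight \<open>1/(n+1)\<close> compares the exponential moments of \<open>\<psi>\<close>
  and \<open>\<psi>/(n+1)\<close>; as \<open>n \<rightarrow> \<infinity>\<close> the latter only sees the mean, which gives the sharp constant.\<close>

lemma gibbs_subgaussian:
  fixes \<psi> :: "'a \<Rightarrow> real"
  assumes \<psi>: "L-lipschitz_on UNIV \<psi>"
  shows "(\<integral>x. exp (\<psi> x) \<partial>gibbs) \<le> exp ((\<integral>x. \<psi> x \<partial>gibbs) + L\<^sup>2 / (2 * \<alpha>))"
proof -
  interpret prob_space gibbs by (rule prob_space_gibbs)
  have [measurable]: "\<psi> \<in> borel_measurable borel" by (rule lipschitz_borel_measurable[OF \<psi>])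
  have Lnn: "L \<ge> 0" using \<psi> by (rule lipschitz_on_nonneg)
  let ?Z = "partition (\<lambda>_. 0)"
  have Z: "?Z > 0" by (rule partition_pos[OF lipschitz_const_real])
  have abs_le: "\<bar>\<psi> x\<bar> \<le> \<bar>\<psi> 0\<bar> + L * norm x" for x by (rule lipschitz_real_norm_bound[OF \<psi>])
  have int\<psi>: "integrable gibbs \<psi>"
    unfolding integrable_gibbs_iff[OF \<open>\<psi> \<in> borel_measurable borel\<close>]
  proof (rule integrable_exp_bound[where C = "exp \<bar>\<psi> 0\<bar>" and K = L])
    fix x
    have "\<bar>\<psi> x\<bar> \<le> exp (\<bar>\<psi> 0\<bar> + L * norm x)"
      using abs_le[of x] exp_ge_add_one_self[of "\<bar>\<psi> 0\<bar> + L * norm x"] by linarith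
    then show "\<bar>\<psi> x\<bar> \<le> exp \<bar>\<psi> 0\<bar> * exp (L * norm x)" by (simp add: exp_add)
  qed measurable
  \<comment> \<open>The dominating function for the second-order remainder of
    \<open>exp (\<psi> / k)\<close>. Its mean \<open>M\<close> enters with \<open>1 / k^2\<close>;
    raising to the power \<open>k\<close> leaves \<open>M / k\<close>, which vanishes in the
    limit.\<close>
  have "integrable lborel (\<lambda>x. ((\<psi> x)\<^sup>2 * exp \<bar>\<psi> x\<bar>) * exp (- V x))"
  proof (rule integrable_exp_bound[where C = "exp (3 * \<bar>\<psi> 0\<bar>)" and K = "3 * L"])
    fix x :: 'a
    define s where "s = \<bar>\<psi> 0\<bar> + L * norm x"
    have s: "0 \<le> s" "\<bar>\<psi> x\<bar> \<le> s" using Lnn abs_le[of x] by (auto simp: s_def)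
    have "\<bar>\<psi> x\<bar> \<le> exp s" using s exp_ge_add_one_self[of s] by linarith
    then have "\<bar>\<psi> x\<bar>\<^sup>2 \<le> (exp s)\<^sup>2" by (intro power_mono) auto
    moreover have "exp \<bar>\<psi> x\<bar> \<le> exp s" using s by simp
    ultimately have "\<bar>\<psi> x\<bar>\<^sup>2 * exp \<bar>\<psi> x\<bar> \<le> (exp s)\<^sup>2 * exp s" by (intro mult_mono) auto
    also have "\<dots> = exp (3 * \<bar>\<psi> 0\<bar>) * exp (3 * L * norm x)"
      by (simp add: s_def exp_add[symmetric] power2_eq_square algebra_simps)
    finally show "\<bar>(\<psi> x)\<^sup>2 * exp \<bar>\<psi> x\<bar>\<bar> \<le> exp (3 * \<bar>\<psi> 0\<bar>) * exp (3 * L * norm x)"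
      by (simp add: abs_mult)
  qed measurable
  then have int2: "integrable gibbs (\<lambda>x. (\<psi> x)\<^sup>2 * exp \<bar>\<psi> x\<bar>)"
    by (subst integrable_gibbs_iff) auto
  define M where "M = expectation (\<lambda>x. (\<psi> x)\<^sup>2 * exp \<bar>\<psi> x\<bar>)"
  have step: "expectation (\<lambda>x. exp (\<psi> x)) \<le> exp (expectation \<psi> + L\<^sup>2 / (2 * \<alpha>) + M / real (Suc (Suc j)))" for j
  proof -
    \<comment> \<open>Starting at 1 keeps the second weight positive, as Prekopa-Leindler requires;
      the first weight is 1 and \<open>k = n + 1\<close> is the ratio of the two moment
      orders.\<close>
    define n where "n = Suc j"
    define k where "k = real (Suc n)"
    have k: "k \<ge> 1" "real (1 + n) = k" by (auto simp: k_def)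
    have \<psi>k: "(L / k)-lipschitz_on UNIV (\<lambda>x. \<psi> x / k)"
      using lipschitz_on_cmult_real[OF \<psi>, of "1 / k"] k by simp
    have small: "expectation (\<lambda>x. exp (\<psi> x / k)) \<le> exp ((expectation \<psi> + M / k) / k)"
    proof -
      have "expectation (\<lambda>x. exp (\<psi> x / k)) \<le> expectation (\<lambda>x. 1 + \<psi> x / k + (\<psi> x)\<^sup>2 * exp \<bar>\<psi> x\<bar> / k\<^sup>2)"
      proof (rule integral_mono)
        fix x
        have "exp (\<psi> x / k) \<le> 1 + \<psi> x / k + (\<psi> x / k)\<^sup>2 * exp \<bar>\<psi> x / k\<bar>" by (rule exp_le_quadratic)
        also have "(\<psi> x / k)\<^sup>2 * exp \<bar>\<psi> x / k\<bar> \<le> (\<psi> x / k)\<^sup>2 * exp \<bar>\<psi> x\<bar>"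
          using k by (intro mult_left_mono) (auto simp: divide_le_eq abs_divide mult_le_cancel_left1)
        finally show "exp (\<psi> x / k) \<le> 1 + \<psi> x / k + (\<psi> x)\<^sup>2 * exp \<bar>\<psi> x\<bar> / k\<^sup>2"
          by (simp add: power_divide)
      qed (use int\<psi> int2 integrable_gibbs_exp[OF \<psi>k] in auto)
      also have "\<dots> = 1 + expectation \<psi> / k + M / k\<^sup>2"
        using int\<psi> int2 by (simp add: M_def prob_space)
      also have "\<dots> = 1 + (expectation \<psi> + M / k) / k" by (simp add: power2_eq_square add_divide_distrib)
      also have "\<dots> \<le> exp ((expectation \<psi> + M / k) / k)" by (rule exp_ge_add_one_self)
      finally show ?thesis .
    qed
    have "partition (\<lambda>x. real (1 + n) / real 1 * (\<psi> x / k)) ^ 1 * ?Z ^ n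
      \<le> partition (\<lambda>x. \<psi> x / k) ^ (1 + n) * exp (real (1 + n) * real n * (L / k)\<^sup>2 / (2 * \<alpha> * real 1))"
      by (rule partition_prekopa_leindler[OF \<psi>k]) (auto simp: n_def)
    then have "partition \<psi> * ?Z ^ n \<le> partition (\<lambda>x. \<psi> x / k) ^ (1 + n) * exp (k * real n * (L / k)\<^sup>2 / (2 * \<alpha>))"
      unfolding k(2) using k(1) by simp
    then have "partition \<psi> * ?Z ^ n / ?Z ^ (1 + n)
      \<le> partition (\<lambda>x. \<psi> x / k) ^ (1 + n) * exp (k * real n * (L / k)\<^sup>2 / (2 * \<alpha>)) / ?Z ^ (1 + n)"
      using Z by (intro divide_right_mono) auto
    note a1 = this
    have a2: "partition \<psi> * ?Z ^ n / ?Z ^ (1 + n) = expectation (\<lambda>x. exp (\<psi> x))"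
      using Z by (simp add: expectation_gibbs_exp[OF \<psi>])
    have a3: "partition (\<lambda>x. \<psi> x / k) ^ (1 + n) / ?Z ^ (1 + n) = expectation (\<lambda>x. exp (\<psi> x / k)) ^ (1 + n)"
      by (simp add: expectation_gibbs_exp[OF \<psi>k] power_divide)
    have "expectation (\<lambda>x. exp (\<psi> x))
        \<le> expectation (\<lambda>x. exp (\<psi> x / k)) ^ (1 + n) * exp (k * real n * (L / k)\<^sup>2 / (2 * \<alpha>))"
      using a1 unfolding a2 unfolding times_divide_eq_left[symmetric] a3 .
    also have "\<dots> \<le> exp ((expectation \<psi> + M / k) / k) ^ (1 + n) * exp (L\<^sup>2 / (2 * \<alpha>))"
    proof (rule mult_mono)
      show "expectation (\<lambda>x. exp (\<psi> x / k)) ^ (1 + n) \<le> exp ((expectation \<psi> + M / k) / k) ^ (1 + n)"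
        by (intro power_mono small integral_nonneg_AE) auto
      \<comment> \<open>The Lipschitz constant of \<open>\<psi> / k\<close> is \<open>L / k\<close>,
        so the Prekopa-Leindler error stays below \<open>L^2 / (2 * \<alpha>)\<close> for every
        \<open>n\<close>.\<close>
      have "real n \<le> k" by (simp add: k_def)
      then have "k * real n * (L / k)\<^sup>2 \<le> k * k * (L / k)\<^sup>2"
        using k by (intro mult_right_mono mult_left_mono) auto
      also have "\<dots> = L\<^sup>2" using k by (simp add: power2_eq_square)
      finally show "exp (k * real n * (L / k)\<^sup>2 / (2 * \<alpha>)) \<le> exp (L\<^sup>2 / (2 * \<alpha>))"
        using \<alpha> by (simp add: divide_right_mono)
    qed auto
    also have "exp ((expectation \<psi> + M / k) / k) ^ (1 + n) = exp (expectation \<psi> + M / k)"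
      using k by (simp only: exp_of_nat_mult[symmetric]) simp
    finally show ?thesis
      by (simp add: exp_add[symmetric] k_def n_def algebra_simps)
  qed
  have "(\<lambda>j. exp (expectation \<psi> + L\<^sup>2 / (2 * \<alpha>) + M / real (Suc (Suc j))))
      \<longlonglongrightarrow> exp (expectation \<psi> + L\<^sup>2 / (2 * \<alpha>) + 0)"
    by (intro tendsto_intros LIMSEQ_Suc[OF LIMSEQ_Suc[OF lim_const_over_n]])
  then show ?thesis
    using step by (intro LIMSEQ_le_const[of _ "exp (expectation \<psi> + L\<^sup>2 / (2 * \<alpha>))"]) auto
qed

text \<open>Gaussian linearization: \<open>exp (s^2 / 2)\<close> is the mean of
  \<open>exp (s * t)\<close> over a standard normal \<open>t\<close>. After exchanging the integrals
  the sub-Gaussian bound applies for each \<open>t\<close> and contributes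
  \<open>exp (3 * t^2 / 8)\<close>, turning the standard normal density into twice the density of
  standard deviation 2. The value 2 is \<open>1 / sqrt (1 - 2 * \<kappa> * L^2 / \<alpha>)\<close>
  at the chosen \<open>\<kappa>\<close>.\<close>

lemma gibbs_gaussian_moment:
  fixes f :: "'a \<Rightarrow> real"
  assumes f: "L-lipschitz_on UNIV f" and \<kappa>: "\<kappa> \<ge> 0" "\<kappa> * L\<^sup>2 = 3 * \<alpha> / 8"
  shows "(\<integral>\<^sup>+x. ennreal (exp (\<kappa> * (f x - (\<integral>y. f y \<partial>gibbs))\<^sup>2)) \<partial>gibbs) \<le> 2"
proof -
  interpret prob_space gibbs by (rule prob_space_gibbs)
  interpret pair_sigma_finite lborel gibbs by standard
  have [measurable]: "f \<in> borel_measurable borel" by (rule lipschitz_borel_measurable[OF f])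
  define c where "c = expectation f"
  define s where "s x = sqrt (2 * \<kappa>) * (f x - c)" for x
  have [measurable]: "s \<in> borel_measurable borel" unfolding s_def by measurable
  have L: "L \<ge> 0" using f by (rule lipschitz_on_nonneg)
  have linearize: "ennreal (exp (\<kappa> * (f x - c)\<^sup>2)) = (\<integral>\<^sup>+t. ennreal (std_normal_density t * exp (s x * t)) \<partial>lborel)" for x
  proof -
    have "(s x)\<^sup>2 / 2 = \<kappa> * (f x - c)\<^sup>2" using \<kappa>(1) by (simp add: s_def power_mult_distrib)
    then have "std_normal_density t * exp (s x * t) = exp (\<kappa> * (f x - c)\<^sup>2) * normal_density (s x) 1 t" for t
      by (simp add: normal_density_def exp_add[symmetric] power2_eq_square field_simps)
    then have "(\<integral>\<^sup>+t. ennreal (std_normal_density t * exp (s x * t)) \<partial>lborel)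
      = (\<integral>\<^sup>+t. ennreal (exp (\<kappa> * (f x - c)\<^sup>2)) * ennreal (normal_density (s x) 1 t) \<partial>lborel)"
      by (simp add: ennreal_mult)
    also have "\<dots> = ennreal (exp (\<kappa> * (f x - c)\<^sup>2)) * 1"
      by (subst nn_integral_cmult) (auto simp: nn_integral_eq_integral)
    finally show ?thesis by simp
  qed
  have mgf: "(\<integral>\<^sup>+x. ennreal (std_normal_density t * exp (s x * t)) \<partial>gibbs) \<le> ennreal (2 * normal_density 0 2 t)" for t
  proof -
    have lip: "(\<bar>sqrt (2 * \<kappa>) * t\<bar> * L)-lipschitz_on UNIV (\<lambda>x. s x * t)"
    proof (rule lipschitz_onI)
      fix x y
      have "dist (s x * t) (s y * t) = \<bar>sqrt (2 * \<kappa>) * t\<bar> * dist (f x) (f y)"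
        by (simp add: s_def dist_real_def abs_mult[symmetric] algebra_simps)
      also have "\<dots> \<le> \<bar>sqrt (2 * \<kappa>) * t\<bar> * (L * dist x y)"
        by (intro mult_left_mono lipschitz_onD[OF f]) auto
      finally show "dist (s x * t) (s y * t) \<le> \<bar>sqrt (2 * \<kappa>) * t\<bar> * L * dist x y" by (simp add: mult.assoc)
    qed (use L in simp)
    have "integrable gibbs f"
    proof -
      have "integrable lborel (\<lambda>x. f x * exp (- V x))"
      proof (rule integrable_exp_bound[where C = "exp \<bar>f 0\<bar>" and K = L])
        fix x
        have "\<bar>f x\<bar> \<le> exp (\<bar>f 0\<bar> + L * norm x)"
          using lipschitz_real_norm_bound[OF f, of x] exp_ge_add_one_self[of "\<bar>f 0\<bar> + L * norm x"] by linarith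
        then show "\<bar>f x\<bar> \<le> exp \<bar>f 0\<bar> * exp (L * norm x)" by (simp add: exp_add)
      qed measurable
      then show ?thesis by (subst integrable_gibbs_iff) auto
    qed
    then have "expectation (\<lambda>x. s x * t) = 0"
      by (simp add: s_def c_def prob_space)
    moreover have "(\<bar>sqrt (2 * \<kappa>) * t\<bar> * L)\<^sup>2 / (2 * \<alpha>) = 3 * t\<^sup>2 / 8"
    proof -
      have "(\<bar>sqrt (2 * \<kappa>) * t\<bar> * L)\<^sup>2 = 2 * (\<kappa> * L\<^sup>2) * t\<^sup>2"
        using \<kappa>(1) by (simp add: power_mult_distrib)
      also have "\<dots> / (2 * \<alpha>) = 3 * t\<^sup>2 / 8" unfolding \<kappa>(2) using \<alpha> by simp
      finally show ?thesis .
    qed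
    ultimately have "expectation (\<lambda>x. exp (s x * t)) \<le> exp (0 + 3 * t\<^sup>2 / 8)"
      using gibbs_subgaussian[OF lip] by (simp only:)
    then have "expectation (\<lambda>x. exp (s x * t)) \<le> exp (3 * t\<^sup>2 / 8)" by simp
    then have le: "std_normal_density t * expectation (\<lambda>x. exp (s x * t)) \<le> std_normal_density t * exp (3 * t\<^sup>2 / 8)"
      by (intro mult_left_mono) auto
    have "(\<integral>\<^sup>+x. ennreal (std_normal_density t * exp (s x * t)) \<partial>gibbs)
      = ennreal (expectation (\<lambda>x. std_normal_density t * exp (s x * t)))"
      by (rule nn_integral_eq_integral) (auto intro: integrable_gibbs_exp[OF lip])
    also have "expectation (\<lambda>x. std_normal_density t * exp (s x * t)) = std_normal_density t * expectation (\<lambda>x. exp (s x * t))"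
      by simp
    also have "ennreal \<dots> \<le> ennreal (std_normal_density t * exp (3 * t\<^sup>2 / 8))"
      by (rule ennreal_leI[OF le])
    also have "std_normal_density t * exp (3 * t\<^sup>2 / 8) = 2 * normal_density 0 2 t"
      using real_sqrt_mult[of 4 2] by (simp add: normal_density_def real_sqrt_mult exp_add[symmetric])
    finally show ?thesis .
  qed
  have "(\<integral>\<^sup>+x. ennreal (exp (\<kappa> * (f x - c)\<^sup>2)) \<partial>gibbs)
    = (\<integral>\<^sup>+x. (\<integral>\<^sup>+t. ennreal (std_normal_density t * exp (s x * t)) \<partial>lborel) \<partial>gibbs)"
    by (simp add: linearize)
  also have "\<dots> = (\<integral>\<^sup>+t. (\<integral>\<^sup>+x. ennreal (std_normal_density t * exp (s x * t)) \<partial>gibbs) \<partial>lborel)"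
    by (rule Fubini') measurable
  also have "\<dots> \<le> (\<integral>\<^sup>+t. ennreal (2 * normal_density 0 2 t) \<partial>lborel)"
    by (intro nn_integral_mono mgf)
  also have "\<dots> = 2"
    by (subst nn_integral_eq_integral) auto
  finally show ?thesis unfolding c_def .
qed

end

text \<open>The entropy inequality is not invoked as such but unfolded into two applications of
  Jensen's inequality under \<open>\<pi>\<close>: one for \<open>\<psi> + g\<close>, one for
  \<open>- g / 2\<close>. Combining them eliminates the unknown mean of \<open>g\<close>, and
  Prekopa-Leindler bounds what remains.\<close>

lemma has_density_propto_exp_lipschitz_variance:
  fixes V g f :: "'a::euclidean_space \<Rightarrow> real"
  assumes \<alpha>: "\<alpha> > 0" and sc: "strongly_convex \<alpha> V"
    and g: "b-lipschitz_on UNIV g" and f: "L-lipschitz_on UNIV f"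
    and \<pi>: "has_density_propto lborel \<pi> (\<lambda>x. exp (- V x - g x))"
  shows "(\<integral>x. (f x - (\<integral>y. f y \<partial>\<pi>))\<^sup>2 \<partial>\<pi>) \<le> L\<^sup>2 * (2 / \<alpha> + 2 * b\<^sup>2 / \<alpha>\<^sup>2)"
proof (cases "L = 0")
  \<comment> \<open>The constant \<open>\<kappa>\<close> of the main case divides by
    \<open>L^2\<close>, so constant functions are treated apart.\<close>
  case True
  have "prob_space \<pi>" using \<pi> by (simp add: has_density_propto_def)
  then interpret prob_space \<pi> .
  have "f x = f 0" for x using lipschitz_onD[OF f, of x 0] True by simp
  then have "expectation f = f 0"
    using prob_space by (metis (mono_tags, lifting) Bochner_Integration.integral_cong lebesgue_integral_const scaleR_one)
  then have "f x - expectation f = 0" for x using \<open>\<And>x. f x = f 0\<close>[of x] by simp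
  then show ?thesis using True by (simp add: prob_space)
next
  case False
  interpret V: strongly_convex_potential V \<alpha> by standard fact+
  obtain c0 where c0: "c0 > 0" and \<pi>eq: "\<pi> = density lborel (\<lambda>x. ennreal (c0 * exp (- V x - g x)))"
    and "prob_space \<pi>"
    using \<pi> by (auto simp: has_density_propto_def)
  then interpret prob_space \<pi> by simp
  have [measurable]: "f \<in> borel_measurable borel" "g \<in> borel_measurable borel"
    using f g by (auto intro: lipschitz_borel_measurable)
  have L: "L > 0" using lipschitz_on_nonneg[OF f] False by simp
  have sets_\<pi>[measurable_cong]: "sets \<pi> = sets borel" by (simp add: \<pi>eq)
  have E: "expectation F = c0 * (\<integral>x. F x * exp (- g x) * exp (- V x) \<partial>lborel)"
    if [measurable]: "F \<in> borel_measurable borel" for F :: "'a \<Rightarrow> real"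
  proof -
    have "expectation F = (\<integral>x. c0 * (F x * exp (- g x) * exp (- V x)) \<partial>lborel)"
      unfolding \<pi>eq using c0
      by (subst integral_density) (auto simp: mult_ac exp_add[symmetric] intro!: Bochner_Integration.integral_cong)
    then show ?thesis by simp
  qed
  have I: "integrable \<pi> F \<longleftrightarrow> integrable lborel (\<lambda>x. F x * exp (- g x) * exp (- V x))"
    if [measurable]: "F \<in> borel_measurable borel" for F :: "'a \<Rightarrow> real"
  proof -
    have "integrable \<pi> F \<longleftrightarrow> integrable lborel (\<lambda>x. c0 * (F x * exp (- g x) * exp (- V x)))"
      unfolding \<pi>eq using c0
      by (subst integrable_density) (auto simp: mult_ac exp_add[symmetric] intro!: integrable_cong)
    then show ?thesis using c0 by simp
  qed
  have int_bd: "integrable \<pi> F"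
    if [measurable]: "F \<in> borel_measurable borel" and le: "\<And>x. \<bar>F x\<bar> \<le> C * exp (K * norm x)"
    for F :: "'a \<Rightarrow> real" and C K
    unfolding I[OF that(1)]
  proof (rule V.integrable_exp_bound[where C = "C * exp \<bar>g 0\<bar>" and K = "K + b"])
    fix x
    have "- g x \<le> \<bar>g 0\<bar> + b * norm x" using lipschitz_real_norm_bound[OF g, of x] by simp
    then have "exp (- g x) \<le> exp (\<bar>g 0\<bar> + b * norm x)" by simp
    then have "\<bar>F x * exp (- g x)\<bar> \<le> (C * exp (K * norm x)) * exp (\<bar>g 0\<bar> + b * norm x)"
      using le[of x] unfolding abs_mult by (intro mult_mono) (auto intro: order_trans[OF abs_ge_zero])
    also have "\<dots> = C * exp \<bar>g 0\<bar> * exp ((K + b) * norm x)"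
      by (simp add: exp_add distrib_right)
    finally show "\<bar>F x * exp (- g x)\<bar> \<le> C * exp \<bar>g 0\<bar> * exp ((K + b) * norm x)" .
  qed measurable
  have lin_bd: "\<bar>F x\<bar> \<le> exp \<bar>F 0\<bar> * exp (M * norm x)" if "M-lipschitz_on UNIV F" for F :: "'a \<Rightarrow> real" and M x
    using lipschitz_real_norm_bound[OF that, of x] exp_ge_add_one_self[of "\<bar>F 0\<bar> + M * norm x"]
    unfolding exp_add[symmetric] by linarith
  \<comment> \<open>With moments of order \<open>3/2\<close> the relative entropy is at most \<open>3/2 * b\<^sup>2 / (2 \<alpha>)\<close>; this \<open>\<kappa>\<close> turns it into
    exactly \<open>2 b\<^sup>2 L\<^sup>2 / \<alpha>\<^sup>2\<close>, and the remaining term fits because \<open>ln 2 \<le> 3/4\<close>.\<close>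
  define \<kappa> where "\<kappa> = 3 * \<alpha> / (8 * L\<^sup>2)"
  have \<kappa>: "\<kappa> > 0" "\<kappa> * L\<^sup>2 = 3 * \<alpha> / 8" using L \<alpha> by (auto simp: \<kappa>_def)
  \<comment> \<open>The Gaussian moment is centred at the mean under \<open>gibbs\<close>. This is
    harmless, since the variance under \<open>\<pi>\<close> is at most the second moment about any
    point.\<close>
  define c where "c = (\<integral>x. f x \<partial>V.gibbs)"
  define \<psi> where "\<psi> x = \<kappa> * (f x - c)\<^sup>2" for x
  have [measurable]: "\<psi> \<in> borel_measurable borel" unfolding \<psi>_def by measurable
  have fc: "L-lipschitz_on UNIV (\<lambda>x. f x - c)"
    using f by (auto simp: lipschitz_on_def dist_real_def)
  have int_g: "integrable \<pi> g" by (rule int_bd[OF _ lin_bd[OF g]]) measurable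
  have int_f: "integrable \<pi> f" by (rule int_bd[OF _ lin_bd[OF f]]) measurable
  have int_f2: "integrable \<pi> (\<lambda>x. (f x - c)\<^sup>2)"
  proof (rule int_bd)
    fix x
    have "\<bar>f x - c\<bar> * \<bar>f x - c\<bar> \<le> (exp \<bar>f 0 - c\<bar> * exp (L * norm x)) * (exp \<bar>f 0 - c\<bar> * exp (L * norm x))"
      by (intro mult_mono lin_bd[OF fc]) auto
    then show "\<bar>(f x - c)\<^sup>2\<bar> \<le> exp (2 * \<bar>f 0 - c\<bar>) * exp ((2 * L) * norm x)"
      by (simp add: power2_eq_square exp_add[symmetric] abs_mult[symmetric] mult.assoc)
  qed measurable
  have int_\<psi>: "integrable \<pi> \<psi>" unfolding \<psi>_def using int_f2 by simp
  interpret G: prob_space V.gibbs by (rule V.prob_space_gibbs)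
  let ?Z = "V.partition (\<lambda>_. 0)"
  have Z: "?Z > 0" by (rule V.partition_pos[OF V.lipschitz_const_real])
  have nn: "(\<integral>\<^sup>+x. ennreal (exp (\<psi> x)) \<partial>V.gibbs) \<le> ennreal 2"
    using V.gibbs_gaussian_moment[OF f _ \<kappa>(2)] \<kappa>(1) by (simp add: \<psi>_def c_def)
  have int_e\<psi>: "integrable V.gibbs (\<lambda>x. exp (\<psi> x))"
    using nn by (intro integrableI_nonneg) (auto intro: le_less_trans)
  have "ennreal (G.expectation (\<lambda>x. exp (\<psi> x))) \<le> ennreal 2"
    using nn by (subst (asm) nn_integral_eq_integral[OF int_e\<psi>]) auto
  then have e\<psi>: "G.expectation (\<lambda>x. exp (\<psi> x)) \<le> 2" by (subst (asm) ennreal_le_iff) auto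
  \<comment> \<open>Adding \<open>g\<close> to \<open>\<psi>\<close> cancels the factor
    \<open>exp (- g)\<close> of the density, so that the moment on the right is one under
    \<open>gibbs\<close>.\<close>
  have 1: "exp (expectation \<psi> + expectation g) \<le> c0 * (2 * ?Z)"
  proof -
    have "exp (expectation (\<lambda>x. \<psi> x + g x)) \<le> expectation (\<lambda>x. exp (\<psi> x + g x))"
    proof (rule exp_expectation_le)
      show "integrable \<pi> (\<lambda>x. exp (\<psi> x + g x))"
        using int_e\<psi> by (subst I) (auto simp: V.integrable_gibbs_iff exp_add[symmetric])
    qed (use int_\<psi> int_g in auto)
    also have "expectation (\<lambda>x. exp (\<psi> x + g x)) = c0 * (\<integral>x. exp (\<psi> x) * exp (- V x) \<partial>lborel)"
      by (subst E) (auto simp: exp_add[symmetric])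
    also have "(\<integral>x. exp (\<psi> x) * exp (- V x) \<partial>lborel) = G.expectation (\<lambda>x. exp (\<psi> x)) * ?Z"
      using Z by (subst V.expectation_gibbs) auto
    also have "c0 * \<dots> \<le> c0 * (2 * ?Z)"
      using e\<psi> Z c0 by (intro mult_left_mono mult_right_mono) auto
    finally show ?thesis using int_\<psi> int_g by simp
  qed
  have ng: "b-lipschitz_on UNIV (\<lambda>x. - g x)" using g by (rule lipschitz_on_minus)
  have ng2: "(3 / 2 * b)-lipschitz_on UNIV (\<lambda>x. 3 / 2 * - g x)"
    using lipschitz_on_cmult_real[OF ng, of "3 / 2"] by simp
  \<comment> \<open>Together with the factor \<open>exp (- g)\<close> of the density,
    \<open>exp (- g / 2)\<close> yields the moment of order 3/2.\<close>
  have 2: "exp (- expectation g / 2) \<le> c0 * V.partition (\<lambda>x. 3 / 2 * - g x)"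
  proof -
    have "exp (expectation (\<lambda>x. - g x / 2)) \<le> expectation (\<lambda>x. exp (- g x / 2))"
    proof (rule exp_expectation_le)
      show "integrable \<pi> (\<lambda>x. exp (- g x / 2))"
        using V.integrable_exp_lipschitz[OF ng2] by (subst I) (auto simp: exp_add[symmetric])
    qed (use int_g in auto)
    also have "\<dots> = c0 * V.partition (\<lambda>x. 3 / 2 * - g x)"
      by (subst E) (auto simp: exp_add[symmetric] V.partition_def)
    finally show ?thesis by simp
  qed
  have norm: "c0 * V.partition (\<lambda>x. - g x) = 1"
    using E[of "\<lambda>_. 1"] by (simp add: prob_space V.partition_def exp_add[symmetric])
  have 3: "V.partition (\<lambda>x. 3 / 2 * - g x) ^ 2 * ?Z \<le> V.partition (\<lambda>x. - g x) ^ 3 * exp (3 * b\<^sup>2 / (4 * \<alpha>))"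
    using V.partition_prekopa_leindler[OF ng, of 2 1] by (simp add: mult.commute)
  \<comment> \<open>The square of \<open>2\<close> removes the mean of \<open>g\<close> from
    \<open>1\<close>. The powers of \<open>c0\<close> add up to 3, matching the cube in
    \<open>3\<close>, where \<open>norm\<close> turns them into 1.\<close>
  have "exp (expectation \<psi>) = exp (expectation \<psi> + expectation g) * (exp (- expectation g / 2))\<^sup>2"
    by (simp add: exp_add[symmetric] power2_eq_square)
  also have "\<dots> \<le> (c0 * (2 * ?Z)) * (c0 * V.partition (\<lambda>x. 3 / 2 * - g x))\<^sup>2"
    using c0 Z by (intro mult_mono 1 power_mono 2) auto
  also have "\<dots> = 2 * c0 ^ 3 * (V.partition (\<lambda>x. 3 / 2 * - g x) ^ 2 * ?Z)"
    by (simp add: power2_eq_square power3_eq_cube)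
  also have "\<dots> \<le> 2 * c0 ^ 3 * (V.partition (\<lambda>x. - g x) ^ 3 * exp (3 * b\<^sup>2 / (4 * \<alpha>)))"
    using c0 by (intro mult_left_mono 3) auto
  also have "\<dots> = 2 * (c0 * V.partition (\<lambda>x. - g x)) ^ 3 * exp (3 * b\<^sup>2 / (4 * \<alpha>))"
    by (simp add: power_mult_distrib)
  also have "\<dots> = exp (ln 2 + 3 * b\<^sup>2 / (4 * \<alpha>))" by (simp add: norm exp_add)
  finally have "expectation \<psi> \<le> ln 2 + 3 * b\<^sup>2 / (4 * \<alpha>)" by simp
  also have "ln (2::real) \<le> 3 / 4" using ln2_le_25_over_36 by simp
  finally have "\<kappa> * expectation (\<lambda>x. (f x - c)\<^sup>2) \<le> 3 / 4 + 3 * b\<^sup>2 / (4 * \<alpha>)"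
    unfolding \<psi>_def by simp
  then have "expectation (\<lambda>x. (f x - c)\<^sup>2) \<le> (3 / 4 + 3 * b\<^sup>2 / (4 * \<alpha>)) / \<kappa>"
    using \<kappa>(1) by (simp add: pos_le_divide_eq mult.commute)
  also have "\<dots> = L\<^sup>2 * (2 / \<alpha> + 2 * b\<^sup>2 / \<alpha>\<^sup>2)"
    using \<alpha> L by (simp add: \<kappa>_def field_simps power2_eq_square)
  finally have "expectation (\<lambda>x. (f x - c)\<^sup>2) \<le> L\<^sup>2 * (2 / \<alpha> + 2 * b\<^sup>2 / \<alpha>\<^sup>2)" .
  moreover have "expectation (\<lambda>x. (f x - expectation f)\<^sup>2) \<le> expectation (\<lambda>x. (f x - c)\<^sup>2)"
  proof -
    have "(f x - c)\<^sup>2 = (f x - expectation f)\<^sup>2 + 2 * (expectation f - c) * (f x - expectation f) + (expectation f - c)\<^sup>2" for x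
      by (simp add: power2_eq_square algebra_simps)
    note eq = this
    have i2: "integrable \<pi> (\<lambda>x. (f x - expectation f)\<^sup>2)"
    proof -
      have "(f x - expectation f)\<^sup>2 = (f x - c)\<^sup>2 - 2 * (expectation f - c) * (f x - c) + (expectation f - c)\<^sup>2" for x
        by (simp add: power2_eq_square algebra_simps)
      then show ?thesis using int_f int_f2 by simp
    qed
    have "expectation (\<lambda>x. (f x - c)\<^sup>2) = expectation (\<lambda>x. (f x - expectation f)\<^sup>2) + (expectation f - c)\<^sup>2"
      unfolding eq using int_f i2 by (simp add: prob_space)
    then show ?thesis by simp
  qed
  ultimately show ?thesis by linarith
qed

section \<open>The Poincare inequality for Lipschitz functions\<close>

text \<open>The classical flat function \<open>exp (- 1 / t)\<close>, with a polynomial in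
  \<open>1 / t\<close> as a factor so that the family is closed under differentiation: the
  derivative replaces \<open>p\<close> by \<open>X^2 * (p - p')\<close>.\<close>

definition flat_exp :: "real poly \<Rightarrow> real \<Rightarrow> real" where
  "flat_exp p t = (if t > 0 then poly p (1 / t) * exp (- (1 / t)) else 0)"

lemma poly_times_exp_minus_tendsto_0:
  "((\<lambda>s::real. poly p s * exp (- s)) \<longlongrightarrow> 0) at_top"
proof -
  have "((\<lambda>s. \<Sum>i\<le>degree p. coeff p i * (s ^ i / exp s)) \<longlongrightarrow> (\<Sum>i\<le>degree p. coeff p i * 0)) at_top"
    by (intro tendsto_intros tendsto_power_div_exp_0)
  then show ?thesis
    by (simp add: poly_altdef sum_distrib_right exp_minus divide_inverse mult.assoc)
qed

lemma flat_exp_tendsto_0: "(flat_exp p \<longlongrightarrow> 0) (at_right 0)"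
proof -
  have "((\<lambda>t. poly p (inverse t) * exp (- inverse t)) \<longlongrightarrow> 0) (at_right (0::real))"
    using filterlim_compose[OF poly_times_exp_minus_tendsto_0 filterlim_inverse_at_top_right] .
  then show ?thesis
    by (rule Lim_transform_eventually)
      (auto simp: eventually_at_filter flat_exp_def inverse_eq_divide)
qed

lemma flat_exp_has_real_derivative:
  "(flat_exp p has_real_derivative flat_exp ([:0, 0, 1:] * (p - pderiv p)) t) (at t)"
proof -
  consider "t > 0" | "t < 0" | "t = 0" by linarith
  then show ?thesis
  proof cases
    case 1
    have "((\<lambda>t. poly p (1 / t) * exp (- (1 / t))) has_real_derivative
        poly ([:0, 0, 1:] * (p - pderiv p)) (1 / t) * exp (- (1 / t))) (at t)"
      using 1 by (auto intro!: derivative_eq_intros DERIV_chain2[OF poly_DERIV]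
          simp: field_simps power2_eq_square)
    moreover have "flat_exp ([:0, 0, 1:] * (p - pderiv p)) t = poly ([:0, 0, 1:] * (p - pderiv p)) (1 / t) * exp (- (1 / t))"
      using 1 by (simp only: flat_exp_def if_True)
    ultimately have "((\<lambda>t. poly p (1 / t) * exp (- (1 / t))) has_real_derivative
        flat_exp ([:0, 0, 1:] * (p - pderiv p)) t) (at t)" by simp
    then show ?thesis
      by (rule has_field_derivative_transform_within_open[of _ _ _ "{0<..}"])
        (use 1 in \<open>auto simp: flat_exp_def\<close>)
  next
    case 2
    have "((\<lambda>t. 0) has_real_derivative flat_exp ([:0, 0, 1:] * (p - pderiv p)) t) (at t)"
      using 2 by (simp add: flat_exp_def)
    then show ?thesis
      by (rule has_field_derivative_transform_within_open[of _ _ _ "{..<0}"])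
        (use 2 in \<open>auto simp: flat_exp_def\<close>)
  next
    case 3
    \<comment> \<open>Dividing by \<open>h > 0\<close> multiplies the polynomial by
      \<open>X\<close>, so the difference quotient at 0 is again of this family.\<close>
    have "((\<lambda>h. flat_exp (pCons 0 p) h) \<longlongrightarrow> 0) (at_right 0)" by (rule flat_exp_tendsto_0)
    then have r: "((\<lambda>h. (flat_exp p h - flat_exp p 0) / (h - 0)) \<longlongrightarrow> 0) (at_right 0)"
      by (rule Lim_transform_eventually) (auto simp: eventually_at_filter flat_exp_def)
    have l: "((\<lambda>h. (flat_exp p h - flat_exp p 0) / (h - 0)) \<longlongrightarrow> 0) (at_left 0)"
      by (rule Lim_transform_eventually[OF tendsto_const]) (auto simp: eventually_at_filter flat_exp_def)
    from filterlim_split_at[OF l r] show ?thesis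
      by (simp add: 3 has_field_derivative_iff flat_exp_def)
  qed
qed

lemma CkI:
  assumes "\<And>x. (f has_derivative D x) (at x)" "\<And>b. b \<in> Basis \<Longrightarrow> Ck k (\<lambda>x. D x b)"
  shows "Ck (Suc k) f"
proof -
  have "frechet_derivative f (at x) = D x" for x
    using frechet_derivative_at[OF assms(1)] by simp
  then show ?thesis
    using assms by (auto simp: differentiable_on_def differentiable_def intro: has_derivative_at_withinI)
qed

lemma Ck_has_derivative:
  "Ck (Suc k) f \<Longrightarrow> (f has_derivative frechet_derivative f (at x)) (at x)"
  by (simp add: differentiable_on_def frechet_derivative_works[symmetric])

lemma Ck_continuous: "Ck k f \<Longrightarrow> continuous_on UNIV f"
  by (cases k) (auto intro: differentiable_imp_continuous_on)

lemma Ck_Suc_imp: "Ck (Suc k) f \<Longrightarrow> Ck k f"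
proof (induction k arbitrary: f)
  case 0
  then show ?case using Ck_continuous[OF 0] by simp
next
  case (Suc k)
  then show ?case by (metis Ck.simps(2))
qed

lemma Ck_const: "Ck k (\<lambda>x. c)"
proof (induction k arbitrary: c)
  case (Suc k)
  show ?case by (rule CkI[where D = "\<lambda>_ _. 0"]) (auto simp: Suc)
qed simp

lemma Ck_add: "Ck k f \<Longrightarrow> Ck k g \<Longrightarrow> Ck k (\<lambda>x. f x + g x)"
proof (induction k arbitrary: f g)
  case (Suc k)
  show ?case
    by (rule CkI[OF has_derivative_add[OF Ck_has_derivative[OF Suc.prems(1)] Ck_has_derivative[OF Suc.prems(2)]]])
      (use Suc in auto)
qed (auto intro: continuous_intros)

lemma Ck_mult: "Ck k f \<Longrightarrow> Ck k g \<Longrightarrow> Ck k (\<lambda>x. f x * g x)"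
proof (induction k arbitrary: f g)
  case (Suc k)
  show ?case
    by (rule CkI[OF has_derivative_mult[OF Ck_has_derivative[OF Suc.prems(1)] Ck_has_derivative[OF Suc.prems(2)]]])
      (use Suc Ck_Suc_imp in \<open>auto intro!: Ck_add Suc.IH\<close>)
qed (auto intro: continuous_intros)

lemma Ck_sum: "finite A \<Longrightarrow> (\<And>a. a \<in> A \<Longrightarrow> Ck k (f a)) \<Longrightarrow> Ck k (\<lambda>x. \<Sum>a\<in>A. f a x)"
  by (induction A rule: finite_induct) (auto intro: Ck_const Ck_add)

lemma Ck_inner_left: "Ck k (\<lambda>x. x \<bullet> c)"
proof (cases k)
  case (Suc j)
  show ?thesis unfolding Suc
    by (rule CkI[where D = "\<lambda>_ h. h \<bullet> c"]) (auto intro: Ck_const bounded_linear_imp_has_derivative bounded_linear_inner_left)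
qed (auto intro: continuous_intros)

lemma Ck_norm_squared: "Ck k (\<lambda>x. (norm x)\<^sup>2)"
proof -
  have "(norm x)\<^sup>2 = (\<Sum>b\<in>Basis. (x \<bullet> b) * (x \<bullet> b))" for x :: 'a
    unfolding power2_norm_eq_inner by (rule euclidean_inner)
  then show ?thesis by (auto intro!: Ck_sum Ck_mult Ck_inner_left)
qed

lemma Ck_flat_exp: "Ck k f \<Longrightarrow> Ck k (\<lambda>x. flat_exp p (f x))"
proof (induction k arbitrary: p)
  case 0
  have "continuous_on UNIV (flat_exp p)"
    using flat_exp_has_real_derivative[THEN DERIV_continuous] by (auto simp: continuous_on_eq_continuous_within)
  then show ?case using 0 by (auto intro: continuous_on_compose2)
next
  case (Suc k)
  let ?q = "[:0, 0, 1:] * (p - pderiv p)"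
  have "((\<lambda>x. flat_exp p (f x)) has_derivative (\<lambda>h. flat_exp ?q (f x) * frechet_derivative f (at x) h)) (at x)" for x
    using has_derivative_compose[OF Ck_has_derivative[OF Suc.prems]
      flat_exp_has_real_derivative[unfolded has_field_derivative_def]] by simp
  then show ?case
    by (rule CkI) (use Suc.prems in \<open>intro Ck_mult Suc.IH Ck_Suc_imp[OF Suc.prems], simp\<close>)
qed

text \<open>The squared norm is used because the norm itself is not differentiable at the
  origin.\<close>

definition bump :: "real \<Rightarrow> 'a::euclidean_space \<Rightarrow> real" where
  "bump e x = flat_exp 1 (e\<^sup>2 - (norm x)\<^sup>2)"

lemma Ck_bump: "Ck k (bump e)"
proof -
  have "Ck k (\<lambda>x. e\<^sup>2 + (-1) * (norm x)\<^sup>2)" by (intro Ck_add Ck_mult Ck_const Ck_norm_squared)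
  from Ck_flat_exp[OF this, of 1] show ?thesis by (simp add: bump_def[abs_def])
qed

lemma bump_nonneg: "bump e x \<ge> 0" by (simp add: bump_def flat_exp_def)

lemma bump_pos: "norm x < e \<Longrightarrow> bump e x > 0"
  by (auto simp: bump_def flat_exp_def intro: power_strict_mono)

lemma bump_eq_0: "0 < e \<Longrightarrow> e \<le> norm x \<Longrightarrow> bump e x = 0"
  by (auto simp: bump_def flat_exp_def not_less intro: power_mono)

lemma bump_minus: "bump e (- x) = bump e x" by (simp add: bump_def)

text \<open>All derivatives fall on \<open>\<phi>\<close>, hence the induction over arbitrary smooth
  \<open>\<phi>\<close> while \<open>k\<close>, the function to be smoothed, is merely continuous.
  Over a fixed compact box, continuity suffices for differentiating under the integral.\<close>

lemma Ck_convolution: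
  fixes k \<phi> :: "'a::euclidean_space \<Rightarrow> real"
  assumes k: "continuous_on UNIV k" and "\<And>j. Ck j \<phi>"
  shows "Ck j (\<lambda>x. integral (cbox a b) (\<lambda>y. k y * \<phi> (x - y)))"
  using assms(2)
proof (induction j arbitrary: \<phi>)
  case 0
  have "continuous_on UNIV \<phi>" using Ck_continuous 0 by blast
  then have c: "continuous_on UNIV (\<lambda>p. k (snd p) * \<phi> (fst p - snd p))"
    using k by (intro continuous_intros) (auto intro!: continuous_intros elim!: continuous_on_compose2)
  have "continuous_on UNIV (\<lambda>x. integral (cbox a b) (\<lambda>y. k y * \<phi> (x - y)))"
    by (rule integral_continuous_on_param) (auto simp: case_prod_beta intro: continuous_on_subset[OF c])
  then show ?case by simp
next
  case (Suc j)
  define \<phi>' where "\<phi>' b x = frechet_derivative \<phi> (at x) b" for b x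
  have \<phi>': "Ck i (\<phi>' b)" if "b \<in> Basis" for i b
    using Suc.prems[of "Suc i"] that by (simp add: \<phi>'_def[abs_def])
  have der: "(\<phi> has_derivative frechet_derivative \<phi> (at x)) (at x)" for x
    by (rule Ck_has_derivative[OF Suc.prems])
  have expand: "frechet_derivative \<phi> (at x) v = (\<Sum>b\<in>Basis. \<phi>' b x * (v \<bullet> b))" for x v
  proof -
    interpret bounded_linear "frechet_derivative \<phi> (at x)" using der[of x] by (rule has_derivative_bounded_linear)
    have "frechet_derivative \<phi> (at x) v = frechet_derivative \<phi> (at x) (\<Sum>b\<in>Basis. (v \<bullet> b) *\<^sub>R b)"
      by (simp add: euclidean_representation)
    also have "\<dots> = (\<Sum>b\<in>Basis. \<phi>' b x * (v \<bullet> b))" by (simp add: sum scaleR \<phi>'_def mult.commute)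
    finally show ?thesis .
  qed
  \<comment> \<open>The derivative as a bounded linear map, expanded in the basis: its continuity
    then reduces to that of the partial derivatives.\<close>
  define D :: "'a \<Rightarrow> 'a \<Rightarrow> 'a \<Rightarrow>\<^sub>L real" where
    "D x y = (\<Sum>b\<in>Basis. (k y * \<phi>' b (x - y)) *\<^sub>R blinfun_inner_left b)" for x y
  have D_apply: "blinfun_apply (D x y) v = k y * frechet_derivative \<phi> (at (x - y)) v" for x y v
    by (simp add: D_def blinfun.sum_left blinfun.scaleR_left expand sum_distrib_left mult.assoc)
  have cont: "continuous_on UNIV (\<lambda>p. k (snd p) * \<psi> (fst p - snd p))" if "continuous_on UNIV \<psi>" for \<psi> :: "'a \<Rightarrow> real"
    using k that by (intro continuous_intros) (auto intro!: continuous_intros elim!: continuous_on_compose2)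
  have contD: "continuous_on UNIV (\<lambda>p. D (fst p) (snd p))"
    unfolding D_def by (intro continuous_intros cont Ck_continuous[OF \<phi>'])
  have intD: "(\<lambda>y. D x y) integrable_on cbox a b" for x
    by (intro integrable_continuous continuous_on_compose2[OF contD, of _ "\<lambda>y. (x, y)", simplified]) (auto intro: continuous_intros)
  have "((\<lambda>x. integral (cbox a b) (\<lambda>y. k y * \<phi> (x - y))) has_derivative
      blinfun_apply (integral (cbox a b) (D x))) (at x)" for x
  proof (rule leibniz_rule[of UNIV, simplified])
    fix x y assume "y \<in> cbox a b"
    have "((\<lambda>x. \<phi> (x - y)) has_derivative (\<lambda>v. frechet_derivative \<phi> (at (x - y)) v)) (at x)"
      by (rule has_derivative_compose[OF _ der, of "\<lambda>x. x - y" "\<lambda>v. v", simplified]) (auto intro!: derivative_eq_intros)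
    then have "((\<lambda>x. k y * \<phi> (x - y)) has_derivative (\<lambda>v. k y * frechet_derivative \<phi> (at (x - y)) v)) (at x)"
      by (rule has_derivative_mult_right)
    then show "((\<lambda>x. k y * \<phi> (x - y)) has_derivative blinfun_apply (D x y)) (at x)"
      by (simp add: D_apply[abs_def] eta_contract_eq)
  next
    fix x
    have "continuous_on UNIV \<phi>" using Ck_continuous Suc.prems by blast
    then have "continuous_on UNIV (\<lambda>y. \<phi> (x - y))"
      by (rule continuous_on_compose2) (auto intro: continuous_intros)
    from continuous_on_mult[OF k this]
    show "(\<lambda>y. k y * \<phi> (x - y)) integrable_on cbox a b"
      by (intro integrable_continuous) (auto intro: continuous_intros continuous_on_subset)
  next
    show "continuous_on (UNIV \<times> cbox a b) (\<lambda>(x, y). D x y)"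
      by (auto simp: case_prod_beta intro: continuous_on_subset[OF contD])
  qed
  then show ?case
  proof (rule CkI)
    fix b' :: 'a assume b': "b' \<in> Basis"
    have "blinfun_apply (integral (cbox a b) (D x)) b' = integral (cbox a b) (\<lambda>y. k y * \<phi>' b' (x - y))" for x
      using integral_linear[OF intD[of x] blinfun.bounded_linear_left[of b']]
      by (simp add: o_def D_apply \<phi>'_def)
    then show "Ck j (\<lambda>x. blinfun_apply (integral (cbox a b) (D x)) b')"
      using Suc.IH[of "\<phi>' b'"] \<phi>'[OF b'] by simp
  qed
qed

text \<open>A normalized bump. Evenness is recorded because the smoothing below passes from
  \<open>k (x + y) * \<phi> y\<close> to the convolution form with
  \<open>\<phi> (x - y)\<close>.\<close>

lemma mollifier_exists:
  assumes e: "e > 0"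
  obtains \<phi> :: "'a::euclidean_space \<Rightarrow> real"
  where "\<And>k. Ck k \<phi>" "\<And>x. \<phi> x \<ge> 0" "\<And>x. e \<le> norm x \<Longrightarrow> \<phi> x = 0" "\<And>x. \<phi> (- x) = \<phi> x"
    "integrable lborel \<phi>" "(\<integral>x. \<phi> x \<partial>lborel) = 1"
proof -
  let ?b = "bump e :: 'a \<Rightarrow> real"
  have cont: "continuous_on UNIV ?b" by (rule Ck_continuous[OF Ck_bump[of 0]])
  have "integrable lborel (\<lambda>x. indicator (cball 0 e) x *\<^sub>R ?b x)"
    by (intro borel_integrable_compact continuous_on_subset[OF cont]) auto
  moreover have "(\<lambda>x. indicator (cball 0 e) x *\<^sub>R ?b x) = ?b"
  proof
    fix x
    show "indicator (cball 0 e) x *\<^sub>R ?b x = ?b x"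
      using e bump_eq_0[of e x] by (cases "norm x \<le> e") auto
  qed
  ultimately have int: "integrable lborel ?b" by simp
  have "(\<integral>x. ?b x \<partial>lborel) \<noteq> 0"
  proof
    assume "(\<integral>x. ?b x \<partial>lborel) = 0"
    then have "AE x in lborel. ?b x = 0"
      using integral_nonneg_eq_0_iff_AE[OF int] bump_nonneg by auto
    then have "emeasure lborel {x\<in>space lborel. ?b x \<noteq> 0} = 0" by (intro emeasure_eq_0_AE) auto
    moreover have "emeasure lborel (ball (0::'a) e) \<le> emeasure lborel {x\<in>space lborel. ?b x \<noteq> 0}"
      using borel_measurable_continuous_onI[OF cont]
      by (intro emeasure_mono) (auto dest!: bump_pos)
    ultimately show False
      using e content_ball_pos[of e "0::'a"] by (simp add: measure_def)
  qed
  moreover have "(\<integral>x. ?b x \<partial>lborel) \<ge> 0"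
    by (intro Bochner_Integration.integral_nonneg bump_nonneg)
  ultimately have pos: "(\<integral>x. ?b x \<partial>lborel) > 0" by simp
  show ?thesis
  proof (rule that[of "\<lambda>x. (1 / (\<integral>x. ?b x \<partial>lborel)) * ?b x"])
    show "Ck k (\<lambda>x. (1 / (\<integral>x. ?b x \<partial>lborel)) * ?b x)" for k
      by (intro Ck_mult Ck_const Ck_bump)
    show "0 \<le> (1 / (\<integral>x. ?b x \<partial>lborel)) * ?b x" for x
      using pos bump_nonneg[of e x] by (intro mult_nonneg_nonneg) auto
    show "(1 / (\<integral>x. ?b x \<partial>lborel)) * ?b x = 0" if "e \<le> norm x" for x
      using bump_eq_0[OF e that] by simp
    show "integrable lborel (\<lambda>x. (1 / (\<integral>x. ?b x \<partial>lborel)) * ?b x)"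
      using int by (rule integrable_mult_right)
    show "(\<integral>y. (1 / (\<integral>x. ?b x \<partial>lborel)) * ?b y \<partial>lborel) = 1"
      using pos by (subst integral_mult_right_zero) simp
  qed (simp add: bump_minus)
qed

text \<open>A positive density cannot make a bump function constant.\<close>

lemma poincare_constant_nonneg:
  fixes \<nu> :: "'a::euclidean_space measure"
  assumes "poincare \<nu> C" and dens: "has_density_propto lborel \<nu> (\<lambda>x. exp (f x))"
    and [measurable]: "f \<in> borel_measurable borel"
  shows "0 \<le> C"
proof (rule ccontr)
  assume C: "\<not> 0 \<le> C"
  obtain c where c: "c > 0" and \<nu>: "\<nu> = density lborel (\<lambda>x. ennreal (c * exp (f x)))" and "prob_space \<nu>"
    using dens by (auto simp: has_density_propto_def)
  then interpret prob_space \<nu> by simp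
  let ?b = "bump 1 :: 'a \<Rightarrow> real"
  have cont: "continuous_on UNIV ?b" by (rule Ck_continuous[OF Ck_bump[of 0]])
  have [measurable]: "?b \<in> borel_measurable borel" by (rule borel_measurable_continuous_onI[OF cont])
  have [measurable_cong]: "sets \<nu> = sets borel" by (simp add: \<nu>)
  have "{x. ?b x \<noteq> 0} \<subseteq> cball 0 1"
  proof
    fix x :: 'a assume "x \<in> {x. ?b x \<noteq> 0}"
    then have "\<not> 1 \<le> norm x" using bump_eq_0[of 1 x] by auto
    then show "x \<in> cball 0 1" by simp
  qed
  then have "closure {x. ?b x \<noteq> 0} \<subseteq> cball 0 1"
    by (rule closure_minimal) simp
  then have "compact (closure {x. ?b x \<noteq> 0})"
    by (meson bounded_cball bounded_subset closed_closure compact_eq_bounded_closed)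
  then have "expectation (\<lambda>x. (?b x - expectation ?b)\<^sup>2) \<le> C * (\<integral>x. (norm (grad ?b x))\<^sup>2 \<partial>\<nu>)"
    using assms(1) Ck_bump unfolding poincare_def by blast
  also have "\<dots> \<le> 0"
    using C by (intro mult_nonpos_nonneg Bochner_Integration.integral_nonneg) auto
  finally have le0: "expectation (\<lambda>x. (?b x - expectation ?b)\<^sup>2) \<le> 0" .
  have bd: "?b x \<le> 1" for x by (auto simp: bump_def flat_exp_def)
  define m where "m = expectation ?b"
  have "\<bar>?b x - m\<bar> \<le> 1 + \<bar>m\<bar>" for x using bd[of x] bump_nonneg[of 1 x] by linarith
  then have "\<bar>?b x - m\<bar>\<^sup>2 \<le> (1 + \<bar>m\<bar>)\<^sup>2" for x by (intro power_mono) auto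
  then have "integrable \<nu> (\<lambda>x. (?b x - m)\<^sup>2)"
    by (intro integrable_const_bound[where B = "(1 + \<bar>m\<bar>)\<^sup>2"]) auto
  moreover have "expectation (\<lambda>x. (?b x - m)\<^sup>2) = 0"
    using le0 by (intro antisym Bochner_Integration.integral_nonneg) (auto simp: m_def)
  ultimately have "AE x in \<nu>. (?b x - m)\<^sup>2 = 0"
    by (subst (asm) integral_nonneg_eq_0_iff_AE) auto
  then have "AE x in lborel. ?b x = m"
    unfolding \<nu> using c by (subst (asm) AE_density) auto
  moreover have ball: "emeasure lborel (ball x 1) > 0" for x :: 'a
    using content_ball_pos[of 1 x] by (simp add: measure_def zero_less_iff_neq_zero) (metis enn2real_0 less_irrefl)
  \<comment> \<open>A null set contains no ball, so the constant value \<open>m\<close> is attained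
    in every unit ball: near 0, where the bump is positive, and near \<open>2 *\<^sub>R b\<close>,
    where it vanishes.\<close>
  have "\<exists>y\<in>ball x 1. P y" if "AE y in lborel. P y" for x :: 'a and P
  proof (rule ccontr)
    assume *: "\<not> (\<exists>y\<in>ball x 1. P y)"
    have "AE y in lborel. \<not> (y \<in> ball x 1)" using that by eventually_elim (use * in auto)
    then have "emeasure lborel {y\<in>space lborel. y \<in> ball x 1} = 0" by (rule emeasure_eq_0_AE)
    moreover have "{y\<in>space lborel. y \<in> ball x 1} = ball x 1" by auto
    ultimately show False using ball[of x] by simp
  qed
  ultimately have ex: "\<exists>y\<in>ball x 1. ?b y = m" for x by blast
  obtain y where y: "norm y < 1" "?b y = m" using ex[of 0] by auto
  obtain b :: 'a where b: "b \<in> Basis" using nonempty_Basis by blast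
  obtain z where z: "norm (2 *\<^sub>R b - z) < 1" "?b z = m" using ex[of "2 *\<^sub>R b"] by (auto simp: dist_norm)
  have "norm z \<ge> 1" using z(1) b norm_triangle_ineq2[of "2 *\<^sub>R b" z] by (simp add: norm_minus_commute)
  then show False using bump_pos[OF y(1)] bump_eq_0[of 1 z] y(2) z(2) by simp
qed

section \<open>From smooth to Lipschitz test functions\<close>

text \<open>The derivative along the gradient \<open>G\<close> itself is \<open>norm G ^ 2\<close>,
  while the difference quotients in that direction are at most \<open>L * norm G\<close>. Since
  \<open>grad\<close> is a definite description, existence and uniqueness of \<open>G\<close> come
  first.\<close>

lemma norm_grad_le_lipschitz:
  fixes f :: "'a::euclidean_space \<Rightarrow> real"
  assumes lip: "L-lipschitz_on UNIV f" and diff: "f differentiable (at x)"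
  shows "norm (grad f x) \<le> L"
proof -
  obtain D where D: "(f has_derivative D) (at x)" using diff by (auto simp: differentiable_def)
  interpret D: bounded_linear D using D by (rule has_derivative_bounded_linear)
  define G where "G = (\<Sum>b\<in>Basis. D b *\<^sub>R b)"
  have DG: "D v = v \<bullet> G" for v
  proof -
    have "D v = D (\<Sum>b\<in>Basis. (v \<bullet> b) *\<^sub>R b)" by (simp add: euclidean_representation)
    then show ?thesis by (simp add: D.sum D.scaleR G_def inner_sum_right mult.commute)
  qed
  have GD: "GDERIV f x :> G"
    using D by (simp add: gderiv_def DG[abs_def] eta_contract_eq)
  have "H = G" if "GDERIV f x :> H" for H
  proof -
    have "(\<lambda>h. h \<bullet> H) = (\<lambda>h. h \<bullet> G)"
      using that GD unfolding gderiv_def by (rule has_derivative_unique)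
    then have "(H - G) \<bullet> H = (H - G) \<bullet> G" by (rule fun_cong)
    then have "(H - G) \<bullet> (H - G) = 0" by (simp add: inner_diff_right)
    then show ?thesis by simp
  qed
  then have grad: "grad f x = G" unfolding grad_def using GD by (intro the_equality)
  have "((\<lambda>t. f (x + t *\<^sub>R G)) has_derivative (\<lambda>t. D (t *\<^sub>R G))) (at 0)"
    by (rule has_derivative_compose[where f = "\<lambda>t. x + t *\<^sub>R G" and g = f]) (auto intro!: derivative_eq_intros simp: D)
  then have "((\<lambda>t. f (x + t *\<^sub>R G)) has_real_derivative (norm G)\<^sup>2) (at 0)"
    by (simp add: has_field_derivative_def D.scaleR DG[of G] power2_norm_eq_inner mult.commute[of _ "G \<bullet> G"])
  then have lim: "((\<lambda>t. (f (x + t *\<^sub>R G) - f x) / t) \<longlongrightarrow> (norm G)\<^sup>2) (at 0)"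
    by (simp add: has_field_derivative_iff)
  have "(f (x + t *\<^sub>R G) - f x) / t \<le> L * norm G" if "t \<noteq> 0" for t
  proof -
    have "\<bar>f (x + t *\<^sub>R G) - f x\<bar> \<le> L * (\<bar>t\<bar> * norm G)"
      using lipschitz_onD[OF lip, of "x + t *\<^sub>R G" x] by (simp add: dist_real_def dist_norm)
    then have "\<bar>(f (x + t *\<^sub>R G) - f x) / t\<bar> \<le> L * norm G"
      using that by (simp add: abs_divide divide_le_eq mult_ac)
    then show ?thesis by linarith
  qed
  then have "(norm G)\<^sup>2 \<le> L * norm G"
    by (intro tendsto_upperbound[OF lim]) (auto simp: eventually_at_filter)
  then show ?thesis
    unfolding grad using lipschitz_on_nonneg[OF lip] by (cases "G = 0") (auto simp: power2_eq_square)
qed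

text \<open>Clipping \<open>f\<close> between \<open>\<plusminus>max 0 (R - L |x|)\<close> yields compact support without increasing the
  Lipschitz constant; mollification then makes it smooth.\<close>

lemma smooth_compact_lipschitz_approx:
  fixes f :: "'a::euclidean_space \<Rightarrow> real"
  assumes f: "L-lipschitz_on UNIV f" and L: "L > 0" and e: "e > 0"
  obtains g where "\<And>k. Ck k g" "compact (closure {x. g x \<noteq> 0})" "L-lipschitz_on UNIV g"
    "\<And>x. \<bar>g x\<bar> \<le> \<bar>f x\<bar> + L * e" "\<And>x. \<bar>f x\<bar> + L * norm x \<le> R \<Longrightarrow> \<bar>g x - f x\<bar> \<le> L * e"
proof -
  define T where "T x = max 0 (R - L * norm x)" for x :: 'a
  define k where "k x = max (- T x) (min (f x) (T x))" for x
  have T0: "T x \<ge> 0" for x by (simp add: T_def)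
  have T_lip: "\<bar>T x - T y\<bar> \<le> L * norm (x - y)" for x y
  proof -
    have "\<bar>L * norm x - L * norm y\<bar> \<le> L * norm (x - y)"
      using L norm_triangle_ineq3[of x y] by (simp add: right_diff_distrib[symmetric] abs_mult mult_left_mono)
    then show ?thesis by (auto simp: T_def)
  qed
  have f_lip: "\<bar>f x - f y\<bar> \<le> L * norm (x - y)" for x y
    using lipschitz_onD[OF f, of x y] by (simp add: dist_real_def dist_norm)
  have k_lip: "\<bar>k x - k y\<bar> \<le> L * norm (x - y)" for x y
    using T_lip[of x y] f_lip[of x y] unfolding k_def by linarith
  have k_le: "\<bar>k x\<bar> \<le> \<bar>f x\<bar>" for x using T0[of x] unfolding k_def by linarith
  have k_eq: "k x = f x" if "\<bar>f x\<bar> + L * norm x \<le> R" for x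
    using that unfolding k_def T_def by linarith
  have k_0: "k x = 0" if "R / L \<le> norm x" for x
  proof -
    have "R \<le> L * norm x" using that L by (simp add: divide_le_eq mult.commute)
    then have "T x = 0" by (simp add: T_def)
    then show ?thesis by (simp add: k_def)
  qed
  have k_cont: "continuous_on UNIV k"
    using k_lip L by (intro lipschitz_on_continuous_on[of L] lipschitz_onI) (auto simp: dist_real_def dist_norm)
  obtain \<phi> :: "'a \<Rightarrow> real" where \<phi>: "\<And>k. Ck k \<phi>" "\<And>x. \<phi> x \<ge> 0" "\<And>x. e \<le> norm x \<Longrightarrow> \<phi> x = 0"
    "\<And>x. \<phi> (- x) = \<phi> x" "integrable lborel \<phi>" "(\<integral>x. \<phi> x \<partial>lborel) = 1"
    using mollifier_exists[OF e] by metis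
  have \<phi>_cont: "continuous_on UNIV \<phi>" using \<phi>(1) Ck_continuous by blast
  have [measurable]: "k \<in> borel_measurable borel" "\<phi> \<in> borel_measurable borel"
    using k_cont \<phi>_cont by (auto intro: borel_measurable_continuous_onI)
  have int_k: "integrable lborel (\<lambda>y. k (x + y) * \<phi> y)" for x
  proof -
    have c: "continuous_on UNIV (\<lambda>y. k (x + y) * \<phi> y)"
      by (intro continuous_intros \<phi>_cont continuous_on_compose2[OF k_cont]) auto
    have "integrable lborel (\<lambda>y. indicator (cball 0 e) y *\<^sub>R (k (x + y) * \<phi> y))"
      by (intro borel_integrable_compact continuous_on_subset[OF c]) auto
    moreover have "(\<lambda>y. indicator (cball 0 e) y *\<^sub>R (k (x + y) * \<phi> y)) = (\<lambda>y. k (x + y) * \<phi> y)"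
      using \<phi>(3) by (auto simp: indicator_def fun_eq_iff)
    ultimately show ?thesis by simp
  qed
  define g where "g x = (\<integral>y. k (x + y) * \<phi> y \<partial>lborel)" for x
  obtain a b :: 'a where ab: "cball 0 (\<bar>R / L\<bar>) \<subseteq> cbox a b"
    using bounded_subset_cbox_symmetric[OF bounded_cball] by metis
  \<comment> \<open>Two forms of \<open>g\<close> are needed: with \<open>\<phi> y\<close> the
    Lipschitz bound and the distance to \<open>k\<close> are immediate, while this one, over a box
    containing the support of \<open>k\<close>, shows smoothness.\<close>
  have g_conv: "g x = integral (cbox a b) (\<lambda>y. k y * \<phi> (x - y))" for x
  proof -
    have "g x = (\<integral>y. k (x + y) * \<phi> ((x + y) - x) \<partial>lborel)" by (simp add: g_def)
    also have "\<dots> = (\<integral>y. k y * \<phi> (y - x) \<partial>distr lborel borel ((+) x))"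
      by (subst integral_distr) auto
    also have "\<dots> = (\<integral>y. k y * \<phi> (x - y) \<partial>lborel)"
      using \<phi>(4)[of "x - _"] by (simp add: lborel_distr_plus)
    also have "\<dots> = (LINT y:cbox a b|lborel. k y * \<phi> (x - y))"
      unfolding set_lebesgue_integral_def
    proof (rule Bochner_Integration.integral_cong[OF refl])
      fix y
      show "k y * \<phi> (x - y) = indicat_real (cbox a b) y *\<^sub>R (k y * \<phi> (x - y))"
      proof (cases "y \<in> cbox a b")
        case False
        then have "\<bar>R / L\<bar> < norm y" using ab by (force simp: subset_iff not_le[symmetric])
        then have "R / L \<le> norm y" by linarith
        then show ?thesis by (simp add: k_0)
      qed simp
    qed
    also have "\<dots> = integral (cbox a b) (\<lambda>y. k y * \<phi> (x - y))"
    proof (rule set_borel_integral_eq_integral(2))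
      have "continuous_on (cbox a b) (\<lambda>y. k y * \<phi> (x - y))"
        by (intro continuous_intros continuous_on_compose2[OF \<phi>_cont] continuous_on_subset[OF k_cont]) auto
      then show "set_integrable lborel (cbox a b) (\<lambda>y. k y * \<phi> (x - y))"
        unfolding set_integrable_def by (intro borel_integrable_compact) auto
    qed
    finally show ?thesis .
  qed
  have smooth: "Ck j g" for j
    unfolding g_conv[abs_def] by (rule Ck_convolution[OF k_cont \<phi>(1)])
  have lip: "L-lipschitz_on UNIV g"
  proof (rule lipschitz_onI)
    fix x y
    have "\<bar>g x - g y\<bar> = \<bar>\<integral>z. k (x + z) * \<phi> z - k (y + z) * \<phi> z \<partial>lborel\<bar>"
      unfolding g_def by (simp add: int_k)
    also have "\<dots> \<le> (\<integral>z. L * norm (x - y) * \<phi> z \<partial>lborel)"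
    proof (rule integral_abs_bound_integral)
      fix z
      have "\<bar>k (x + z) * \<phi> z - k (y + z) * \<phi> z\<bar> = \<bar>k (x + z) - k (y + z)\<bar> * \<phi> z"
        using \<phi>(2)[of z] by (simp add: left_diff_distrib[symmetric] abs_mult)
      also have "\<dots> \<le> L * norm (x - y) * \<phi> z"
        using k_lip[of "x + z" "y + z"] \<phi>(2)[of z] by (intro mult_right_mono) auto
      finally show "\<bar>k (x + z) * \<phi> z - k (y + z) * \<phi> z\<bar> \<le> L * norm (x - y) * \<phi> z" .
    qed (auto simp: int_k \<phi>(5))
    also have "\<dots> = L * norm (x - y)" by (simp add: \<phi>(6))
    finally show "dist (g x) (g y) \<le> L * dist x y" by (simp add: dist_real_def dist_norm)
  qed (use L in simp)
  have close: "\<bar>g x - k x\<bar> \<le> L * e" for x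
  proof -
    have "\<bar>g x - k x\<bar> = \<bar>\<integral>z. k (x + z) * \<phi> z - k x * \<phi> z \<partial>lborel\<bar>"
      by (subst Bochner_Integration.integral_diff) (auto simp: int_k \<phi>(5,6) g_def)
    also have "\<dots> \<le> (\<integral>z. L * e * \<phi> z \<partial>lborel)"
    proof (rule integral_abs_bound_integral)
      fix z
      have "\<bar>k (x + z) * \<phi> z - k x * \<phi> z\<bar> = \<bar>k (x + z) - k x\<bar> * \<phi> z"
        using \<phi>(2)[of z] by (simp add: left_diff_distrib[symmetric] abs_mult)
      also have "\<dots> \<le> L * e * \<phi> z"
      proof (cases "norm z < e")
        case True
        then have "L * norm z \<le> L * e" using L by simp
        then show ?thesis using k_lip[of "x + z" x] \<phi>(2)[of z] by (intro mult_right_mono) auto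
      qed (use \<phi>(3)[of z] in auto)
      finally show "\<bar>k (x + z) * \<phi> z - k x * \<phi> z\<bar> \<le> L * e * \<phi> z" .
    qed (auto simp: int_k \<phi>(5))
    also have "\<dots> = L * e" by (simp add: \<phi>(6))
    finally show ?thesis .
  qed
  have "{x. g x \<noteq> 0} \<subseteq> cball 0 (\<bar>R / L\<bar> + e)"
  proof (rule subsetI, rule ccontr)
    fix x assume "x \<in> {x. g x \<noteq> 0}" and "x \<notin> cball 0 (\<bar>R / L\<bar> + e)"
    then have gx: "g x \<noteq> 0" and x: "\<bar>R / L\<bar> + e < norm x" by auto
    have "k (x + y) * \<phi> y = 0" for y
    proof (cases "e \<le> norm y")
      case False
      then have "R / L \<le> norm (x + y)" using x norm_diff_ineq[of x y] by linarith
      then show ?thesis by (simp add: k_0)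
    qed (simp add: \<phi>(3))
    then have "g x = 0" by (simp only: g_def) simp
    then show False using gx by simp
  qed
  then have "closure {x. g x \<noteq> 0} \<subseteq> cball 0 (\<bar>R / L\<bar> + e)"
    by (rule closure_minimal) simp
  then have "compact (closure {x. g x \<noteq> 0})"
    by (meson bounded_cball bounded_subset closed_closure compact_eq_bounded_closed)
  moreover have "\<bar>g x\<bar> \<le> \<bar>f x\<bar> + L * e" for x using close[of x] k_le[of x] by linarith
  moreover have "\<bar>g x - f x\<bar> \<le> L * e" if "\<bar>f x\<bar> + L * norm x \<le> R" for x
    using close[of x] k_eq[OF that] by simp
  ultimately show ?thesis using that[of g] smooth lip by blast
qed

text \<open>The approximants with cutoff \<open>n\<close> and error \<open>L / (n + 1)\<close>
  converge pointwise and are dominated by \<open>\<bar>f\<bar> + L\<close>, so their variances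
  converge. Their gradients are bounded by the same \<open>L\<close>, so the constant is not
  degraded.\<close>

lemma poincare_lipschitz:
  fixes \<nu> :: "'a::euclidean_space measure"
  assumes \<nu>: "poincare \<nu> C" "prob_space \<nu>" and sets[measurable_cong]: "sets \<nu> = sets borel"
    and C: "0 \<le> C" and f: "L-lipschitz_on UNIV f"
    and int: "integrable \<nu> (\<lambda>x. (f x)\<^sup>2)"
  shows "(\<integral>x. (f x - (\<integral>y. f y \<partial>\<nu>))\<^sup>2 \<partial>\<nu>) \<le> C * L\<^sup>2"
proof (cases "L = 0")
  case True
  interpret prob_space \<nu> by fact
  have "f = (\<lambda>_. f 0)" using lipschitz_onD[OF f, of _ 0] True by auto
  then obtain c where "f = (\<lambda>_. c)" by blast
  then show ?thesis using True by (simp add: prob_space)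
next
  case False
  interpret prob_space \<nu> by fact
  have L: "L > 0" using lipschitz_on_nonneg[OF f] False by simp
  have [measurable]: "f \<in> borel_measurable borel"
    using lipschitz_on_continuous_on[OF f] by (rule borel_measurable_continuous_onI)
  have "\<exists>g. (\<forall>k. Ck k g) \<and> compact (closure {x. g x \<noteq> 0}) \<and> L-lipschitz_on UNIV g
    \<and> (\<forall>x. \<bar>g x\<bar> \<le> \<bar>f x\<bar> + L * (1 / real (Suc n)))
    \<and> (\<forall>x. \<bar>f x\<bar> + L * norm x \<le> real n \<longrightarrow> \<bar>g x - f x\<bar> \<le> L * (1 / real (Suc n)))" for n
    by (rule smooth_compact_lipschitz_approx[OF f L, of "1 / real (Suc n)" "real n"]) (simp, blast)
  then obtain g where g: "\<And>n k. Ck k (g n)" "\<And>n. compact (closure {x. g n x \<noteq> 0})"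
    "\<And>n. L-lipschitz_on UNIV (g n)" "\<And>n x. \<bar>g n x\<bar> \<le> \<bar>f x\<bar> + L * (1 / real (Suc n))"
    "\<And>n x. \<bar>f x\<bar> + L * norm x \<le> real n \<Longrightarrow> \<bar>g n x - f x\<bar> \<le> L * (1 / real (Suc n))"
    by metis
  have [measurable]: "g n \<in> borel_measurable borel" for n
    using Ck_continuous[OF g(1)] by (rule borel_measurable_continuous_onI)
  have lim: "(\<lambda>n. g n x) \<longlonglongrightarrow> f x" for x
  proof -
    have "(\<lambda>n. L * (1 / real (Suc n))) \<longlonglongrightarrow> L * 0"
      by (intro tendsto_intros LIMSEQ_Suc[OF lim_const_over_n])
    then have "(\<lambda>n. L * (1 / real (Suc n))) \<longlonglongrightarrow> 0" by simp
    moreover obtain n0 :: nat where "\<bar>f x\<bar> + L * norm x \<le> real n0" using real_arch_simple by blast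
    then have "\<forall>\<^sub>F n in sequentially. norm (g n x - f x) \<le> L * (1 / real (Suc n))"
      unfolding real_norm_def by (intro eventually_sequentiallyI[of n0] g(5)) simp
    ultimately have "(\<lambda>n. g n x - f x) \<longlonglongrightarrow> 0" by (rule Lim_null_comparison[rotated])
    then show ?thesis by (simp add: LIM_zero_iff)
  qed
  have bd: "\<bar>g n x\<bar> \<le> \<bar>f x\<bar> + L" for n x
  proof -
    have "L * (1 / real (Suc n)) \<le> L * 1" using L by (intro mult_left_mono) auto
    then show ?thesis using g(4)[of n x] by simp
  qed
  have int_f: "integrable \<nu> f" by (rule square_integrable_imp_integrable[OF _ int]) measurable
  have int_bd: "integrable \<nu> (\<lambda>x. \<bar>f x\<bar> + L)" using int_f by simp
  have int_bd2: "integrable \<nu> (\<lambda>x. (\<bar>f x\<bar> + L)\<^sup>2)"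
    using int int_f by (simp add: power2_sum)
  have bd2: "(g n x)\<^sup>2 \<le> (\<bar>f x\<bar> + L)\<^sup>2" for n x
    using power_mono[OF bd[of n x], of 2] by simp
  have l1: "(\<lambda>n. expectation (g n)) \<longlonglongrightarrow> expectation f"
    by (rule integral_dominated_convergence[OF _ _ int_bd]) (auto simp: lim bd)
  have l2: "(\<lambda>n. expectation (\<lambda>x. (g n x)\<^sup>2)) \<longlonglongrightarrow> expectation (\<lambda>x. (f x)\<^sup>2)"
    by (rule integral_dominated_convergence[OF _ _ int_bd2]) (auto intro!: tendsto_intros lim simp: bd2)
  have ig1: "integrable \<nu> (g n)" for n
    by (rule Bochner_Integration.integrable_bound[OF int_bd]) (auto intro!: AE_I2 order_trans[OF bd])
  have ig2: "integrable \<nu> (\<lambda>x. (g n x)\<^sup>2)" for n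
  proof (rule Bochner_Integration.integrable_bound[OF int_bd2])
    have "norm ((g n x)\<^sup>2) \<le> norm ((\<bar>f x\<bar> + L)\<^sup>2)" for x
      using bd2[of n x] by simp
    then show "AE x in \<nu>. norm ((g n x)\<^sup>2) \<le> norm ((\<bar>f x\<bar> + L)\<^sup>2)" by (rule AE_I2)
  qed measurable
  have var: "variance X = expectation (\<lambda>x. (X x)\<^sup>2) - (expectation X)\<^sup>2"
    if "integrable \<nu> X" "integrable \<nu> (\<lambda>x. (X x)\<^sup>2)" for X :: "'a \<Rightarrow> real"
    using that by (rule variance_eq)
  have le: "variance (g n) \<le> C * L\<^sup>2" for n
  proof -
    have "variance (g n) \<le> C * (\<integral>x. (norm (grad (g n) x))\<^sup>2 \<partial>\<nu>)"
      using \<nu>(1) g(1,2) unfolding poincare_def by blast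
    also have "(\<integral>x. (norm (grad (g n) x))\<^sup>2 \<partial>\<nu>) \<le> L\<^sup>2"
    \<comment> \<open>If the squared gradient were not integrable, its integral would be 0 by
      convention, so both cases give the bound.\<close>
    proof (cases "integrable \<nu> (\<lambda>x. (norm (grad (g n) x))\<^sup>2)")
      case True
      have "g n differentiable (at x)" for x
        using g(1)[of "Suc 0" n] by (simp add: differentiable_on_def)
      then have "(norm (grad (g n) x))\<^sup>2 \<le> L\<^sup>2" for x
        by (intro power_mono norm_grad_le_lipschitz[OF g(3)]) auto
      then have "(\<integral>x. (norm (grad (g n) x))\<^sup>2 \<partial>\<nu>) \<le> (\<integral>x. L\<^sup>2 \<partial>\<nu>)"
        using True by (intro integral_mono) auto
      then show ?thesis by (simp add: prob_space)
    qed (simp add: not_integrable_integral_eq)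
    finally show ?thesis using C by (simp add: mult_left_mono)
  qed
  have "(\<lambda>n. variance (g n)) \<longlonglongrightarrow> variance f"
    unfolding var[OF ig1 ig2] var[OF int_f int] by (intro tendsto_intros l1 l2)
  then show ?thesis by (rule LIMSEQ_le_const2) (use le in auto)
qed

section \<open>Entropy of a mean-field Gibbs measure\<close>

lemma nn_integral_mixture:
  assumes fin: "finite I" and sets: "\<And>i. i \<in> I \<Longrightarrow> sets (\<nu> i) = sets borel"
    and f: "f \<in> borel_measurable borel"
  shows "(\<integral>\<^sup>+x. f x \<partial>mixture I w \<nu>) = (\<Sum>i\<in>I. ennreal (w i) * (\<integral>\<^sup>+x. f x \<partial>\<nu> i))"
  using f
proof (induction f rule: borel_measurable_induct)
  case (cong f g)
  then show ?case using sets_eq_imp_space_eq[OF sets] by (simp cong: nn_integral_cong)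
next
  case (set A)
  then show ?case using sets by (simp add: emeasure_mixture)
next
  case (mult u c)
  have "u \<in> borel_measurable (\<nu> i)" if "i \<in> I" for i using mult sets[OF that] by (simp cong: measurable_cong_sets)
  moreover have "u \<in> borel_measurable (mixture I w \<nu>)" using mult by (simp cong: measurable_cong_sets)
  ultimately show ?case using mult by (simp add: nn_integral_cmult sum_distrib_left mult_ac)
next
  case (add u v)
  have "u \<in> borel_measurable (\<nu> i)" "v \<in> borel_measurable (\<nu> i)" if "i \<in> I" for i
    using add sets[OF that] by (simp_all cong: measurable_cong_sets)
  moreover have "u \<in> borel_measurable (mixture I w \<nu>)" "v \<in> borel_measurable (mixture I w \<nu>)"
    using add by (simp_all cong: measurable_cong_sets)
  ultimately show ?case using add by (simp add: nn_integral_add sum.distrib distrib_left)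
next
  case (seq U)
  have m: "U k \<in> borel_measurable (\<nu> i)" if "i \<in> I" for i k using seq sets[OF that] by (simp cong: measurable_cong_sets)
  have m': "U k \<in> borel_measurable (mixture I w \<nu>)" for k using seq by (simp cong: measurable_cong_sets)
  have inc: "incseq (\<lambda>k. ennreal (w i) * (\<integral>\<^sup>+x. U k x \<partial>\<nu> i))" for i
    using seq(3) by (auto simp: incseq_def le_fun_def intro!: mult_left_mono nn_integral_mono)
  have "(\<integral>\<^sup>+x. (SUP k. U k) x \<partial>mixture I w \<nu>) = (SUP k. \<Sum>i\<in>I. ennreal (w i) * (\<integral>\<^sup>+x. U k x \<partial>\<nu> i))"
    using seq(3) m' by (simp add: nn_integral_monotone_convergence_SUP seq.IH image_comp o_def)
  also have "\<dots> = (\<Sum>i\<in>I. SUP k. ennreal (w i) * (\<integral>\<^sup>+x. U k x \<partial>\<nu> i))"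
    by (rule ennreal_SUP_sum[OF inc])
  also have "\<dots> = (\<Sum>i\<in>I. ennreal (w i) * (\<integral>\<^sup>+x. (SUP k. U k) x \<partial>\<nu> i))"
    using seq(3) m by (intro sum.cong refl) (simp add: nn_integral_monotone_convergence_SUP SUP_mult_left_ennreal image_comp o_def)
  finally show ?case .
qed

lemma
  fixes f :: "'a::topological_space \<Rightarrow> real"
  assumes fin: "finite I" and sets: "\<And>i. i \<in> I \<Longrightarrow> sets (\<nu> i) = sets borel"
    and w: "\<And>i. i \<in> I \<Longrightarrow> 0 \<le> w i" and f[measurable]: "f \<in> borel_measurable borel"
    and int: "\<And>i. i \<in> I \<Longrightarrow> integrable (\<nu> i) f"
  shows integrable_mixture: "integrable (mixture I w \<nu>) f"
    and integral_mixture: "(\<integral>x. f x \<partial>mixture I w \<nu>) = (\<Sum>i\<in>I. w i * (\<integral>x. f x \<partial>\<nu> i))"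
proof -
  have bound: "(\<integral>\<^sup>+x. ennreal (norm (f x)) \<partial>\<nu> i) < \<infinity>" if "i \<in> I" for i
    using int[OF that] by (simp add: integrable_iff_bounded)
  have "(\<integral>\<^sup>+x. ennreal (norm (f x)) \<partial>mixture I w \<nu>) < \<infinity>"
    using bound by (subst nn_integral_mixture[OF fin sets]) (auto simp: fin ennreal_mult_less_top)
  then show im: "integrable (mixture I w \<nu>) f"
    by (intro integrableI_bounded) (simp_all cong: measurable_cong_sets)
  have part: "enn2real (\<integral>\<^sup>+x. ennreal (g x) \<partial>mixture I w \<nu>) = (\<Sum>i\<in>I. w i * enn2real (\<integral>\<^sup>+x. ennreal (g x) \<partial>\<nu> i))"
    if [measurable]: "g \<in> borel_measurable borel" and le: "\<And>x. g x \<le> norm (f x)" for g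
  proof -
    have "(\<integral>\<^sup>+x. ennreal (g x) \<partial>\<nu> i) < \<infinity>" if "i \<in> I" for i
      using bound[OF that] by (rule le_less_trans[rotated]) (intro nn_integral_mono ennreal_leI le)
    then show ?thesis
      using w by (subst nn_integral_mixture[OF fin sets])
        (auto simp: enn2real_sum enn2real_mult ennreal_mult_less_top intro!: sum.cong)
  qed
  show "(\<integral>x. f x \<partial>mixture I w \<nu>) = (\<Sum>i\<in>I. w i * (\<integral>x. f x \<partial>\<nu> i))"
    using part[of f] part[of "\<lambda>x. - f x"]
    by (simp add: real_lebesgue_integral_def im int sum_subtractf right_diff_distrib)
qed

lemma P2D:
  assumes "\<nu> \<in> P2"
  shows "prob_space \<nu>" "sets \<nu> = sets borel" "integrable \<nu> (\<lambda>x. (norm x)\<^sup>2)"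
  using assms by (auto simp: P2_def)

lemma return_in_P2: "return borel x \<in> P2"
proof -
  have "integrable (return borel x) (\<lambda>x. (norm x)\<^sup>2)"
    by (rule integrableI_bounded) (auto simp: nn_integral_return)
  then show ?thesis by (auto simp: P2_def prob_space_return)
qed

lemma average_in_P2:
  assumes N: "N \<ge> 1" and \<nu>: "\<And>i. i \<in> {1..N} \<Longrightarrow> \<nu> i \<in> P2"
  shows "average N \<nu> \<in> P2"
proof -
  have "emeasure (\<nu> i) UNIV = 1" if "i \<in> {1..N}" for i
    using prob_space.emeasure_space_1[OF P2D(1)[OF \<nu>[OF that]]] sets_eq_imp_space_eq[OF P2D(2)[OF \<nu>[OF that]]]
    by simp
  then have "emeasure (average N \<nu>) UNIV = (\<Sum>i\<in>{1..N}. ennreal (1 / real N) * 1)"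
    using P2D(2)[OF \<nu>] by (subst emeasure_mixture) (auto intro!: sum.cong)
  also have "\<dots> = 1" using N by (simp add: ennreal_of_nat_eq_real_of_nat ennreal_mult[symmetric])
  finally have "prob_space (average N \<nu>)" by (intro prob_spaceI) simp
  moreover have "integrable (average N \<nu>) (\<lambda>x. (norm x)\<^sup>2)"
    using P2D[OF \<nu>] by (intro integrable_mixture) auto
  ultimately show ?thesis by (simp add: P2_def)
qed

lemma P2_lipschitz_integrable:
  fixes f :: "'a::euclidean_space \<Rightarrow> real"
  assumes \<nu>: "\<nu> \<in> P2" and f: "L-lipschitz_on UNIV f"
  shows "integrable \<nu> (\<lambda>x. (f x)\<^sup>2)" and "integrable \<nu> f"
proof -
  interpret prob_space \<nu> by (rule P2D[OF \<nu>])
  note [measurable_cong] = P2D(2)[OF \<nu>]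
  have [measurable]: "f \<in> borel_measurable borel" by (rule lipschitz_borel_measurable[OF f])
  have "integrable \<nu> (\<lambda>x. 2 * (f 0)\<^sup>2 + 2 * L\<^sup>2 * (norm x)\<^sup>2)"
    using P2D(3)[OF \<nu>] by simp
  then show "integrable \<nu> (\<lambda>x. (f x)\<^sup>2)"
  proof (rule Bochner_Integration.integrable_bound)
    have "(f x)\<^sup>2 \<le> 2 * (f 0)\<^sup>2 + 2 * L\<^sup>2 * (norm x)\<^sup>2" for x
    proof -
      have "\<bar>f x\<bar>\<^sup>2 \<le> (\<bar>f 0\<bar> + L * norm x)\<^sup>2"
        by (intro power_mono lipschitz_real_norm_bound[OF f]) simp
      also have "\<dots> \<le> 2 * \<bar>f 0\<bar>\<^sup>2 + 2 * (L * norm x)\<^sup>2"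
        using sum_squares_bound[of "\<bar>f 0\<bar>" "L * norm x"] by (simp add: power2_sum)
      finally show ?thesis by (simp add: power_mult_distrib)
    qed
    then show "AE x in \<nu>. norm ((f x)\<^sup>2) \<le> norm (2 * (f 0)\<^sup>2 + 2 * L\<^sup>2 * (norm x)\<^sup>2)"
      by (intro AE_I2) simp
  qed measurable
  then show "integrable \<nu> f" by (rule square_integrable_imp_integrable[rotated]) measurable
qed

lemma integral_average:
  fixes f :: "'a::euclidean_space \<Rightarrow> real"
  assumes "\<And>i. i \<in> {1..N} \<Longrightarrow> \<nu> i \<in> P2" and "L-lipschitz_on UNIV f"
  shows "(\<integral>x. f x \<partial>average N \<nu>) = (\<Sum>i=1..N. \<integral>x. f x \<partial>\<nu> i) / real N"
  using assms P2_lipschitz_integrable(2)[OF assms] P2D(2)[OF assms(1)]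
  by (subst integral_mixture) (auto simp: lipschitz_borel_measurable sum_divide_distrib)

lemma integral_empirical:
  fixes f :: "'a::euclidean_space \<Rightarrow> real"
  assumes "L-lipschitz_on UNIV f"
  shows "(\<integral>x. f x \<partial>empirical N y) = (\<Sum>i=1..N. f (y i)) / real N"
  using lipschitz_borel_measurable[OF assms]
  by (subst integral_average[OF return_in_P2 assms]) (simp add: integral_return)

section \<open>Bregman remainders, product measures and entropy\<close>

text \<open>The lower bound is the tangent inequality. For the upper one, the remainder minus
  \<open>\<beta> / 2 * (t - a)^2\<close> has a derivative that is nonpositive to the right of
  \<open>a\<close> and nonnegative to the left, so it is largest at \<open>a\<close>, where it
  vanishes.\<close>

lemma bregman_bounds:
  fixes l :: "real \<Rightarrow> real"
  assumes conv: "convex_on UNIV l" and diff: "l differentiable_on UNIV" and lip: "\<beta>-lipschitz_on UNIV (deriv l)"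
  shows "0 \<le> l s - l a - deriv l a * (s - a)"
    and "l s - l a - deriv l a * (s - a) \<le> \<beta> / 2 * (s - a)\<^sup>2"
proof -
  have der: "(l has_real_derivative deriv l t) (at t)" for t
    using diff by (simp add: differentiable_on_def DERIV_deriv_iff_real_differentiable)
  show "0 \<le> l s - l a - deriv l a * (s - a)"
    using convex_on_imp_above_tangent[OF conv, of a s "deriv l a"] der[of a] by simp
  define g where "g t = l t - deriv l a * (t - a) - \<beta> / 2 * (t - a)\<^sup>2" for t
  have dg: "(g has_real_derivative deriv l t - deriv l a - \<beta> * (t - a)) (at t)" for t
    unfolding g_def[abs_def] by (auto intro!: derivative_eq_intros der)
  have lip': "\<bar>deriv l t - deriv l a\<bar> \<le> \<beta> * \<bar>t - a\<bar>" for t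
    using lipschitz_onD[OF lip, of t a] by (simp add: dist_real_def)
  have "g s \<le> g a"
  proof (cases "a \<le> s")
    case True
    show "g s \<le> g a"
    proof (rule DERIV_nonpos_imp_nonincreasing[OF True])
      fix t assume "a \<le> t" "t \<le> s"
      then show "\<exists>y. (g has_real_derivative y) (at t) \<and> y \<le> 0"
        using dg[of t] lip'[of t] by (intro exI conjI) auto
    qed
  next
    case False
    show "g s \<le> g a"
    proof (rule DERIV_nonneg_imp_nondecreasing[of s a g])
      show "s \<le> a" using False by simp
      fix t assume "s \<le> t" "t \<le> a"
      then show "\<exists>y. (g has_real_derivative y) (at t) \<and> 0 \<le> y"
        using dg[of t] lip'[of t] by (intro exI conjI) (auto simp: algebra_simps abs_le_iff)
    qed
  qed
  then show "l s - l a - deriv l a * (s - a) \<le> \<beta> / 2 * (s - a)\<^sup>2" by (simp add: g_def)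
qed

lemma deriv_le_lipschitz:
  fixes l :: "real \<Rightarrow> real"
  assumes lip: "L-lipschitz_on UNIV l" and diff: "l differentiable (at a)"
  shows "\<bar>deriv l a\<bar> \<le> L"
proof -
  have "(l has_real_derivative deriv l a) (at a)"
    using diff by (simp add: DERIV_deriv_iff_real_differentiable)
  then have "((\<lambda>h. \<bar>(l (a + h) - l a) / h\<bar>) \<longlongrightarrow> \<bar>deriv l a\<bar>) (at 0)"
    unfolding DERIV_def by (rule tendsto_rabs)
  moreover have "\<bar>(l (a + h) - l a) / h\<bar> \<le> L" if "h \<noteq> 0" for h
    using lipschitz_onD[OF lip, of "a + h" a] that by (simp add: dist_real_def abs_divide divide_le_eq)
  ultimately show ?thesis
    by (intro tendsto_upperbound) (auto simp: eventually_at_filter)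
qed

lemma PiM_density:
  assumes fin: "finite I" and M: "\<And>i. sigma_finite_measure (M i)"
    and f[measurable]: "\<And>i. i \<in> I \<Longrightarrow> f i \<in> borel_measurable (M i)"
    and dens: "\<And>i. i \<in> I \<Longrightarrow> sigma_finite_measure (density (M i) (f i))"
  shows "Pi\<^sub>M I (\<lambda>i. density (M i) (f i)) = density (Pi\<^sub>M I M) (\<lambda>x. \<Prod>i\<in>I. f i (x i))"
proof -
  \<comment> \<open>\<open>product_sigma_finite\<close> speaks about every index, so indices outside
    \<open>I\<close> keep the measure \<open>M i\<close>.\<close>
  define D where "D i = (if i \<in> I then density (M i) (f i) else M i)" for i
  interpret M: product_sigma_finite M by (intro product_sigma_finite.intro M)
  interpret D: product_sigma_finite D by (intro product_sigma_finite.intro) (auto simp: D_def M dens)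
  have sets_D: "sets (D i) = sets (M i)" for i by (simp add: D_def)
  have "density (Pi\<^sub>M I M) (\<lambda>x. \<Prod>i\<in>I. f i (x i)) = Pi\<^sub>M I D"
  proof (rule D.PiM_eqI[OF fin])
    show "sets (density (Pi\<^sub>M I M) (\<lambda>x. \<Prod>i\<in>I. f i (x i))) = sets (Pi\<^sub>M I D)"
      using sets_D by (auto intro!: sets_PiM_cong)
    fix A assume "\<And>i. i \<in> I \<Longrightarrow> A i \<in> sets (D i)"
    then have A[measurable]: "\<And>i. i \<in> I \<Longrightarrow> A i \<in> sets (M i)" by (simp add: sets_D)
    have "emeasure (density (Pi\<^sub>M I M) (\<lambda>x. \<Prod>i\<in>I. f i (x i))) (Pi\<^sub>E I A)
      = (\<integral>\<^sup>+x. (\<Prod>i\<in>I. f i (x i)) * indicator (Pi\<^sub>E I A) x \<partial>Pi\<^sub>M I M)"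
      using fin A by (intro emeasure_density sets_PiM_I_finite) measurable
    also have "\<dots> = (\<integral>\<^sup>+x. (\<Prod>i\<in>I. f i (x i) * indicator (A i) (x i)) \<partial>Pi\<^sub>M I M)"
    proof (rule nn_integral_cong)
      fix x assume "x \<in> space (Pi\<^sub>M I M)"
      then have "indicator (Pi\<^sub>E I A) x = (\<Prod>i\<in>I. indicator (A i) (x i) :: ennreal)"
        using fin by (auto simp: space_PiM PiE_def indicator_def prod_zero_iff Pi_iff)
      then show "(\<Prod>i\<in>I. f i (x i)) * indicator (Pi\<^sub>E I A) x = (\<Prod>i\<in>I. f i (x i) * indicator (A i) (x i))"
        by (simp add: prod.distrib)
    qed
    also have "\<dots> = (\<Prod>i\<in>I. \<integral>\<^sup>+y. f i y * indicator (A i) y \<partial>M i)"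
      by (rule M.product_nn_integral_prod[OF fin]) measurable
    also have "\<dots> = (\<Prod>i\<in>I. emeasure (D i) (A i))"
      by (intro prod.cong refl) (simp add: D_def emeasure_density)
    finally show "emeasure (density (Pi\<^sub>M I M) (\<lambda>x. \<Prod>i\<in>I. f i (x i))) (Pi\<^sub>E I A) = (\<Prod>i\<in>I. emeasure (D i) (A i))" .
  qed
  moreover have "Pi\<^sub>M I D = Pi\<^sub>M I (\<lambda>i. density (M i) (f i))"
    by (intro PiM_cong) (auto simp: D_def)
  ultimately show ?thesis by simp
qed

text \<open>Independence in the form of vanishing covariances: the square is expanded into a double
  sum, and each term is written as a product over all coordinates so that its integral
  factorizes.\<close>

lemma (in product_prob_space) variance_sum_PiM:
  fixes f :: "'i \<Rightarrow> 'a \<Rightarrow> real"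
  assumes fin: "finite I" and f1: "\<And>i. i \<in> I \<Longrightarrow> integrable (M i) (f i)"
    and f2: "\<And>i. i \<in> I \<Longrightarrow> integrable (M i) (\<lambda>x. (f i x)\<^sup>2)"
  shows "integrable (Pi\<^sub>M I M) (\<lambda>x. ((\<Sum>i\<in>I. f i (x i)) - (\<Sum>i\<in>I. \<integral>y. f i y \<partial>M i))\<^sup>2)"
    and "(\<integral>x. ((\<Sum>i\<in>I. f i (x i)) - (\<Sum>i\<in>I. \<integral>y. f i y \<partial>M i))\<^sup>2 \<partial>Pi\<^sub>M I M)
      = (\<Sum>i\<in>I. \<integral>x. (f i x - (\<integral>y. f i y \<partial>M i))\<^sup>2 \<partial>M i)"
proof -
  define Y where "Y i x = f i x - (\<integral>y. f i y \<partial>M i)" for i x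
  have Y1: "integrable (M i) (Y i)" if "i \<in> I" for i
    unfolding Y_def[abs_def] using f1[OF that] by simp
  have Y2: "integrable (M i) (\<lambda>x. Y i x * Y i x)" if "i \<in> I" for i
    unfolding Y_def using f1[OF that] f2[OF that] by (simp add: algebra_simps power2_eq_square)
  have Y0: "(\<integral>x. Y i x \<partial>M i) = 0" if "i \<in> I" for i
    using f1[OF that] by (simp add: Y_def M.prob_space)
  \<comment> \<open>If \<open>i = j\<close>, both factors sit at the same coordinate and give a
    square; otherwise coordinate \<open>i\<close> contributes a centred factor, which makes the
    product of integrals vanish.\<close>
  define F where "F i j l y = (if l = i then Y i y else 1) * (if l = j then Y j y else 1)" for i j l y
  have F_int: "integrable (M l) (F i j l)" if "i \<in> I" "j \<in> I" for i j l
    using Y1[OF that(1)] Y1[OF that(2)] Y2[OF that(1)] by (cases "l = i"; cases "l = j") (auto simp: F_def[abs_def])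
  have F_prod: "(\<Prod>l\<in>I. F i j l (x l)) = Y i (x i) * Y j (x j)" if "i \<in> I" "j \<in> I" for i j x
  proof -
    have "(\<Prod>l\<in>I. if l = i then Y i (x l) else 1) = Y i (x i)" if "i \<in> I" for i
      using that fin by (subst prod.delta) auto
    then show ?thesis using that by (simp add: F_def prod.distrib)
  qed
  have F_integral: "(\<Prod>l\<in>I. \<integral>y. F i j l y \<partial>M l) = (if i = j then \<integral>y. Y i y * Y i y \<partial>M i else 0)"
    if "i \<in> I" "j \<in> I" for i j
  proof (cases "i = j")
    case True
    have "(\<Prod>l\<in>I. \<integral>y. F i j l y \<partial>M l) = (\<Prod>l\<in>I. if l = i then \<integral>y. Y i y * Y i y \<partial>M i else 1)"
      by (intro prod.cong refl) (simp add: F_def True M.prob_space)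
    then show ?thesis using that fin True by (simp add: prod.delta)
  next
    case False
    have "(\<integral>y. F i j i y \<partial>M i) = 0" using False Y0[OF that(1)] by (simp add: F_def)
    then have "(\<Prod>l\<in>I. \<integral>y. F i j l y \<partial>M l) = 0" using that fin by (intro prod_zero) auto
    then show ?thesis using False by simp
  qed
  have sq: "((\<Sum>i\<in>I. f i (x i)) - (\<Sum>i\<in>I. \<integral>y. f i y \<partial>M i))\<^sup>2 = (\<Sum>i\<in>I. \<Sum>j\<in>I. \<Prod>l\<in>I. F i j l (x l))" for x
    by (simp add: F_prod sum_subtractf[symmetric] Y_def[symmetric] power2_eq_square sum_product)
  have int: "integrable (Pi\<^sub>M I M) (\<lambda>x. \<Prod>l\<in>I. F i j l (x l))" if "i \<in> I" "j \<in> I" for i j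
    by (rule product_integrable_prod[OF fin F_int[OF that]])
  show "integrable (Pi\<^sub>M I M) (\<lambda>x. ((\<Sum>i\<in>I. f i (x i)) - (\<Sum>i\<in>I. \<integral>y. f i y \<partial>M i))\<^sup>2)"
    unfolding sq by (intro Bochner_Integration.integrable_sum int)
  have "(\<integral>x. (\<Sum>i\<in>I. \<Sum>j\<in>I. \<Prod>l\<in>I. F i j l (x l)) \<partial>Pi\<^sub>M I M)
      = (\<Sum>i\<in>I. \<Sum>j\<in>I. if i = j then \<integral>y. Y i y * Y i y \<partial>M i else 0)"
    by (simp add: Bochner_Integration.integral_sum int product_integral_prod[OF fin F_int] F_integral cong: sum.cong)
  also have "\<dots> = (\<Sum>i\<in>I. \<integral>x. (f i x - (\<integral>y. f i y \<partial>M i))\<^sup>2 \<partial>M i)"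
    using fin by (simp add: Y_def power2_eq_square)
  finally show "(\<integral>x. ((\<Sum>i\<in>I. f i (x i)) - (\<Sum>i\<in>I. \<integral>y. f i y \<partial>M i))\<^sup>2 \<partial>Pi\<^sub>M I M)
      = (\<Sum>i\<in>I. \<integral>x. (f i x - (\<integral>y. f i y \<partial>M i))\<^sup>2 \<partial>M i)"
    unfolding sq .
qed

text \<open>The divergence equals \<open>ln w\<close> minus \<open>k\<close> times the mean of
  \<open>\<Delta>\<close> under the tilted measure, which is nonnegative and is dropped. The
  normalization gives \<open>1 / w\<close> as the \<open>Q\<close>-mean of
  \<open>exp (- k * \<Delta>)\<close>, and Jensen bounds this from below.\<close>

lemma KL_gibbs_le:
  fixes \<Delta> :: "'a \<Rightarrow> real"
  assumes Q: "prob_space Q" and nn: "\<And>x. 0 \<le> \<Delta> x" and int: "integrable Q \<Delta>"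
    and k: "0 \<le> k" and w: "0 < w" and P: "prob_space (density Q (\<lambda>x. ennreal (w * exp (- k * \<Delta> x))))"
  shows "KL (density Q (\<lambda>x. ennreal (w * exp (- k * \<Delta> x)))) Q \<le> ereal (k * (\<integral>x. \<Delta> x \<partial>Q))"
proof -
  interpret Q: prob_space Q by fact
  define \<rho> where "\<rho> x = w * exp (- k * \<Delta> x)" for x
  let ?P = "density Q (\<lambda>x. ennreal (\<rho> x))"
  interpret P: prob_space ?P using P by (simp add: \<rho>_def)
  have [measurable]: "\<Delta> \<in> borel_measurable Q" using int by simp
  have [measurable]: "\<rho> \<in> borel_measurable Q" unfolding \<rho>_def by measurable
  have \<rho>_pos: "0 < \<rho> x" for x using w by (simp add: \<rho>_def)
  have \<rho>_le: "\<rho> x \<le> w" for x using w k nn[of x] by (simp add: \<rho>_def)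
  have ln_\<rho>: "log (exp 1) (\<rho> x) = ln w - k * \<Delta> x" for x
    using w by (simp add: \<rho>_def log_def ln_mult)
  have int_\<rho>: "integrable Q \<rho>"
    using \<rho>_le \<rho>_pos by (intro Q.integrable_const_bound[where B = w]) (auto intro!: AE_I2 simp: less_imp_le)
  have int_\<rho>\<Delta>: "integrable Q (\<lambda>x. \<rho> x * \<Delta> x)"
  proof (rule Bochner_Integration.integrable_bound)
    show "integrable Q (\<lambda>x. w * \<Delta> x)" using int by simp
    show "AE x in Q. norm (\<rho> x * \<Delta> x) \<le> norm (w * \<Delta> x)"
      using \<rho>_le \<rho>_pos nn w by (auto intro!: AE_I2 mult_right_mono simp: abs_mult less_imp_le)
  qed measurable
  have int_log: "integrable Q (\<lambda>x. \<rho> x * log (exp 1) (\<rho> x))"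
    unfolding ln_\<rho> right_diff_distrib using int_\<rho> int_\<rho>\<Delta> by (simp add: mult.left_commute[of _ k])
  have mass: "(\<integral>x. \<rho> x \<partial>Q) = 1"
  proof -
    have "ennreal (\<integral>x. \<rho> x \<partial>Q) = (\<integral>\<^sup>+x. ennreal (\<rho> x) \<partial>Q)"
      using \<rho>_pos by (intro nn_integral_eq_integral[symmetric] int_\<rho>) (auto simp: less_imp_le)
    also have "\<dots> = emeasure ?P (space ?P)" by (simp add: emeasure_density cong: nn_integral_cong)
    finally show ?thesis using P.emeasure_space_1 by simp
  qed
  \<comment> \<open>\<open>KL\<close> is infinite unless absolute continuity and integrability of
    the entropy density are established. The Radon-Nikodym derivative is known only almost
    everywhere, hence the detour through \<open>AE\<close>.\<close>
  have ac: "absolutely_continuous Q ?P" by (rule absolutely_continuousI_density) simp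
  have "AE x in Q. ennreal (\<rho> x) = RN_deriv Q ?P x"
    by (rule Q.RN_deriv_unique) auto
  then have "AE x in Q. log (exp 1) (\<rho> x) = entropy_density (exp 1) Q ?P x"
  proof eventually_elim
    case (elim x)
    then show ?case using \<rho>_pos[of x] by (simp add: entropy_density_def elim[symmetric])
  qed
  then have "AE x in ?P. log (exp 1) (\<rho> x) = entropy_density (exp 1) Q ?P x"
    by (rule absolutely_continuous_AE[OF _ ac, rotated]) simp
  moreover have "integrable ?P (\<lambda>x. log (exp 1) (\<rho> x))"
    using int_log \<rho>_pos by (subst integrable_density) (auto simp: less_imp_le)
  ultimately have ent: "integrable ?P (entropy_density (exp 1) Q ?P)"
    by (subst integrable_cong_AE[where g = "\<lambda>x. log (exp 1) (\<rho> x)"]) auto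
  have "KL_divergence (exp 1) Q ?P = (\<integral>x. \<rho> x * log (exp 1) (\<rho> x) \<partial>Q)"
    using \<rho>_pos by (intro Q.KL_density) (auto simp: less_imp_le)
  also have "\<dots> = (\<integral>x. ln w * \<rho> x - k * (\<rho> x * \<Delta> x) \<partial>Q)"
    by (simp add: ln_\<rho> algebra_simps)
  also have "\<dots> = ln w - k * (\<integral>x. \<rho> x * \<Delta> x \<partial>Q)"
    using int_\<rho> int_\<rho>\<Delta> by (simp add: mass)
  also have "\<dots> \<le> ln w"
    using k nn \<rho>_pos by (simp add: Bochner_Integration.integral_nonneg less_imp_le)
  also have "\<dots> \<le> k * (\<integral>x. \<Delta> x \<partial>Q)"
  proof -
    have e: "integrable Q (\<lambda>x. exp (- k * \<Delta> x))"
      using int_\<rho> w unfolding \<rho>_def by simp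
    have "exp (\<integral>x. - k * \<Delta> x \<partial>Q) \<le> (\<integral>x. exp (- k * \<Delta> x) \<partial>Q)"
      using int e by (intro Q.exp_expectation_le) auto
    also have "\<dots> = 1 / w" using mass w unfolding \<rho>_def by (simp add: field_simps)
    finally have "w \<le> exp (k * (\<integral>x. \<Delta> x \<partial>Q))"
      using w by (simp add: exp_minus field_simps)
    then show ?thesis using w by (simp add: ln_le_cancel_iff[symmetric] del: ln_le_cancel_iff)
  qed
  finally show ?thesis using ac ent by (simp add: KL_def \<rho>_def)
qed

theorem theorem8:
  fixes N :: nat
    and \<sigma> \<alpha> L\<^sub>l \<beta>\<^sub>l L\<^sub>h \<beta> B C :: real
    and V :: "nat \<Rightarrow> real^'d \<Rightarrow> real"
    and P :: "'z measure"
    and l :: "real \<Rightarrow> 'z \<Rightarrow> real"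
    and h :: "real^'d \<Rightarrow> 'z \<Rightarrow> real"
    and \<mu> :: "(nat \<Rightarrow> real^'d) measure"
    and \<pi> :: "nat \<Rightarrow> (real^'d) measure"
  assumes "N \<ge> 1" and "\<sigma> > 0" and "\<alpha> > 0"
    and "\<And>i. i \<in> {1..N} \<Longrightarrow> strongly_convex \<alpha> (V i)"
    and "prob_space P"
    and "\<And>z. z \<in> space P \<Longrightarrow> convex_on UNIV (\<lambda>r. l r z)"
    and "\<And>z. z \<in> space P \<Longrightarrow> L\<^sub>l-lipschitz_on UNIV (\<lambda>r. l r z)"
    and "\<And>z. z \<in> space P \<Longrightarrow> (\<lambda>r. l r z) differentiable_on UNIV"
    and "\<And>z. z \<in> space P \<Longrightarrow> \<beta>\<^sub>l-lipschitz_on UNIV (deriv (\<lambda>r. l r z))"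
    and "\<And>z. z \<in> space P \<Longrightarrow> L\<^sub>h-lipschitz_on UNIV (\<lambda>x. h x z)"
    and "\<beta> = L\<^sub>h\<^sup>2 * \<beta>\<^sub>l" and "B = L\<^sub>h * L\<^sub>l"
    and regular: "regular P l h"
    and A1: "\<And>\<nu>0 \<nu>1 t. \<nu>0 \<in> P2 \<Longrightarrow> \<nu>1 \<in> P2 \<Longrightarrow> t \<in> {0..1} \<Longrightarrow>
        F0 P l h (interp t \<nu>0 \<nu>1) \<le> (1 - t) * F0 P l h \<nu>0 + t * F0 P l h \<nu>1"
    and A2: "\<And>\<nu> x y. \<nu> \<in> P2 \<Longrightarrow> onorm (\<lambda>v. mixed_hessian (d2F0 P l h \<nu>) x y *v v) \<le> \<beta>"
    and A3: "\<And>\<nu> x. \<nu> \<in> P2 \<Longrightarrow> norm (grad (dF0 P l h \<nu>) x) \<le> B"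
    and "has_density_propto (Pi\<^sub>M {1..N} (\<lambda>_. lborel)) \<mu>
        (\<lambda>x. exp (- (\<Sum>i=1..N. V i (x i)) - 2 * real N / \<sigma>\<^sup>2 * F0 P l h (empirical N x)))"
    and "\<And>i. i \<in> {1..N} \<Longrightarrow> \<pi> i \<in> P2"
    and "\<And>i. i \<in> {1..N} \<Longrightarrow> has_density_propto lborel (\<pi> i)
        (\<lambda>x. exp (- V i x - 2 / \<sigma>\<^sup>2 * dF0 P l h (average N \<pi>) x))"
    and "\<And>i. i \<in> {1..N} \<Longrightarrow> poincare (\<pi> i) C"
  shows "KL \<mu> (Pi\<^sub>M {1..N} \<pi>)
    \<le> ereal (\<beta> / \<sigma>\<^sup>2 * min C (2 / \<alpha> + 8 * B\<^sup>2 / (\<alpha>\<^sup>2 * \<sigma>^4)))"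
proof -
  note N = assms(1) and \<sigma> = assms(2) and \<alpha> = assms(3) and V = assms(4)
    and convex = assms(6) and lip_l = assms(7) and diff_l = assms(8) and lip_l' = assms(9) and lip_h = assms(10)
    and \<beta> = assms(11) and B = assms(12) and \<mu> = assms(17) and \<pi>_P2 = assms(18) and \<pi> = assms(19)
    and poincare = assms(20)
  interpret P: prob_space P by fact
  have l_meas [measurable]: "(\<lambda>(r, z). l r z) \<in> borel_measurable (borel \<Otimes>\<^sub>M P)"
    and h_meas [measurable]: "(\<lambda>(x, z). h x z) \<in> borel_measurable (borel \<Otimes>\<^sub>M P)"
    and int_l: "\<And>\<nu>. \<nu> \<in> P2 \<Longrightarrow> integrable P (\<lambda>z. l (\<integral>\<theta>. h \<theta> z \<partial>\<nu>) z)"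
    and int_l'h: "\<And>\<nu> x. \<nu> \<in> P2 \<Longrightarrow> integrable P (\<lambda>z. deriv (\<lambda>r. l r z) (\<integral>\<theta>. h \<theta> z \<partial>\<nu>) * h x z)"
    using regular by (auto simp: regular_def)

  \<comment> \<open>Expansion of \<open>F0\<close> at the average measure\<close>
  define m where "m = average N \<pi>"
  have m: "m \<in> P2" unfolding m_def by (rule average_in_P2[OF N \<pi>_P2])
  interpret m: prob_space m by (rule P2D(1)[OF m])
  note [measurable_cong] = P2D(2)[OF m]
  define a where "a z = (\<integral>\<theta>. h \<theta> z \<partial>m)" for z
  define D where "D z = deriv (\<lambda>r. l r z) (a z)" for z
  \<comment> \<open>The integral of \<open>h\<close> against the empirical measure, written as a sum
    so that joint measurability in \<open>x\<close> and \<open>z\<close> is evident; the two agree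
    on \<open>space P\<close>, where \<open>h\<close> is Lipschitz in its first argument.\<close>
  define s where "s x z = (\<Sum>i=1..N. h (x i) z) / real N" for x z
  define breg where "breg x z = l (s x z) z - l (a z) z - D z * (s x z - a z)" for x z
  define \<Delta> where "\<Delta> x = (\<integral>z. breg x z \<partial>P)" for x
  obtain z0 where z0: "z0 \<in> space P" using P.not_empty by blast
  have nonneg: "0 \<le> L\<^sub>l" "0 \<le> \<beta>\<^sub>l" "0 \<le> L\<^sub>h"
    using lip_l[OF z0] lip_l'[OF z0] lip_h[OF z0] by (auto dest: lipschitz_on_nonneg)

  have [measurable]: "a \<in> borel_measurable P"
  proof -
    have "(\<lambda>(z, \<theta>). h \<theta> z) \<in> borel_measurable (P \<Otimes>\<^sub>M m)" by measurable
    then show ?thesis unfolding a_def by (rule m.borel_measurable_lebesgue_integral)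
  qed
  \<comment> \<open>Measurability in \<open>z\<close> of the derivative comes from its being a
    pointwise limit of difference quotients.\<close>
  have [measurable]: "D \<in> borel_measurable P"
  proof (rule borel_measurable_LIMSEQ_real)
    fix z assume z: "z \<in> space P"
    have "((\<lambda>r. l r z) has_real_derivative D z) (at (a z))"
      using diff_l[OF z] by (simp add: D_def differentiable_on_def DERIV_deriv_iff_real_differentiable)
    then have "((\<lambda>t. (l (a z + t) z - l (a z) z) / t) \<longlongrightarrow> D z) (at 0)"
      by (simp add: DERIV_def)
    moreover have "filterlim (\<lambda>n. 1 / real (Suc n)) (at 0) sequentially"
      using LIMSEQ_inverse_real_of_nat unfolding inverse_eq_divide by (auto simp: filterlim_at)
    ultimately show "(\<lambda>n. (l (a z + 1 / real (Suc n)) z - l (a z) z) / (1 / real (Suc n))) \<longlonglongrightarrow> D z"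
      by (rule filterlim_compose)
  qed measurable
  have D_le: "\<bar>D z\<bar> \<le> L\<^sub>l" if "z \<in> space P" for z
    unfolding D_def using diff_l[OF that] by (intro deriv_le_lipschitz[OF lip_l[OF that]]) (simp add: differentiable_on_def)
  have empirical_P2: "empirical N x \<in> P2" for x :: "nat \<Rightarrow> real^'d"
    by (rule average_in_P2[OF N return_in_P2])
  have s_eq: "(\<integral>\<theta>. h \<theta> z \<partial>empirical N x) = s x z" if "z \<in> space P" for x z
    unfolding s_def by (rule integral_empirical[OF lip_h[OF that]])
  have a_eq: "a z = (\<Sum>i=1..N. \<integral>\<theta>. h \<theta> z \<partial>\<pi> i) / real N" if "z \<in> space P" for z
    unfolding a_def m_def by (rule integral_average[OF \<pi>_P2 lip_h[OF that]])
  have int_ls: "integrable P (\<lambda>z. l (s x z) z)" for x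
    using int_l[OF empirical_P2[of x]] by (rule Bochner_Integration.integrable_cong[THEN iffD1, rotated 2]) (simp_all only: s_eq)
  have int_la: "integrable P (\<lambda>z. l (a z) z)" using int_l[OF m] by (simp add: a_def)
  have int_Dh: "integrable P (\<lambda>z. D z * h x z)" for x using int_l'h[OF m] by (simp add: a_def D_def)
  have int_Ds: "integrable P (\<lambda>z. D z * s x z)" for x
    using int_Dh by (simp add: s_def sum_distrib_left)

  have breg_nonneg: "0 \<le> breg x z" and breg_le: "breg x z \<le> \<beta>\<^sub>l / 2 * (s x z - a z)\<^sup>2"
    if "z \<in> space P" for x z
    using bregman_bounds[OF convex[OF that] diff_l[OF that] lip_l'[OF that], of "s x z" "a z"]
    by (simp_all add: breg_def D_def)
  have breg_meas: "(\<lambda>(x, z). breg x z) \<in> borel_measurable (Pi\<^sub>M {1..N} (\<lambda>_. borel) \<Otimes>\<^sub>M P)"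
    unfolding breg_def s_def by measurable
  \<comment> \<open>The values of \<open>h\<close> may be unbounded in \<open>z\<close>, but its
    increments in the first argument are controlled uniformly in \<open>z\<close>. So for fixed
    \<open>x\<close> the remainder \<open>breg x\<close> is bounded and hence integrable.\<close>
  have sa_bound: "\<bar>s x z - a z\<bar> \<le> (\<Sum>i=1..N. L\<^sub>h * (\<integral>\<theta>. norm (x i - \<theta>) \<partial>m)) / real N" if z: "z \<in> space P" for x z
  proof -
    have hm: "integrable m (\<lambda>\<theta>. h \<theta> z)" by (rule P2_lipschitz_integrable(2)[OF m lip_h[OF z]])
    have nm: "integrable m (\<lambda>\<theta>. norm (y - \<theta>))" for y :: "real^'d"
      by (rule P2_lipschitz_integrable(2)[OF m, of 1]) (auto intro!: lipschitz_onI simp: dist_real_def dist_norm, metis dist_norm dist_commute abs_dist_diff_le)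
    have "\<bar>h y z - a z\<bar> \<le> L\<^sub>h * (\<integral>\<theta>. norm (y - \<theta>) \<partial>m)" for y
    proof -
      have "\<bar>h y z - a z\<bar> = \<bar>\<integral>\<theta>. h y z - h \<theta> z \<partial>m\<bar>" using hm by (simp add: a_def m.prob_space)
      also have "\<dots> \<le> (\<integral>\<theta>. L\<^sub>h * norm (y - \<theta>) \<partial>m)"
        using hm nm lipschitz_onD[OF lip_h[OF z], of y]
        by (intro integral_abs_bound_integral) (auto simp: dist_real_def dist_norm)
      finally show ?thesis by simp
    qed
    then have "(\<Sum>i=1..N. \<bar>h (x i) z - a z\<bar>) / real N \<le> (\<Sum>i=1..N. L\<^sub>h * (\<integral>\<theta>. norm (x i - \<theta>) \<partial>m)) / real N"
      by (intro divide_right_mono sum_mono) auto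
    moreover have "\<bar>s x z - a z\<bar> \<le> (\<Sum>i=1..N. \<bar>h (x i) z - a z\<bar>) / real N"
    proof -
      have "s x z - a z = (\<Sum>i=1..N. h (x i) z - a z) / real N"
        using N by (simp add: s_def sum_subtractf field_simps)
      then show ?thesis by (simp add: abs_divide divide_right_mono)
    qed
    ultimately show ?thesis by simp
  qed
  have int_breg: "integrable P (breg x)" for x
  proof -
    let ?K = "(\<Sum>i=1..N. L\<^sub>h * (\<integral>\<theta>. norm (x i - \<theta>) \<partial>m)) / real N"
    have "norm (breg x z) \<le> \<beta>\<^sub>l / 2 * ?K\<^sup>2" if "z \<in> space P" for z
    proof -
      have "(s x z - a z)\<^sup>2 \<le> ?K\<^sup>2" using power_mono[OF sa_bound[OF that, of x], of 2] by simp
      then have "\<beta>\<^sub>l / 2 * (s x z - a z)\<^sup>2 \<le> \<beta>\<^sub>l / 2 * ?K\<^sup>2" using nonneg by (intro mult_left_mono) auto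
      then show ?thesis using breg_nonneg[OF that, of x] breg_le[OF that, of x] by simp
    qed
    moreover have "breg x \<in> borel_measurable P"
      unfolding breg_def s_def by measurable
    ultimately show ?thesis by (intro P.integrable_const_bound[where B = "\<beta>\<^sub>l / 2 * ?K\<^sup>2"] AE_I2)
  qed
  have \<Delta>_nonneg: "0 \<le> \<Delta> x" for x
    unfolding \<Delta>_def by (intro integral_nonneg_AE AE_I2 breg_nonneg)
  define K where "K = (\<integral>z. l (a z) z - D z * a z \<partial>P)"
  have F0_eq: "F0 P l h (empirical N x) = \<Delta> x + (\<Sum>i=1..N. dF0 P l h m (x i)) / real N + K" for x
  proof -
    \<comment> \<open>Regularity speaks of \<open>D z * h x z\<close> only; for \<open>a\<close> in
      place of \<open>h x\<close>, integrability is read off from the remaining terms of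
      \<open>breg\<close>.\<close>
    have int_Da: "integrable P (\<lambda>z. D z * a z)"
    proof -
      have "D z * a z = D z * s x z - (l (s x z) z - l (a z) z - breg x z)" for z
        by (simp add: breg_def algebra_simps)
      then show ?thesis using int_Ds int_ls int_la int_breg by simp
    qed
    have "F0 P l h (empirical N x) = (\<integral>z. l (s x z) z \<partial>P)"
      unfolding F0_def by (rule Bochner_Integration.integral_cong) (simp_all only: s_eq)
    also have "\<dots> = (\<integral>z. breg x z + D z * s x z + (l (a z) z - D z * a z) \<partial>P)"
      by (simp add: breg_def algebra_simps)
    also have "\<dots> = \<Delta> x + (\<integral>z. D z * s x z \<partial>P) + K"
      unfolding \<Delta>_def K_def using int_breg int_Ds int_la int_Da by simp
    also have "(\<integral>z. D z * s x z \<partial>P) = (\<Sum>i=1..N. dF0 P l h m (x i)) / real N"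
      using int_Dh by (simp add: s_def sum_distrib_left dF0_def D_def[symmetric] a_def[symmetric])
    finally show ?thesis .
  qed

  \<comment> \<open>Variances under the single factors\<close>
  define U where "U i x = - V i x - 2 / \<sigma>\<^sup>2 * dF0 P l h m x" for i x
  define Q where "Q = Pi\<^sub>M {1..N} \<pi>"
  have dF0_lip: "B-lipschitz_on UNIV (dF0 P l h m)"
  proof (rule lipschitz_onI)
    fix x y :: "real^'d"
    have "\<bar>dF0 P l h m x - dF0 P l h m y\<bar> = \<bar>\<integral>z. D z * h x z - D z * h y z \<partial>P\<bar>"
      using int_Dh by (simp add: dF0_def D_def[symmetric] a_def[symmetric])
    also have "\<dots> \<le> (\<integral>z. \<bar>D z * h x z - D z * h y z\<bar> \<partial>P)"
      by (rule integral_abs_bound)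
    also have "\<dots> \<le> (\<integral>z. B * dist x y \<partial>P)"
    proof (rule integral_mono)
      fix z assume z: "z \<in> space P"
      have "\<bar>D z * h x z - D z * h y z\<bar> = \<bar>D z\<bar> * \<bar>h x z - h y z\<bar>"
        by (simp add: right_diff_distrib[symmetric] abs_mult)
      also have "\<dots> \<le> L\<^sub>l * (L\<^sub>h * dist x y)"
        using D_le[OF z] lipschitz_onD[OF lip_h[OF z], of x y] nonneg
        by (intro mult_mono) (auto simp: dist_real_def)
      finally show "\<bar>D z * h x z - D z * h y z\<bar> \<le> B * dist x y" by (simp add: B mult_ac)
    qed (use int_Dh in auto)
    finally show "dist (dF0 P l h m x) (dF0 P l h m y) \<le> B * dist x y" by (simp add: dist_real_def P.prob_space)
  next
    show "0 \<le> B" using nonneg by (simp add: B)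
  qed
  have U_meas: "U i \<in> borel_measurable borel" if "i \<in> {1..N}" for i
  proof -
    interpret V: strongly_convex_potential "V i" \<alpha> by standard (use V[OF that] \<alpha> in auto)
    show ?thesis unfolding U_def using V.measurable_V lipschitz_borel_measurable[OF dF0_lip] by measurable
  qed
  have \<pi>_dens: "has_density_propto lborel (\<pi> i) (\<lambda>x. exp (U i x))" if "i \<in> {1..N}" for i
    using \<pi>[OF that] by (simp add: U_def m_def)

  define c where "c = min C (2 / \<alpha> + 8 * B\<^sup>2 / (\<alpha>\<^sup>2 * \<sigma>^4))"
  have var_h: "(\<integral>x. (h x z - (\<integral>y. h y z \<partial>\<pi> i))\<^sup>2 \<partial>\<pi> i) \<le> L\<^sub>h\<^sup>2 * c"
    if i: "i \<in> {1..N}" and z: "z \<in> space P" for i z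
  proof -
    \<comment> \<open>The sign allows the squared gradient in the Poincare inequality to be replaced
      by its upper bound.\<close>
    have "0 \<le> C" by (rule poincare_constant_nonneg[OF poincare[OF i] \<pi>_dens[OF i] U_meas[OF i]])
    then have "(\<integral>x. (h x z - (\<integral>y. h y z \<partial>\<pi> i))\<^sup>2 \<partial>\<pi> i) \<le> C * L\<^sub>h\<^sup>2"
      using poincare_lipschitz[OF poincare[OF i] P2D(1,2)[OF \<pi>_P2[OF i]] _ lip_h[OF z]]
        P2_lipschitz_integrable(1)[OF \<pi>_P2[OF i] lip_h[OF z]] by simp
    moreover have "(\<integral>x. (h x z - (\<integral>y. h y z \<partial>\<pi> i))\<^sup>2 \<partial>\<pi> i)
        \<le> L\<^sub>h\<^sup>2 * (2 / \<alpha> + 2 * (2 / \<sigma>\<^sup>2 * B)\<^sup>2 / \<alpha>\<^sup>2)"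
    proof (rule has_density_propto_exp_lipschitz_variance[OF \<alpha> V[OF i] _ lip_h[OF z]])
      show "(2 / \<sigma>\<^sup>2 * B)-lipschitz_on UNIV (\<lambda>x. 2 / \<sigma>\<^sup>2 * dF0 P l h m x)"
        using lipschitz_on_cmult_real[OF dF0_lip, of "2 / \<sigma>\<^sup>2"] by simp
      show "has_density_propto lborel (\<pi> i) (\<lambda>x. exp (- V i x - 2 / \<sigma>\<^sup>2 * dF0 P l h m x))"
        using \<pi>_dens[OF i] by (simp add: U_def)
    qed
    moreover have "2 * (2 / \<sigma>\<^sup>2 * B)\<^sup>2 / \<alpha>\<^sup>2 = 8 * B\<^sup>2 / (\<alpha>\<^sup>2 * \<sigma>^4)"
      by (simp add: power_mult_distrib power_divide power_mult[symmetric])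
    ultimately show ?thesis by (simp add: c_def min_def mult.commute)
  qed

  \<comment> \<open>Mean of the remainder under the product measure\<close>
  \<comment> \<open>The product locale asks for a probability measure at every index; outside
    \<open>{1..N}\<close> any of the given ones will do.\<close>
  define \<pi>' where "\<pi>' i = (if i \<in> {1..N} then \<pi> i else \<pi> 1)" for i
  have \<pi>'_P2: "\<pi>' i \<in> P2" for i using \<pi>_P2 N by (simp add: \<pi>'_def)
  interpret \<pi>': product_prob_space \<pi>' "{1..N}"
    by (intro product_prob_spaceI P2D(1)[OF \<pi>'_P2])
  have Q': "Q = Pi\<^sub>M {1..N} \<pi>'" unfolding Q_def by (intro PiM_cong) (auto simp: \<pi>'_def)
  interpret Q: prob_space Q unfolding Q' by (rule \<pi>'.prob_space_axioms)
  interpret QP: pair_sigma_finite Q P ..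
  have sets_Q: "sets Q = sets (Pi\<^sub>M {1..N} (\<lambda>_. borel))"
    unfolding Q' by (intro sets_PiM_cong refl P2D(2)[OF \<pi>'_P2])
  note [measurable_cong] = sets_Q
  have breg_meas_Q [measurable]: "(\<lambda>(x, z). breg x z) \<in> borel_measurable (Q \<Otimes>\<^sub>M P)"
    using breg_meas sets_pair_measure_cong[OF sets_Q refl, of P] by (simp cong: measurable_cong_sets)
  have \<Delta>_meas [measurable]: "\<Delta> \<in> borel_measurable (Pi\<^sub>M {1..N} (\<lambda>_. borel))"
    unfolding \<Delta>_def by (rule P.borel_measurable_lebesgue_integral[OF breg_meas])
  have sa_meas: "(\<lambda>(x, z). ennreal (\<beta>\<^sub>l / 2 * (s x z - a z)\<^sup>2)) \<in> borel_measurable (Q \<Otimes>\<^sub>M P)"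
    unfolding s_def by measurable
  have sa_integral: "(\<integral>\<^sup>+x. ennreal (\<beta>\<^sub>l / 2 * (s x z - a z)\<^sup>2) \<partial>Q) \<le> ennreal (\<beta> * c / (2 * real N))"
    if z: "z \<in> space P" for z
  proof -
    have i1: "integrable (\<pi>' i) (\<lambda>x. h x z)" and i2: "integrable (\<pi>' i) (\<lambda>x. (h x z)\<^sup>2)" for i
      using P2_lipschitz_integrable[OF \<pi>'_P2 lip_h[OF z]] by auto
    let ?S = "\<lambda>x. ((\<Sum>i=1..N. h (x i) z) - (\<Sum>i=1..N. \<integral>y. h y z \<partial>\<pi>' i))\<^sup>2"
    have S_int: "integrable Q ?S" unfolding Q' by (rule \<pi>'.variance_sum_PiM(1)) (auto simp: i1 i2)
    have "(\<integral>x. ?S x \<partial>Q) = (\<Sum>i=1..N. \<integral>x. (h x z - (\<integral>y. h y z \<partial>\<pi>' i))\<^sup>2 \<partial>\<pi>' i)"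
      unfolding Q' by (rule \<pi>'.variance_sum_PiM(2)) (auto simp: i1 i2)
    also have "\<dots> \<le> (\<Sum>i=1..N. L\<^sub>h\<^sup>2 * c)"
      using var_h[OF _ z] by (intro sum_mono) (simp add: \<pi>'_def)
    finally have S_le: "(\<integral>x. ?S x \<partial>Q) \<le> real N * (L\<^sub>h\<^sup>2 * c)" by simp
    have "a z = (\<Sum>i=1..N. \<integral>y. h y z \<partial>\<pi>' i) / real N"
      unfolding a_eq[OF z] by (intro arg_cong2[where f = "(/)"] sum.cong refl) (simp add: \<pi>'_def)
    \<comment> \<open>Clearing both averages produces \<open>1 / N^2\<close>; the sum of
      \<open>N\<close> variances gives back one factor \<open>N\<close>.\<close>
    then have sa: "\<beta>\<^sub>l / 2 * (s x z - a z)\<^sup>2 = \<beta>\<^sub>l / (2 * (real N)\<^sup>2) * ?S x" for x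
      by (simp add: s_def diff_divide_distrib[symmetric] power_divide)
    have "(\<integral>\<^sup>+x. ennreal (\<beta>\<^sub>l / 2 * (s x z - a z)\<^sup>2) \<partial>Q) = ennreal (\<integral>x. \<beta>\<^sub>l / (2 * (real N)\<^sup>2) * ?S x \<partial>Q)"
      unfolding sa using S_int nonneg by (intro nn_integral_eq_integral integrable_mult_right) auto
    also have "(\<integral>x. \<beta>\<^sub>l / (2 * (real N)\<^sup>2) * ?S x \<partial>Q) = \<beta>\<^sub>l / (2 * (real N)\<^sup>2) * (\<integral>x. ?S x \<partial>Q)"
      by (rule integral_mult_right_zero)
    also have "ennreal \<dots> \<le> ennreal (\<beta>\<^sub>l / (2 * (real N)\<^sup>2) * (real N * (L\<^sub>h\<^sup>2 * c)))"
      using nonneg by (intro ennreal_leI mult_left_mono S_le) auto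
    also have "\<beta>\<^sub>l / (2 * (real N)\<^sup>2) * (real N * (L\<^sub>h\<^sup>2 * c)) = \<beta> * c / (2 * real N)"
      using N by (simp add: \<beta> power2_eq_square field_simps)
    finally show ?thesis .
  qed
  \<comment> \<open>Stated for nonnegative integrals, so that the order of integration can be
    exchanged before \<open>\<Delta>\<close> is known to be integrable; integrability is then a
    consequence.\<close>
  have \<Delta>_nn: "(\<integral>\<^sup>+x. ennreal (\<Delta> x) \<partial>Q) \<le> ennreal (\<beta> * c / (2 * real N))"
  proof -
    have "ennreal (\<Delta> x) = (\<integral>\<^sup>+z. ennreal (breg x z) \<partial>P)" for x
      unfolding \<Delta>_def by (intro nn_integral_eq_integral[symmetric] int_breg AE_I2 breg_nonneg)
    then have "(\<integral>\<^sup>+x. ennreal (\<Delta> x) \<partial>Q) = (\<integral>\<^sup>+x. (\<integral>\<^sup>+z. ennreal (breg x z) \<partial>P) \<partial>Q)" by simp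
    also have "\<dots> \<le> (\<integral>\<^sup>+x. (\<integral>\<^sup>+z. ennreal (\<beta>\<^sub>l / 2 * (s x z - a z)\<^sup>2) \<partial>P) \<partial>Q)"
      by (intro nn_integral_mono ennreal_leI breg_le)
    also have "\<dots> = (\<integral>\<^sup>+z. (\<integral>\<^sup>+x. ennreal (\<beta>\<^sub>l / 2 * (s x z - a z)\<^sup>2) \<partial>Q) \<partial>P)"
      using QP.Fubini'[OF sa_meas] by simp
    also have "\<dots> \<le> (\<integral>\<^sup>+z. ennreal (\<beta> * c / (2 * real N)) \<partial>P)"
      by (intro nn_integral_mono sa_integral)
    finally show ?thesis by (simp add: P.emeasure_space_1)
  qed
  have \<Delta>_int: "integrable Q \<Delta>"
    using \<Delta>_nn \<Delta>_nonneg by (intro integrableI_nonneg) (auto intro: le_less_trans)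
  obtain i0 where i0: "i0 \<in> {1..N}" using N by auto
  \<comment> \<open>\<open>ennreal\<close> sends negative reals to 0, so returning to a real
    inequality needs a nonnegative right-hand side; a variance below
    \<open>L\<^sub>h\<^sup>2 * c\<close> supplies the sign.\<close>
  have "0 \<le> \<beta> * c"
  proof -
    interpret \<pi>0: prob_space "\<pi> i0" by (rule P2D(1)[OF \<pi>_P2[OF i0]])
    have "0 \<le> (\<integral>x. (h x z0 - (\<integral>y. h y z0 \<partial>\<pi> i0))\<^sup>2 \<partial>\<pi> i0)" by simp
    also have "\<dots> \<le> L\<^sub>h\<^sup>2 * c" by (rule var_h[OF i0 z0])
    finally show ?thesis using nonneg by (simp add: \<beta> mult.commute[of _ "\<beta>\<^sub>l"] mult.assoc)
  qed
  then have \<Delta>_le: "(\<integral>x. \<Delta> x \<partial>Q) \<le> \<beta> * c / (2 * real N)"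
    using \<Delta>_nn \<Delta>_nonneg by (subst (asm) nn_integral_eq_integral[OF \<Delta>_int]) (auto simp: ennreal_le_iff)

  \<comment> \<open>Density relative to the product measure and conclusion\<close>
  define k where "k = 2 * real N / \<sigma>\<^sup>2"
  obtain c\<mu> where c\<mu>: "c\<mu> > 0" and "prob_space \<mu>"
    and \<mu>_eq: "\<mu> = density (Pi\<^sub>M {1..N} (\<lambda>_. lborel))
        (\<lambda>x. ennreal (c\<mu> * exp (- (\<Sum>i=1..N. V i (x i)) - k * F0 P l h (empirical N x))))"
    using \<mu> by (auto simp: has_density_propto_def k_def)
  have "\<exists>d>0. \<pi> i = density lborel (\<lambda>x. ennreal (d * exp (U i x)))" if "i \<in> {1..N}" for i
    using \<pi>_dens[OF that] by (auto simp: has_density_propto_def)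
  then obtain d where d: "\<And>i. i \<in> {1..N} \<Longrightarrow> d i > 0"
    and \<pi>_eq: "\<And>i. i \<in> {1..N} \<Longrightarrow> \<pi> i = density lborel (\<lambda>x. ennreal (d i * exp (U i x)))"
    by metis
  define E where "E i x = ennreal (d i * exp (U i x))" for i x
  have E_meas: "E i \<in> borel_measurable lborel" if "i \<in> {1..N}" for i
    unfolding E_def using U_meas[OF that] by measurable
  have Q_eq: "Q = density (Pi\<^sub>M {1..N} (\<lambda>_. lborel)) (\<lambda>x. \<Prod>i\<in>{1..N}. E i (x i))"
  proof -
    have eq: "\<pi> i = density lborel (E i)" if "i \<in> {1..N}" for i
      unfolding E_def by (rule \<pi>_eq[OF that])
    have "Q = Pi\<^sub>M {1..N} (\<lambda>i. density lborel (E i))"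
      unfolding Q_def by (rule PiM_cong[OF refl eq])
    also have "\<dots> = density (Pi\<^sub>M {1..N} (\<lambda>_. lborel)) (\<lambda>x. \<Prod>i\<in>{1..N}. E i (x i))"
    proof (rule PiM_density)
      fix i assume i: "i \<in> {1..N}"
      interpret prob_space "\<pi> i" by (rule P2D(1)[OF \<pi>_P2[OF i]])
      show "sigma_finite_measure (density lborel (E i))" unfolding eq[OF i, symmetric] ..
    qed (simp_all only: E_meas sigma_finite_lborel finite_atLeastAtMost)
    finally show ?thesis .
  qed
  \<comment> \<open>Gathers everything independent of \<open>x\<close>: the constant
    \<open>K\<close> of the expansion and the normalizations of \<open>\<mu>\<close> and of the
    \<open>\<pi> i\<close>.\<close>
  define w where "w = c\<mu> * exp (- k * K) / (\<Prod>i\<in>{1..N}. d i)"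
  have d_prod: "(\<Prod>i\<in>{1..N}. d i) > 0" using d by (intro prod_pos) auto
  have w: "w > 0" using c\<mu> d_prod by (simp add: w_def)
  have \<mu>_Q: "\<mu> = density Q (\<lambda>x. ennreal (w * exp (- k * \<Delta> x)))"
  proof -
    have "c\<mu> * exp (- (\<Sum>i=1..N. V i (x i)) - k * F0 P l h (empirical N x))
       = (\<Prod>i\<in>{1..N}. d i * exp (U i (x i))) * (w * exp (- k * \<Delta> x))" for x
    proof -
      \<comment> \<open>As \<open>k / N = 2 / \<sigma>^2\<close>, the linear part of
        \<open>F0\<close> is exactly the interaction term in the exponents of the
        \<open>\<pi> i\<close>.\<close>
      have "k * ((\<Sum>i=1..N. dF0 P l h m (x i)) / real N) = (\<Sum>i=1..N. 2 / \<sigma>\<^sup>2 * dF0 P l h m (x i))"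
      proof -
        have "k * (t / real N) = 2 / \<sigma>\<^sup>2 * t" for t using N by (simp add: k_def)
        then show ?thesis by (simp only: sum_distrib_left)
      qed
      then have "- (\<Sum>i=1..N. V i (x i)) - k * F0 P l h (empirical N x)
        = (\<Sum>i=1..N. U i (x i)) + (- k * K) + (- k * \<Delta> x)"
        unfolding F0_eq by (simp add: U_def sum_subtractf sum_negf distrib_left)
      then have "exp (- (\<Sum>i=1..N. V i (x i)) - k * F0 P l h (empirical N x))
        = (\<Prod>i\<in>{1..N}. exp (U i (x i))) * exp (- k * K) * exp (- k * \<Delta> x)"
        by (simp only: exp_add exp_sum finite_atLeastAtMost)
      note exp_eq = this
      have cancel: "c\<mu> * (A * e * f) = p * A * (c\<mu> * e / p * f)" if "p \<noteq> 0" for A e f p :: real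
        using that by simp
      show ?thesis
        unfolding exp_eq prod.distrib w_def by (rule cancel) (rule less_imp_neq[OF d_prod, symmetric])
    qed
    moreover have "ennreal ((\<Prod>i\<in>{1..N}. d i * exp (U i (x i))) * (w * exp (- k * \<Delta> x)))
        = (\<Prod>i\<in>{1..N}. E i (x i)) * ennreal (w * exp (- k * \<Delta> x))" for x
    proof -
      have "(\<Prod>i\<in>{1..N}. E i (x i)) = ennreal (\<Prod>i\<in>{1..N}. d i * exp (U i (x i)))"
        unfolding E_def using d by (intro prod_ennreal) (auto intro: mult_nonneg_nonneg less_imp_le)
      then show ?thesis using w by (subst ennreal_mult'') auto
    qed
    ultimately have "\<mu> = density (Pi\<^sub>M {1..N} (\<lambda>_. lborel))
        (\<lambda>x. (\<Prod>i\<in>{1..N}. E i (x i)) * ennreal (w * exp (- k * \<Delta> x)))"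
      unfolding \<mu>_eq by simp
    also have "\<dots> = density Q (\<lambda>x. ennreal (w * exp (- k * \<Delta> x)))"
      unfolding Q_eq
    proof (rule density_density_eq[symmetric])
      have "(\<lambda>x. E i (x i)) \<in> borel_measurable (Pi\<^sub>M {1..N} (\<lambda>_. lborel))" if "i \<in> {1..N}" for i
        using measurable_compose[OF measurable_component_singleton[OF that] E_meas[OF that]] .
      then show "(\<lambda>x. \<Prod>i\<in>{1..N}. E i (x i)) \<in> borel_measurable (Pi\<^sub>M {1..N} (\<lambda>_. lborel))"
        by (rule borel_measurable_prod_ennreal)
      have "sets (Pi\<^sub>M {1..N} (\<lambda>_. lborel)) = sets (Pi\<^sub>M {1..N} (\<lambda>_. borel :: (real^'d) measure))"
        by (intro sets_PiM_cong) auto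
      then show "(\<lambda>x. ennreal (w * exp (- k * \<Delta> x))) \<in> borel_measurable (Pi\<^sub>M {1..N} (\<lambda>_. lborel))"
        using \<Delta>_meas by (simp cong: measurable_cong_sets)
    qed
    finally show ?thesis .
  qed
  have "KL \<mu> Q \<le> ereal (k * (\<integral>x. \<Delta> x \<partial>Q))"
    unfolding \<mu>_Q
  proof (rule KL_gibbs_le)
    show "prob_space (density Q (\<lambda>x. ennreal (w * exp (- k * \<Delta> x))))"
      unfolding \<mu>_Q[symmetric] by fact
  qed (use \<Delta>_nonneg \<Delta>_int w in \<open>auto simp: k_def Q.prob_space_axioms\<close>)
  also have "k * (\<integral>x. \<Delta> x \<partial>Q) \<le> k * (\<beta> * c / (2 * real N))"
    by (intro mult_left_mono \<Delta>_le) (simp add: k_def)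
  also have "k * (\<beta> * c / (2 * real N)) = \<beta> / \<sigma>\<^sup>2 * c"
    using N by (simp add: k_def)
  finally show ?thesis by (simp add: Q_def c_def)
qed

end
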